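(* Let $\lambda$ be a fixed even partition such that all zeros of $H=H_\lambda$ are simple, and let $m=\deg H=|\lambda|$. If $n$ is large enough, then the logarithmic energy function $\log T_{w_1}$ on $\mathbb{R}^n$ with respect to the weight $w_1:=wP_m^2$ on $\mathbb{R}$, where $$T_{w_1}(u_1,\dots,u_n)=\prod_{i=1}^nw_1(u_i)\prod_{1\le i<j\le n}(u_i-u_j)^2,$$ attains its maximum at a unique set $\{u_1,\dots,u_n\}\subset\mathbb{R}$, which is the set of the regular zeros $x_1,\dots,x_n$ of the exceptional Hermite polynomial $P_{m,m+n}$.
   Context: A partition of length $r$ is $\lambda=(\lambda_1\ge\dots\ge\lambda_r\ge 1)$, $|\lambda|=\sum_i\lambda_i$. It is even if $r$ is even and $\lambda_{2k-1}=\lambda_{2k}$ for $k=1,\dots,r/2$. With $H_j$ the classical Hermite polynomials (orthogonal with respect to $e^{-x^2}$ on $\mathbb{R}$) and $\mathrm{Wr}$ the Wronskian determinant, the generalized Hermite polynomial is $H_\lambda=\mathrm{Wr}[H_{\lambda_r},\dots,H_{\lambda_2+r-2},H_{\lambda_1+r-1}]$, of degree $|\lambda|$; for even $\lambda$ it has no real zeros. Write $H=H_\lambda$, $m=\deg H=|\lambda|$, and $w(x)=e^{-x^2}/H(x)^2$ for $x\in\mathbb{R}$. Let $n\ge\lambda_1$. The exceptional Hermite polynomial of degree $m+n$ is $P_{m,m+n}=\mathrm{Wr}[H_{\lambda_r},\dots,H_{\lambda_2+r-2},H_{\lambda_1+r-1},H_{n+r}]$. Known: for $n$ large it has exactly $m$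 non-real ("exceptional") zeros $z_1,\dots,z_m$ and $n$ real ("regular") zeros $x_1,\dots,x_n$. Write $P_{m,m+n}=P_mq_n$ with real polynomials $P_m,q_n$, where the zeros of $P_m$ are $z_1,\dots,z_m$ and the zeros of $q_n$ are $x_1,\dots,x_n$. *)

theory Defs
  imports
    "HOL-Analysis.Derivative"
    "HOL-Library.Extended_Real"
    "HOL-Library.FuncSet"
    "HOL-Computational_Algebra.Polynomial"
    "Jordan_Normal_Form.Determinant"
begin

text \<open>The recursion is the one obtained by differentiating
  $H_n(x) e^{-x^2} = (-1)^n (d/dx)^n e^{-x^2}$; see \<open>hermite_rodrigues\<close>.\<close>

fun hermite :: "nat \<Rightarrow> real poly" where
  "hermite 0 = 1"
| "hermite (Suc n) = [:0, 2:] * hermite n - pderiv (hermite n)"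

lemma hermite_rodrigues:
  "(deriv ^^ n) (\<lambda>x::real. exp (- x\<^sup>2)) = (\<lambda>x. (- 1) ^ n * poly (hermite n) x * exp (- x\<^sup>2))"
proof (induction n)
  case 0
  show ?case by simp
next
  case (Suc n)
  have "((\<lambda>x::real. (- 1) ^ n * poly (hermite n) x * exp (- x\<^sup>2)) has_field_derivative
      (- 1) ^ Suc n * poly (hermite (Suc n)) x * exp (- x\<^sup>2)) (at x)" for x :: real
    by (auto intro!: derivative_eq_intros simp: algebra_simps)
  then show ?case
    using Suc.IH by (auto intro!: DERIV_imp_deriv)
qed

definition wronskian :: "real poly list \<Rightarrow> real poly" where
  "wronskian fs =
     Determinant.det (mat (length fs) (length fs) (\<lambda>(i, j). (pderiv ^^ i) (fs ! j)))"

text \<open>A partition $\lambda_1 \ge \dots \ge \lambda_r \ge 1$ is the list of its parts, so that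
  $\lambda_i$ is \<open>la ! (i - 1)\<close>. The empty partition is allowed.\<close>

definition partition_list :: "nat list \<Rightarrow> bool" where
  "partition_list la \<longleftrightarrow> sorted_wrt (\<ge>) la \<and> (\<forall>a \<in> set la. 1 \<le> a)"

definition even_partition :: "nat list \<Rightarrow> bool" where
  "even_partition la \<longleftrightarrow> partition_list la \<and> even (length la) \<and>
     (\<forall>k \<in> {1..length la div 2}. la ! (2 * k - 1 - 1) = la ! (2 * k - 1))"

text \<open>$H_{\lambda_r}, \dots, H_{\lambda_2 + r - 2}, H_{\lambda_1 + r - 1}$, in this order.\<close>

definition hermite_seq :: "nat list \<Rightarrow> real poly list" where
  "hermite_seq la = map (\<lambda>k. hermite (rev la ! k + k)) [0..<length la]"

definition gen_hermite :: "nat list \<Rightarrow> real poly" where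
  "gen_hermite la = wronskian (hermite_seq la)"

definition exc_hermite :: "nat list \<Rightarrow> nat \<Rightarrow> real poly" where
  "exc_hermite la n = wronskian (hermite_seq la @ [hermite (n + length la)])"

definition exc_weight :: "nat list \<Rightarrow> real \<Rightarrow> real" where
  "exc_weight la x = exp (- x\<^sup>2) / (poly (gen_hermite la) x)\<^sup>2"

text \<open>The factorization of a real polynomial \<open>P\<close> into a real factor \<open>Pm\<close> that carries the
  non-real zeros and a real factor \<open>qn\<close> that carries the real ones. For \<open>P \<noteq> 0\<close> it exists and is
  unique up to real constants.\<close>

definition nonreal_real_factorization :: "real poly \<Rightarrow> real poly \<Rightarrow> real poly \<Rightarrow> bool" where
  "nonreal_real_factorization P Pm qn \<longleftrightarrow> P = Pm * qn \<and>
     (\<forall>z. poly (map_poly complex_of_real Pm) z = 0 \<longrightarrow> z \<notin> \<real>) \<and>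
     (\<forall>z. poly (map_poly complex_of_real qn) z = 0 \<longrightarrow> z \<in> \<real>)"

text \<open>A point $(u_1, \dots, u_n)$ of $\mathbb{R}^n$ is a function \<open>u \<in> real_space n\<close> with
  \<open>u i\<close> in the role of $u_{i+1}$.\<close>

definition real_space :: "nat \<Rightarrow> (nat \<Rightarrow> real) set" where
  "real_space n = {..<n} \<rightarrow>\<^sub>E UNIV"

definition energy_T :: "(real \<Rightarrow> real) \<Rightarrow> nat \<Rightarrow> (nat \<Rightarrow> real) \<Rightarrow> real" where
  "energy_T w n u = (\<Prod>i<n. w (u i)) * (\<Prod>j<n. \<Prod>i<j. (u i - u j)\<^sup>2)"

text \<open>Extended real valued, since $T_w(u) = 0$ when two points coincide, while \<open>ln 0 = 0\<close>
  for the real logarithm of the library.\<close>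

definition log_energy :: "(real \<Rightarrow> real) \<Rightarrow> nat \<Rightarrow> (nat \<Rightarrow> real) \<Rightarrow> ereal" where
  "log_energy w n u = (if energy_T w n u = 0 then - \<infinity> else ereal (ln (energy_T w n u)))"

definition attains_max_at :: "('a \<Rightarrow> 'b::linorder) \<Rightarrow> 'a set \<Rightarrow> 'a \<Rightarrow> bool" where
  "attains_max_at f A u \<longleftrightarrow> u \<in> A \<and> (\<forall>v \<in> A. f v \<le> f u)"

end

theory Submission
  imports
    "HOL-Probability.Distributions"
    "HOL-Complex_Analysis.Conformal_Mappings"
    "HOL-Real_Asymp.Real_Asymp"
    "HOL-Computational_Algebra.Formal_Power_Series"
    "HOL-Computational_Algebra.Fundamental_Theorem_Algebra"
    Defs
begin

text \<open>At a regular zero the differential equation of the exceptional polynomial is the critical point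
  equation of the logarithmic energy, so it suffices that \<open>ln w\<^sub>1\<close> is strictly concave: then every
  ordered critical configuration is the unique maximum. The second derivative of \<open>ln w\<^sub>1\<close> is \<open>-2\<close> plus
  a multiple of the difference of \<open>\<Sum> 1/(x - \<zeta>)\<^sup>2\<close> over the zeros of \<open>H\<close> and over the exceptional zeros,
  and the latter converge to the former. Indeed, expanding the Wronskian along its last column and
  using the three-term recurrence, the exceptional polynomial is close to a multiple of \<open>H H\<^sub>n\<close>: off the
  real line this gives, by the maximum principle, a zero near each of the \<open>m\<close> simple zeros of \<open>H\<close>, and on
  the real line it gives \<open>n\<close> sign changes at the critical points of \<open>H\<^sub>n\<close>. That \<open>H\<close> has no real zeros is
  the Krein--Adler theorem.\<close>

section \<open>Determinants of functions\<close>

text \<open>The comparison with \<open>hermite n\<close> has to hold on an interval growing like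
  \<open>sqrt n\<close>, and quotients by \<open>hermite n\<close> break down at its zeros. On the
  real line the comparison is therefore made at finitely many points only: the critical points of
  \<open>hermite n\<close>, where the derivative in the error term drops out, and the two ends
  \<open>-sqrt (2 n)\<close> and \<open>sqrt (2 n)\<close>, where the smaller degree of the
  cofactors compensates for a derivative that is not small. Off the line a fixed small disc
  suffices, since there the logarithmic derivative of \<open>hermite n\<close> is only of order
  \<open>sqrt n\<close>. The zeros are then pinned down by counting: \<open>n\<close> sign changes
  and one zero near each of the \<open>m\<close> simple zeros of \<open>H\<close> exhaust the degree
  bound \<open>m + n\<close>, so there are no others and all are simple. Evenness enters through the
  exponents of the Wronskian: they come in pairs of consecutive integers, so an even number of them
  lies above every gap.\<close>

definition fdet :: "nat \<Rightarrow> (nat \<Rightarrow> nat \<Rightarrow> 'a::comm_ring_1) \<Rightarrow> 'a" where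
  "fdet n a = Determinant.det (Matrix.mat n n (\<lambda>(i, j). a i j))"

lemma fdet_leibniz:
  "fdet n a = (\<Sum>p | p permutes {0..<n}. signof p * (\<Prod>i=0..<n. a i (p i)))"
proof -
  have "(\<Prod>i=0..<n. Matrix.mat n n (\<lambda>(i, j). a i j) $$ (i, p i)) = (\<Prod>i=0..<n. a i (p i))"
    if "p permutes {0..<n}" for p
    using permutes_in_image[OF that] by (intro prod.cong) auto
  then show ?thesis
    unfolding fdet_def by (subst det_def'[of _ n]) (auto intro!: sum.cong)
qed

lemma fdet_cong:
  assumes "\<And>i j. i < n \<Longrightarrow> j < n \<Longrightarrow> a i j = b i j"
  shows "fdet n a = fdet n b"
  unfolding fdet_def using assms by (intro arg_cong[of _ _ Determinant.det] eq_matI) auto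

lemma fdet_transpose: "fdet n (\<lambda>i j. a j i) = fdet n a"
proof -
  have "Matrix.mat n n (\<lambda>(i, j). a j i) = transpose_mat (Matrix.mat n n (\<lambda>(i, j). a i j))"
    by (intro eq_matI) auto
  then show ?thesis
    unfolding fdet_def using det_transpose[of "Matrix.mat n n (\<lambda>(i, j). a i j)" n] by simp
qed

lemma fdet_0_iff:
  fixes a :: "nat \<Rightarrow> nat \<Rightarrow> 'a::idom"
  shows "fdet n a = 0 \<longleftrightarrow> (\<exists>v. (\<exists>j<n. v j \<noteq> 0) \<and> (\<forall>i<n. (\<Sum>j<n. a i j * v j) = 0))"
proof
  assume "fdet n a = 0"
  then obtain v where v: "v \<in> carrier_vec n" "v \<noteq> 0\<^sub>v n"
      and z: "Matrix.mat n n (\<lambda>(i, j). a i j) *\<^sub>v v = 0\<^sub>v n"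
    unfolding fdet_def by (subst (asm) det_0_iff_vec_prod_zero[of _ n]) auto
  have "\<exists>j<n. vec_index v j \<noteq> 0"
    using v by (metis carrier_vecD eq_vecI index_zero_vec(1) index_zero_vec(2))
  moreover have "(\<Sum>j<n. a i j * vec_index v j) = 0" if "i < n" for i
  proof -
    have "(\<Sum>j<n. a i j * vec_index v j) = vec_index (Matrix.mat n n (\<lambda>(i, j). a i j) *\<^sub>v v) i"
      using that v(1) by (simp add: scalar_prod_def lessThan_atLeast0)
    then show ?thesis using z that by simp
  qed
  ultimately show "\<exists>v. (\<exists>j<n. v j \<noteq> 0) \<and> (\<forall>i<n. (\<Sum>j<n. a i j * v j) = 0)" by blast
next
  assume "\<exists>v. (\<exists>j<n. v j \<noteq> 0) \<and> (\<forall>i<n. (\<Sum>j<n. a i j * v j) = 0)"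
  then obtain v where v: "\<exists>j<n. v j \<noteq> 0" "\<And>i. i < n \<Longrightarrow> (\<Sum>j<n. a i j * v j) = 0" by blast
  have "Matrix.vec n v \<noteq> 0\<^sub>v n"
    using v(1) by (metis index_vec index_zero_vec(1))
  moreover have "Matrix.mat n n (\<lambda>(i, j). a i j) *\<^sub>v Matrix.vec n v = 0\<^sub>v n"
    using v(2) by (intro eq_vecI) (auto simp: scalar_prod_def lessThan_atLeast0)
  ultimately show "fdet n a = 0"
    unfolding fdet_def by (subst det_0_iff_vec_prod_zero[of _ n]) (auto intro!: exI[of _ "Matrix.vec n v"])
qed

lemma fdet_laplace_last_column:
  "fdet (Suc n) a = (\<Sum>i\<le>n. (- 1) ^ (i + n) * a i n * fdet n (\<lambda>i' j. a (if i' < i then i' else Suc i') j))"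
proof -
  let ?A = "Matrix.mat (Suc n) (Suc n) (\<lambda>(i, j). a i j)"
  have "fdet (Suc n) a = (\<Sum>i<Suc n. ?A $$ (i, n) * cofactor ?A i n)"
    unfolding fdet_def by (rule laplace_expansion_column) auto
  also have "\<dots> = (\<Sum>i\<le>n. (- 1) ^ (i + n) * a i n * fdet n (\<lambda>i' j. a (if i' < i then i' else Suc i') j))"
    unfolding lessThan_Suc_atMost
  proof (intro sum.cong refl, goal_cases)
    case (1 i)
    have "mat_delete ?A i n = Matrix.mat n n (\<lambda>(i', j). a (if i' < i then i' else Suc i') j)"
      unfolding mat_delete_def by (intro eq_matI) auto
    with 1 show ?case by (simp add: cofactor_def fdet_def)
  qed
  finally show ?thesis .
qed

text \<open>The right-hand side is \<open>w\<close> times the last unit vector, so the column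
  inserted by Cramer's rule leaves a single minor. The form without division suits any commutative
  ring.\<close>

lemma fdet_cramer_last:
  assumes "\<And>i. i \<le> n \<Longrightarrow> (\<Sum>j\<le>n. a i j * v j) = (if i = n then w else 0)"
  shows "v n * fdet (Suc n) a = w * fdet n a"
proof -
  let ?A = "Matrix.mat (Suc n) (Suc n) (\<lambda>(i, j). a i j)"
  let ?b = "\<lambda>i j. if j = n then if i = n then w else 0 else a i j"
  have "Matrix.mat (Suc n) (Suc n) (\<lambda>(i, j). ?b i j) = replace_col ?A (?A *\<^sub>v Matrix.vec (Suc n) v) n"
    unfolding replace_col_def using assms
    by (intro eq_matI) (auto simp: scalar_prod_def atLeast0LessThan lessThan_Suc_atMost less_Suc_eq_le)
  then have "v n * fdet (Suc n) a = fdet (Suc n) ?b"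
    using cramer_lemma_mat[of ?A "Suc n" "Matrix.vec (Suc n) v" n] by (simp add: fdet_def)
  also have "\<dots> = (\<Sum>i\<le>n. if i = n then w * fdet n (\<lambda>i' j. ?b (if i' < i then i' else Suc i') j) else 0)"
    unfolding fdet_laplace_last_column[of n ?b]
    by (intro sum.cong refl) (auto simp flip: power_add mult_2)
  also have "\<dots> = w * fdet n a"
    by (auto intro!: arg_cong[of _ _ "\<lambda>x. w * x"] fdet_cong)
  finally show ?thesis .
qed

lemma fdet_row_linear:
  assumes "k < n"
  shows "fdet n (a(k := \<lambda>j. u j + c * v j)) = fdet n (a(k := u)) + c * fdet n (a(k := v))"
proof -
  have *: "(\<Prod>i=0..<n. (a(k := w)) i (p i)) = w (p k) * (\<Prod>i\<in>{0..<n} - {k}. a i (p i))" for w p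
    using assms by (subst prod.remove[of _ k]) auto
  show ?thesis
    unfolding fdet_leibniz * by (simp add: algebra_simps sum.distrib sum_distrib_left)
qed

lemma fdet_identical_rows:
  assumes "i < n" "k < n" "i \<noteq> k" "\<And>j. j < n \<Longrightarrow> a i j = a k j"
  shows "fdet n a = 0"
  unfolding fdet_def
  by (rule det_identical_rows[of _ n i k]) (use assms in \<open>auto intro!: eq_vecI\<close>)

lemma fdet_swap_rows:
  assumes "i < n" "k < n" "i \<noteq> k"
  shows "fdet n (a(i := u, k := v)) = - fdet n (a(i := v, k := u))"
proof -
  \<comment> \<open>The factor 1 only brings the sum into the shape of
    \<open>fdet_row_linear\<close>.\<close>
  let ?s = "\<lambda>j. u j + 1 * v j"
  have "0 = fdet n (a(i := ?s, k := ?s))"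
    using assms by (intro fdet_identical_rows[symmetric, of i _ k]) auto
  also have "\<dots> = fdet n (a(i := ?s, k := u)) + 1 * fdet n (a(i := ?s, k := v))"
    using assms by (intro fdet_row_linear) auto
  also have "a(i := ?s, k := u) = (a(k := u))(i := ?s)" using assms by auto
  also have "a(i := ?s, k := v) = (a(k := v))(i := ?s)" using assms by auto
  also have "fdet n ((a(k := u))(i := ?s)) = fdet n ((a(k := u))(i := u)) + 1 * fdet n ((a(k := u))(i := v))"
    using assms by (intro fdet_row_linear) auto
  also have "fdet n ((a(k := v))(i := ?s)) = fdet n ((a(k := v))(i := u)) + 1 * fdet n ((a(k := v))(i := v))"
    using assms by (intro fdet_row_linear) auto
  also have "fdet n ((a(k := u))(i := u)) = 0"
    using assms by (intro fdet_identical_rows[of i _ k]) auto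
  also have "fdet n ((a(k := v))(i := v)) = 0"
    using assms by (intro fdet_identical_rows[of i _ k]) auto
  also have "(a(k := u))(i := v) = a(i := v, k := u)" using assms by auto
  also have "(a(k := v))(i := u) = a(i := u, k := v)" using assms by auto
  finally show ?thesis by (simp only: mult_1 add_0_left add_0_right) (metis minus_unique)
qed

text \<open>The trace of a diagonal matrix acts on a determinant as a derivation on the rows.\<close>

lemma fdet_scale_rows_sum:
  "(\<Sum>k<n. fdet n (a(k := \<lambda>j. m j * a k j))) = (\<Sum>j<n. m j) * fdet n a"
proof -
  have *: "(\<Prod>i=0..<n. (a(k := \<lambda>j. m j * a k j)) i (p i)) = m (p k) * (\<Prod>i=0..<n. a i (p i))"
    if "k < n" for p k
  proof -
    have "(\<Prod>i=0..<n. (a(k := \<lambda>j. m j * a k j)) i (p i)) =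
        (m (p k) * a k (p k)) * (\<Prod>i\<in>{0..<n} - {k}. (a(k := \<lambda>j. m j * a k j)) i (p i))"
      using that by (subst prod.remove[of _ k]) auto
    also have "(\<Prod>i\<in>{0..<n} - {k}. (a(k := \<lambda>j. m j * a k j)) i (p i)) = (\<Prod>i\<in>{0..<n} - {k}. a i (p i))"
      by (intro prod.cong) auto
    also have "(m (p k) * a k (p k)) * \<dots> = m (p k) * (\<Prod>i=0..<n. a i (p i))"
      using that by (subst prod.remove[of "{0..<n}" k]) (auto simp: mult.assoc)
    finally show ?thesis .
  qed
  have **: "(\<Sum>k<n. m (p k)) = (\<Sum>j<n. m j)" if "p permutes {0..<n}" for p
    using sum.permute[OF that, of m] by (simp add: atLeast0LessThan comp_def)
  have "(\<Sum>k<n. fdet n (a(k := \<lambda>j. m j * a k j))) =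
     (\<Sum>k<n. \<Sum>p | p permutes {0..<n}. m (p k) * (signof p * (\<Prod>i=0..<n. a i (p i))))"
    unfolding fdet_leibniz using * by (intro sum.cong refl) (auto simp: mult_ac)
  also have "\<dots> = (\<Sum>p | p permutes {0..<n}. (\<Sum>k<n. m (p k)) * (signof p * (\<Prod>i=0..<n. a i (p i))))"
    by (subst sum.swap) (simp add: sum_distrib_right)
  also have "\<dots> = (\<Sum>j<n. m j) * fdet n a"
    unfolding fdet_leibniz using ** by (simp add: sum_distrib_left)
  finally show ?thesis .
qed

lemma poly_fdet: "poly (fdet n a) x = fdet n (\<lambda>i j. poly (a i j) x)"
proof -
  have "poly (signof p) x = signof p" for p
    by (simp add: sign_def)
  then show ?thesis
    by (simp add: fdet_leibniz poly_sum poly_prod)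
qed

lemma pderiv_fdet:
  fixes a :: "nat \<Rightarrow> nat \<Rightarrow> 'a::idom poly"
  shows "pderiv (fdet n a) = (\<Sum>k<n. fdet n (a(k := \<lambda>j. pderiv (a k j))))"
proof -
  have s: "pderiv (signof p * q) = signof p * pderiv q" for p and q :: "'a poly"
    by (simp add: sign_def pderiv_minus)
  have *: "(\<Prod>i=0..<n. (a(k := \<lambda>j. pderiv (a k j))) i (p i)) =
     (\<Prod>i\<in>{0..<n} - {k}. a i (p i)) * pderiv (a k (p k))" if "k < n" for p k
    using that by (subst prod.remove[of _ k]) (auto simp: mult.commute)
  have sum: "pderiv (sum f A) = (\<Sum>p\<in>A. pderiv (f p))" for f :: "(nat \<Rightarrow> nat) \<Rightarrow> 'a poly" and A
    by (induction A rule: infinite_finite_induct) (auto simp: pderiv_add)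
  have "pderiv (fdet n a) = (\<Sum>p | p permutes {0..<n}. \<Sum>k<n.
      signof p * ((\<Prod>i\<in>{0..<n} - {k}. a i (p i)) * pderiv (a k (p k))))"
    by (simp add: fdet_leibniz sum s pderiv_prod sum_distrib_left atLeast0LessThan)
  also have "\<dots> = (\<Sum>p | p permutes {0..<n}. \<Sum>k<n.
      signof p * (\<Prod>i=0..<n. (a(k := \<lambda>j. pderiv (a k j))) i (p i)))"
    by (intro sum.cong refl arg_cong[of _ _ "\<lambda>z. signof _ * z"]) (rule *[symmetric], simp)
  also have "\<dots> = (\<Sum>k<n. fdet n (a(k := \<lambda>j. pderiv (a k j))))"
    unfolding fdet_leibniz by (rule sum.swap)
  finally show ?thesis .
qed

section \<open>Hermite polynomials and their Wronskians\<close>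

declare hermite.simps(2) [simp del]

lemma pderiv_linear_mult:
  "pderiv ([:0, c:] * p) = [:0, c:] * pderiv p + Polynomial.smult c p" for c :: "'a::idom"
  by (simp only: pderiv_mult) (simp add: pderiv_pCons)

lemma pderiv_hermite_Suc: "pderiv (hermite (Suc n)) = Polynomial.smult (2 * (real n + 1)) (hermite n)"
proof (induction n)
  case 0
  then show ?case by (simp add: hermite.simps(2) pderiv_pCons)
next
  case (Suc n)
  have "pderiv (hermite (Suc (Suc n))) =
      [:0, 2:] * pderiv (hermite (Suc n)) + Polynomial.smult 2 (hermite (Suc n)) - pderiv (pderiv (hermite (Suc n)))"
    unfolding hermite.simps(2)[of "Suc n"] pderiv_diff pderiv_linear_mult ..
  also have "\<dots> = Polynomial.smult (2 * (real n + 1)) ([:0, 2:] * hermite n - pderiv (hermite n))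
      + Polynomial.smult 2 (hermite (Suc n))"
    unfolding Suc.IH by (simp only: pderiv_smult smult_diff_right mult_smult_right)
  also have "\<dots> = Polynomial.smult (2 * (real (Suc n) + 1)) (hermite (Suc n))"
    unfolding hermite.simps(2)[symmetric] smult_add_left[symmetric] by (simp add: algebra_simps)
  finally show ?case .
qed

text \<open>Differentiating the recursion gives one expression for the derivative of
  \<open>hermite (Suc n)\<close>, and \<open>pderiv_hermite_Suc\<close> gives another.\<close>

lemma hermite_ode:
  "pderiv (pderiv (hermite n)) = [:0, 2:] * pderiv (hermite n) - Polynomial.smult (2 * real n) (hermite n)"
proof -
  have "Polynomial.smult (2 * (real n + 1)) (hermite n) = pderiv ([:0, 2:] * hermite n - pderiv (hermite n))"
    using pderiv_hermite_Suc[of n] unfolding hermite.simps(2) by simp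
  also have "\<dots> = [:0, 2:] * pderiv (hermite n) + Polynomial.smult 2 (hermite n) - pderiv (pderiv (hermite n))"
    unfolding pderiv_diff pderiv_linear_mult ..
  also have "Polynomial.smult (2 * (real n + 1)) (hermite n) =
      Polynomial.smult (2 * real n) (hermite n) + Polynomial.smult 2 (hermite n)"
    unfolding smult_add_left[symmetric] by simp
  finally show ?thesis
    by (simp only: algebra_simps)
qed

text \<open>Each differentiation of Hermite's equation shifts its eigenvalue by 2. Solved for the
  lowest derivative, this becomes the downward recurrence in
  \<open>norm_exc_minus_le\<close>.\<close>

lemma hermite_ode_higher:
  "(pderiv ^^ Suc (Suc j)) (hermite n) =
     [:0, 2:] * (pderiv ^^ Suc j) (hermite n)
      + Polynomial.smult (2 * real j - 2 * real n) ((pderiv ^^ j) (hermite n))"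
proof (induction j)
  case 0
  then show ?case by (simp add: hermite_ode)
next
  case (Suc j)
  have "(pderiv ^^ Suc (Suc (Suc j))) (hermite n) = pderiv ([:0, 2:] * (pderiv ^^ Suc j) (hermite n)
      + Polynomial.smult (2 * real j - 2 * real n) ((pderiv ^^ j) (hermite n)))"
    using Suc.IH by simp
  also have "\<dots> = [:0, 2:] * (pderiv ^^ Suc (Suc j)) (hermite n) + (Polynomial.smult 2 ((pderiv ^^ Suc j) (hermite n))
      + Polynomial.smult (2 * real j - 2 * real n) ((pderiv ^^ Suc j) (hermite n)))"
    unfolding pderiv_add pderiv_linear_mult pderiv_smult by (simp only: funpow.simps comp_def add.assoc)
  also have "Polynomial.smult 2 ((pderiv ^^ Suc j) (hermite n))
      + Polynomial.smult (2 * real j - 2 * real n) ((pderiv ^^ Suc j) (hermite n)) =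
      Polynomial.smult (2 * real (Suc j) - 2 * real n) ((pderiv ^^ Suc j) (hermite n))"
    unfolding smult_add_left[symmetric] by (simp add: algebra_simps)
  finally show ?case .
qed

lemma higher_pderiv_hermite:
  "(pderiv ^^ j) (hermite (n + j)) = Polynomial.smult (2 ^ j * fact (n + j) / fact n) (hermite n)"
proof (induction j)
  case (Suc j)
  have "(pderiv ^^ Suc j) (hermite (n + Suc j)) = (pderiv ^^ j) (pderiv (hermite (Suc (n + j))))"
    by (simp add: funpow_swap1)
  also have "\<dots> = Polynomial.smult (2 * (real (n + j) + 1)) ((pderiv ^^ j) (hermite (n + j)))"
    unfolding pderiv_hermite_Suc by (simp add: higher_pderiv_smult)
  finally show ?case unfolding Suc.IH by (simp add: field_simps)
qed simp

lemma degree_hermite [simp]: "degree (hermite n) = n"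
  and lead_coeff_hermite: "coeff (hermite n) n = 2 ^ n"
proof -
  have *: "degree (hermite n) = n \<and> coeff (hermite n) n = 2 ^ n"
  proof (induction n)
    case (Suc n)
    have c: "coeff (hermite (Suc n)) (Suc n) = 2 ^ Suc n"
      using Suc by (simp add: hermite.simps(2) coeff_pderiv coeff_eq_0)
    have "degree (hermite (Suc n)) \<le> Suc n"
    proof (rule degree_le, intro allI impI)
      fix i assume i: "i > Suc n"
      then obtain i' where "i = Suc i'" by (cases i) auto
      with i Suc show "coeff (hermite (Suc n)) i = 0"
        by (simp add: hermite.simps(2) coeff_pderiv coeff_eq_0)
    qed
    moreover have "Suc n \<le> degree (hermite (Suc n))"
      by (rule le_degree) (simp add: c)
    ultimately show ?case using c by simp
  qed simp
  then show "degree (hermite n) = n" "coeff (hermite n) n = 2 ^ n" by auto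
qed

lemma higher_pderiv_hermite_0:
  assumes "k < i"
  shows "(pderiv ^^ i) (hermite k) = 0"
proof -
  obtain j where j: "i = j + Suc k" by (metis add.commute add_Suc_right less_imp_Suc_add assms)
  have "(pderiv ^^ Suc k) (hermite k) = 0"
    using higher_pderiv_hermite[of k 0] by (simp add: pderiv_smult)
  then show ?thesis
    unfolding j funpow_add by (simp add: o_def del: funpow.simps)
qed

text \<open>Row \<open>i\<close> carries the derivative of order \<open>s i\<close>;
  \<open>s = id\<close> is the Wronskian. General orders make the family closed under
  differentiation and let it contain the cofactors of a Wronskian.\<close>

definition hdet :: "nat \<Rightarrow> (nat \<Rightarrow> nat) \<Rightarrow> (nat \<Rightarrow> nat) \<Rightarrow> real poly" where
  "hdet n \<kappa> s = fdet n (\<lambda>i j. (pderiv ^^ s i) (hermite (\<kappa> j)))"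

lemma hdet_cong:
  "(\<And>i. i < n \<Longrightarrow> s i = t i) \<Longrightarrow> (\<And>j. j < n \<Longrightarrow> \<kappa> j = \<mu> j) \<Longrightarrow> hdet n \<kappa> s = hdet n \<mu> t"
  unfolding hdet_def by (rule fdet_cong) auto

lemma hdet_repeated: "i < n \<Longrightarrow> k < n \<Longrightarrow> i \<noteq> k \<Longrightarrow> s i = s k \<Longrightarrow> hdet n \<kappa> s = 0"
  unfolding hdet_def by (rule fdet_identical_rows[of i n k]) auto

lemma hdet_swap:
  assumes "i < n" "k < n" "i \<noteq> k"
  shows "hdet n \<kappa> (s(i := a, k := b)) = - hdet n \<kappa> (s(i := b, k := a))"
proof -
  let ?m = "\<lambda>i j. (pderiv ^^ s i) (hermite (\<kappa> j))"
  have "hdet n \<kappa> (s(i := a, k := b)) =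
      fdet n (?m(i := \<lambda>j. (pderiv ^^ a) (hermite (\<kappa> j)), k := \<lambda>j. (pderiv ^^ b) (hermite (\<kappa> j))))" for a b
    unfolding hdet_def by (rule fdet_cong) auto
  then show ?thesis using fdet_swap_rows[OF assms] by metis
qed

lemma pderiv_hdet: "pderiv (hdet n \<kappa> s) = (\<Sum>k<n. hdet n \<kappa> (s(k := Suc (s k))))"
  unfolding hdet_def pderiv_fdet by (intro sum.cong refl fdet_cong) auto

text \<open>Hermite's equation rewrites each row raised by two. Its eigenvalue
  \<open>-2 * \<kappa> j\<close> depends on the column and does not factor out of a single row, but
  summed over all rows it acts as the trace of a diagonal matrix, by
  \<open>fdet_scale_rows_sum\<close>.\<close>

lemma hdet_eigen:
  "(\<Sum>k<n. hdet n \<kappa> (s(k := Suc (Suc (s k))))) = [:0, 2:] * pderiv (hdet n \<kappa> s)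
     + Polynomial.smult (2 * (\<Sum>k<n. real (s k)) - 2 * (\<Sum>j<n. real (\<kappa> j))) (hdet n \<kappa> s)"
proof -
  have aux: "[:- 2 * k:] * p0 = (([:0, 2:] * p1 + Polynomial.smult (2 * t - 2 * k) p0) + (- [:0, 2:]) * p1)
      + (- [:2 * t:]) * p0" for k t :: real and p0 p1
    by (rule poly_ext) (simp add: algebra_simps)
  define d where "d = (\<lambda>t j. (pderiv ^^ t) (hermite (\<kappa> j)))"
  define m where "m = (\<lambda>i. d (s i))"
  have m: "hdet n \<kappa> s = fdet n m"
    unfolding hdet_def m_def d_def ..
  have upd: "fdet n (m(k := d t)) = hdet n \<kappa> (s(k := t))" for k t
    unfolding hdet_def m_def d_def by (rule fdet_cong) auto
  have row: "fdet n (m(k := \<lambda>j. [:- 2 * real (\<kappa> j):] * m k j)) =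
      hdet n \<kappa> (s(k := Suc (Suc (s k)))) - [:0, 2:] * hdet n \<kappa> (s(k := Suc (s k)))
       - [:2 * real (s k):] * hdet n \<kappa> s" if "k < n" for k
  proof -
    have "(\<lambda>j. [:- 2 * real (\<kappa> j):] * m k j) =
       (\<lambda>j. (d (Suc (Suc (s k))) j + (- [:0, 2:]) * d (Suc (s k)) j) + (- [:2 * real (s k):]) * d (s k) j)"
      unfolding m_def d_def hermite_ode_higher by (rule ext) (rule aux)
    then have "fdet n (m(k := \<lambda>j. [:- 2 * real (\<kappa> j):] * m k j)) =
        fdet n (m(k := \<lambda>j. (d (Suc (Suc (s k))) j + (- [:0, 2:]) * d (Suc (s k)) j) + (- [:2 * real (s k):]) * d (s k) j))"
      by (rule arg_cong)
    also have "\<dots> = fdet n (m(k := \<lambda>j. d (Suc (Suc (s k))) j + (- [:0, 2:]) * d (Suc (s k)) j))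
         + (- [:2 * real (s k):]) * fdet n (m(k := d (s k)))"
      by (rule fdet_row_linear[OF that])
    also have "fdet n (m(k := \<lambda>j. d (Suc (Suc (s k))) j + (- [:0, 2:]) * d (Suc (s k)) j)) =
        fdet n (m(k := d (Suc (Suc (s k))))) + (- [:0, 2:]) * fdet n (m(k := d (Suc (s k))))"
      by (rule fdet_row_linear[OF that])
    finally show ?thesis
      by (simp only: upd minus_mult_left[symmetric] diff_conv_add_uminus fun_upd_triv)
  qed
  have "(\<Sum>j<n. [:- 2 * real (\<kappa> j):]) * hdet n \<kappa> s = (\<Sum>k<n. fdet n (m(k := \<lambda>j. [:- 2 * real (\<kappa> j):] * m k j)))"
    unfolding m by (rule fdet_scale_rows_sum[symmetric])
  also have "\<dots> = (\<Sum>k<n. hdet n \<kappa> (s(k := Suc (Suc (s k)))) - [:0, 2:] * hdet n \<kappa> (s(k := Suc (s k)))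
       - [:2 * real (s k):] * hdet n \<kappa> s)"
    by (intro sum.cong refl row) simp
  also have "\<dots> = (\<Sum>k<n. hdet n \<kappa> (s(k := Suc (Suc (s k))))) - [:0, 2:] * pderiv (hdet n \<kappa> s)
       - (\<Sum>k<n. [:2 * real (s k):]) * hdet n \<kappa> s"
    by (simp only: pderiv_hdet sum_subtractf sum_distrib_left sum_distrib_right)
  finally have *: "(\<Sum>k<n. hdet n \<kappa> (s(k := Suc (Suc (s k))))) = [:0, 2:] * pderiv (hdet n \<kappa> s)
      + ((\<Sum>k<n. [:2 * real (s k):]) + (\<Sum>j<n. [:- 2 * real (\<kappa> j):])) * hdet n \<kappa> s"
    by (simp only: algebra_simps)
  have const: "(\<Sum>k\<in>A. [:f k:]) = [:sum f A:]" for f :: "nat \<Rightarrow> real" and A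
    by (induction A rule: infinite_finite_induct) auto
  show ?thesis
    unfolding * const by (simp add: sum_distrib_left sum_negf)
qed

text \<open>Raising any row but the last duplicates the row below it.\<close>

lemma pderiv_hdet_id: "pderiv (hdet (Suc q) \<kappa> id) = hdet (Suc q) \<kappa> (id(q := Suc q))"
proof -
  have "hdet (Suc q) \<kappa> (id(k := Suc k)) = 0" if "k < q" for k
    using that by (intro hdet_repeated[of k _ "Suc k"]) auto
  then show ?thesis unfolding pderiv_hdet by simp
qed

text \<open>In \<open>?A\<close> the last two rows are raised by one, in \<open>?B\<close> the last
  row by two. The second derivative is \<open>?A + ?B\<close>. In \<open>hdet_eigen\<close>, raising
  row \<open>q\<close> by two yields the rows of \<open>?A\<close> in swapped order, so the left
  side there is \<open>?B - ?A\<close>. Eliminating \<open>?B\<close> leaves twice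
  \<open>?A\<close>.\<close>

lemma pderiv2_hdet_id:
  "pderiv (pderiv (hdet (Suc (Suc q)) \<kappa> id)) =
     Polynomial.smult 2 (hdet (Suc (Suc q)) \<kappa> (id(q := Suc q, Suc q := Suc (Suc q)))) + [:0, 2:] * pderiv (hdet (Suc (Suc q)) \<kappa> id)
      + Polynomial.smult (2 * (\<Sum>k<Suc (Suc q). real k) - 2 * (\<Sum>j<Suc (Suc q). real (\<kappa> j))) (hdet (Suc (Suc q)) \<kappa> id)"
proof -
  let ?n = "Suc (Suc q)"
  let ?A = "hdet ?n \<kappa> (id(q := Suc q, Suc q := ?n))"
  let ?B = "hdet ?n \<kappa> (id(Suc q := Suc ?n))"
  let ?s = "id(Suc q := ?n)"
  have "hdet ?n \<kappa> (?s(k := Suc (?s k))) = 0" if "k < q" for k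
    using that by (intro hdet_repeated[of k _ "Suc k"]) auto
  then have "pderiv (pderiv (hdet ?n \<kappa> id)) = hdet ?n \<kappa> (?s(q := Suc q)) + ?B"
    unfolding pderiv_hdet_id unfolding pderiv_hdet by simp
  also have "?s(q := Suc q) = id(q := Suc q, Suc q := ?n)" by auto
  finally have 1: "pderiv (pderiv (hdet ?n \<kappa> id)) = ?A + ?B" .
  have "hdet ?n \<kappa> (id(k := Suc (Suc k))) = 0" if "k < q" for k
    using that by (intro hdet_repeated[of k _ "Suc (Suc k)"]) auto
  then have "(\<Sum>k<?n. hdet ?n \<kappa> (id(k := Suc (Suc (id k))))) = hdet ?n \<kappa> (id(q := ?n)) + ?B"
    by simp
  also have "hdet ?n \<kappa> (id(q := ?n)) = hdet ?n \<kappa> (id(q := ?n, Suc q := Suc q))"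
    by (rule hdet_cong) auto
  also have "\<dots> = - ?A"
    by (rule hdet_swap) auto
  finally have "- ?A + ?B = [:0, 2:] * pderiv (hdet ?n \<kappa> id)
      + Polynomial.smult (2 * (\<Sum>k<?n. real k) - 2 * (\<Sum>j<?n. real (\<kappa> j))) (hdet ?n \<kappa> id)"
    unfolding hdet_eigen by (simp only: id_def)
  then have "?A + ?B = (?A + ?A) + [:0, 2:] * pderiv (hdet ?n \<kappa> id)
      + Polynomial.smult (2 * (\<Sum>k<?n. real k) - 2 * (\<Sum>j<?n. real (\<kappa> j))) (hdet ?n \<kappa> id)"
    by (simp only: add.assoc)
  also have "?A + ?A = Polynomial.smult 2 ?A"
    by (rule poly_ext) simp
  finally show ?thesis unfolding 1 .
qed

text \<open>At a zero of the larger Wronskian some combination of its columns vanishes to high order, and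
  Cramer's rule for this combination expresses the derivatives of the larger Wronskian through the
  smaller one.\<close>

lemma exc_root_ode:
  assumes P: "poly (hdet (Suc r) \<kappa> id) x = 0" and W: "poly (hdet r \<kappa> id) x \<noteq> 0"
  defines "P \<equiv> hdet (Suc r) \<kappa> id" and "W \<equiv> hdet r \<kappa> id"
  shows "poly W x * poly (pderiv (pderiv P)) x =
           2 * (x * poly W x + poly (pderiv W) x) * poly (pderiv P) x"
proof (cases r)
  case 0
  have 1: "fdet (Suc 0) a = a 0 0" for a :: "nat \<Rightarrow> nat \<Rightarrow> real poly"
    by (simp add: fdet_leibniz)
  have 2: "fdet 0 a = 1" for a :: "nat \<Rightarrow> nat \<Rightarrow> real poly"
    by (simp add: fdet_leibniz)
  have "W = 1" "P = hermite (\<kappa> 0)"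
    unfolding W_def P_def hdet_def 0 by (simp_all add: 1 2)
  with P show ?thesis
    unfolding P_def[symmetric] by (simp add: hermite_ode)
next
  case (Suc q)
  let ?f = "\<lambda>t j. poly ((pderiv ^^ t) (hermite (\<kappa> j))) x"
  have ev: "poly (hdet n \<kappa> s) x = fdet n (\<lambda>i j. ?f (s i) j)" for n s
    unfolding hdet_def poly_fdet ..
  obtain v where v: "\<exists>j<Suc r. v j \<noteq> 0" "\<And>i. i < Suc r \<Longrightarrow> (\<Sum>j<Suc r. ?f i j * v j) = 0"
    using P unfolding ev fdet_0_iff by auto
  have vr: "v r \<noteq> 0"
  proof
    assume "v r = 0"
    with v have "\<exists>j<r. v j \<noteq> 0" "\<And>i. i < r \<Longrightarrow> (\<Sum>j<r. ?f i j * v j) = 0"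
      by (auto simp: less_Suc_eq)
    then have "poly (hdet r \<kappa> id) x = 0"
      unfolding ev fdet_0_iff by auto
    with W show False by simp
  qed
  define w where "w = (\<Sum>j\<le>r. ?f (Suc r) j * v j)"
  let ?s = "id(q := r)"
  let ?A = "hdet (Suc r) \<kappa> (?s(r := Suc r))"
  have van: "(\<Sum>j\<le>r. ?f i j * v j) = 0" if "i \<le> r" for i
    using v(2)[of i] that by (simp add: lessThan_Suc_atMost)
  \<comment> \<open>In the system with orders \<open>s 0, ..., s (r - 1), r + 1\<close> every row
    but the last annihilates \<open>v\<close>. With \<open>s = id\<close> the determinant on the
    left is the derivative of \<open>P\<close>; with the last order of \<open>s\<close> raised it is
    \<open>?A\<close>.\<close>
  have "v r * poly (hdet (Suc r) \<kappa> (s(r := Suc r))) x = w * poly (hdet r \<kappa> s) x" if "\<And>i. i < r \<Longrightarrow> s i \<le> r" for s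
  proof -
    have "v r * fdet (Suc r) (\<lambda>i j. ?f ((s(r := Suc r)) i) j) = w * fdet r (\<lambda>i j. ?f ((s(r := Suc r)) i) j)"
      by (rule fdet_cramer_last) (use that van in \<open>auto simp: w_def\<close>)
    also have "fdet r (\<lambda>i j. ?f ((s(r := Suc r)) i) j) = fdet r (\<lambda>i j. ?f (s i) j)"
      by (rule fdet_cong) auto
    finally show ?thesis unfolding ev .
  qed
  note cr = this
  have 1: "v r * poly (pderiv P) x = w * poly W x"
    unfolding P_def W_def pderiv_hdet_id by (rule cr) auto
  have 2: "v r * poly ?A x = w * poly (pderiv W) x"
    unfolding W_def Suc pderiv_hdet_id unfolding Suc[symmetric] by (rule cr) (auto simp: Suc)
  \<comment> \<open>Eliminating \<open>w\<close> gives \<open>W * A = W' * P'\<close> at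
    \<open>x\<close>: a three-term Pluecker relation whose remaining term contains \<open>P\<close>
    and vanishes here.\<close>
  have "v r * (poly W x * poly ?A x) = poly W x * (w * poly (pderiv W) x)"
    unfolding 2[symmetric] by simp
  also have "\<dots> = v r * (poly (pderiv W) x * poly (pderiv P) x)"
    using 1 by simp
  finally have "v r * (poly W x * poly ?A x) = v r * (poly (pderiv W) x * poly (pderiv P) x)" .
  with vr have pl: "poly W x * poly ?A x = poly (pderiv W) x * poly (pderiv P) x"
    by simp
  have "poly (pderiv (pderiv P)) x = 2 * poly ?A x + 2 * x * poly (pderiv P) x + c * poly P x"
    if "pderiv (pderiv P) = Polynomial.smult 2 ?A + [:0, 2:] * pderiv P + Polynomial.smult c P" for c
    unfolding that by simp
  from this[OF pderiv2_hdet_id[of q \<kappa>, folded Suc, folded P_def]]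
  have "poly (pderiv (pderiv P)) x = 2 * poly ?A x + 2 * x * poly (pderiv P) x"
    using assms(1) by (simp add: P_def)
  then show ?thesis
    using pl by (simp add: algebra_simps)
qed

section \<open>Sign changes of polynomials with exponents of alternating parity\<close>

text \<open>\<open>N\<close> counts sign changes, so \<open>N + 1\<close> points
  \<open>t 0, ..., t N\<close> are involved.\<close>

definition alternates :: "(real \<Rightarrow> real) \<Rightarrow> nat \<Rightarrow> (nat \<Rightarrow> real) \<Rightarrow> bool" where
  "alternates f N t \<longleftrightarrow> (\<forall>i<N. t i < t (Suc i) \<and> f (t i) * f (t (Suc i)) < 0)"

text \<open>By the mean value theorem the derivative takes the sign of each increment, and the
  increments of alternating values alternate. One point, hence one sign change, is lost.\<close>

lemma alternates_pderiv:
  assumes "alternates (poly p) (Suc N) t"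
  shows "\<exists>s. alternates (poly (pderiv p)) N s"
proof -
  have "\<exists>s. t i < s \<and> s < t (Suc i) \<and> poly p (t (Suc i)) - poly p (t i) = (t (Suc i) - t i) * poly (pderiv p) s"
    if "i < Suc N" for i
    using poly_MVT[of "t i" "t (Suc i)" p] assms that by (auto simp: alternates_def)
  then obtain s where s: "\<And>i. i < Suc N \<Longrightarrow> t i < s i \<and> s i < t (Suc i) \<and>
      poly p (t (Suc i)) - poly p (t i) = (t (Suc i) - t i) * poly (pderiv p) (s i)"
    by metis
  have "s i < s (Suc i) \<and> poly (pderiv p) (s i) * poly (pderiv p) (s (Suc i)) < 0" if "i < N" for i
  proof -
    let ?a = "poly p (t i)" and ?b = "poly p (t (Suc i))" and ?c = "poly p (t (Suc (Suc i)))"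
    have s1: "t i < s i" "s i < t (Suc i)" "?b - ?a = (t (Suc i) - t i) * poly (pderiv p) (s i)"
      using s[of i] that by auto
    have s2: "t (Suc i) < s (Suc i)" "s (Suc i) < t (Suc (Suc i))"
        "?c - ?b = (t (Suc (Suc i)) - t (Suc i)) * poly (pderiv p) (s (Suc i))"
      using s[of "Suc i"] that by auto
    have ab: "?a * ?b < 0" "?b * ?c < 0"
      using assms that by (auto simp: alternates_def)
    have "(?b - ?a) * (?c - ?b) < 0"
      using ab by (auto simp: mult_less_0_iff)
    then have "(t (Suc i) - t i) * (t (Suc (Suc i)) - t (Suc i)) * (poly (pderiv p) (s i) * poly (pderiv p) (s (Suc i))) < 0"
      unfolding s1(3) s2(3) by (simp add: mult_ac)
    moreover have "(t (Suc i) - t i) * (t (Suc (Suc i)) - t (Suc i)) > 0"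
      using s1 s2 by (intro mult_pos_pos) linarith+
    ultimately show ?thesis
      using s1 s2 by (auto simp: mult_less_0_iff[of "(t (Suc i) - t i) * (t (Suc (Suc i)) - t (Suc i))"])
  qed
  then show ?thesis unfolding alternates_def by blast
qed

text \<open>Descartes' rule of signs for exponents whose parities alternate, starting with an even one:
  dividing by the lowest power and differentiating removes one exponent and at most one sign change.\<close>

lemma alternates_sparse:
  assumes "finite A" "\<And>a. a \<in> A \<Longrightarrow> even (a + card {b \<in> A. b < a})"
    and "\<And>i. coeff p i \<noteq> 0 \<Longrightarrow> i \<in> A" "p \<noteq> 0" "alternates (poly p) N t"
  shows "N < card A"
  using assms
proof (induction N arbitrary: A p t)
  case 0
  then show ?case
    by (metis card_gt_0_iff empty_iff leading_coeff_0_iff)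
next
  case (Suc N)
  have "A \<noteq> {}" using Suc.prems by (metis empty_iff leading_coeff_0_iff)
  define m where "m = Min A"
  have mA: "m \<in> A" and mle: "\<And>a. a \<in> A \<Longrightarrow> m \<le> a"
    using Suc.prems(1) \<open>A \<noteq> {}\<close> by (auto simp: m_def)
  have "{b \<in> A. b < m} = {}" using mle by force
  \<comment> \<open>The least exponent has no smaller one in \<open>A\<close>, so the parity
    condition makes it even, and division by \<open>x ^ m\<close> preserves signs on both sides of
    0.\<close>
  then have em: "even m" using Suc.prems(2)[OF mA] by (metis add_0_right card.empty)
  have "monom 1 m dvd p"
    using Suc.prems(3) mle by (subst monom_1_dvd_iff') (auto simp: not_less[symmetric])
  then obtain p1 where p1: "p = monom 1 m * p1" by (elim dvdE)
  have c1: "coeff p1 i = coeff p (i + m)" for i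
    unfolding p1 by (simp add: coeff_monom_mult)
  have "alternates (poly p1) (Suc N) t"
    unfolding alternates_def
  proof (intro allI impI)
    fix i assume i: "i < Suc N"
    have a: "t i < t (Suc i)" "(t i * t (Suc i)) ^ m * (poly p1 (t i) * poly p1 (t (Suc i))) < 0"
      using Suc.prems(5) i by (auto simp: alternates_def p1 poly_monom power_mult_distrib mult_ac)
    have "(t i * t (Suc i)) ^ m \<ge> 0" using em by (simp add: zero_le_even_power)
    with a show "t i < t (Suc i) \<and> poly p1 (t i) * poly p1 (t (Suc i)) < 0"
      by (metis linorder_not_le mult_less_0_iff)
  qed
  then obtain s where s: "alternates (poly (pderiv p1)) N s" and alt1: "alternates (poly p1) (Suc N) t"
    using alternates_pderiv by blast
  \<comment> \<open>The exponents after dividing by \<open>x ^ m\<close> and differentiating. An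
    exponent drops by \<open>m + 1\<close> and the number of smaller ones by 1, so their sum drops
    by the even number \<open>m + 2\<close> and the parity condition survives.\<close>
  define A' where "A' = (\<lambda>a. a - Suc m) ` (A - {m})"
  have inj: "inj_on (\<lambda>a. a - Suc m) (A - {m})"
  proof (rule inj_onI)
    fix x y assume "x \<in> A - {m}" "y \<in> A - {m}" "x - Suc m = y - Suc m"
    then show "x = y" using mle[of x] mle[of y] by auto
  qed
  have cA: "card A' = card A - 1"
    unfolding A'_def using inj mA Suc.prems(1) by (subst card_image) auto
  have fA: "finite A'" using Suc.prems(1) by (simp add: A'_def)
  have "pderiv p1 \<noteq> 0"
  proof
    assume "pderiv p1 = 0"
    then obtain c where "p1 = [:c:]" using pderiv_iszero by blast
    with alt1 have "c * c < 0" by (auto simp: alternates_def)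
    then show False by (simp add: mult_less_0_iff)
  qed
  moreover have "even (a' + card {b \<in> A'. b < a'})" if "a' \<in> A'" for a'
  proof -
    obtain a where a: "a \<in> A" "a \<noteq> m" "a' = a - Suc m" using \<open>a' \<in> A'\<close> by (auto simp: A'_def)
    have ma: "m < a" using mle[OF a(1)] a(2) by simp
    have "{b \<in> A'. b < a'} = (\<lambda>a. a - Suc m) ` ({b \<in> A. b < a} - {m})"
      using mle ma unfolding A'_def a(3) by (auto simp: image_iff) (metis Suc_leI diff_less_mono le_neq_implies_less less_diff_iff)+
    also have "card \<dots> = card ({b \<in> A. b < a} - {m})"
      by (rule card_image) (rule inj_on_subset[OF inj], auto)
    also have "\<dots> = card {b \<in> A. b < a} - 1"
      using mA ma by simp
    finally have c: "card {b \<in> A'. b < a'} = card {b \<in> A. b < a} - 1" .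
    have "card {b \<in> A. b < a} > 0"
      using mA ma Suc.prems(1) by (subst card_gt_0_iff) auto
    then have "a' + card {b \<in> A'. b < a'} + Suc (Suc m) = a + card {b \<in> A. b < a}"
      using ma unfolding c unfolding a(3) by linarith
    then show ?thesis using Suc.prems(2)[OF a(1)] em
      by (metis even_Suc even_add)
  qed
  moreover have "i \<in> A'" if "coeff (pderiv p1) i \<noteq> 0" for i
  proof -
    have "coeff p (Suc i + m) \<noteq> 0" using that by (simp add: coeff_pderiv c1)
    then have "Suc i + m \<in> A" using Suc.prems(3) by blast
    then show ?thesis unfolding A'_def by (intro image_eqI[of _ _ "Suc i + m"]) auto
  qed
  ultimately have "N < card A'"
    using Suc.IH[of A' "pderiv p1" s] s fA by blast
  then show ?case using cA by linarith
qed

section \<open>Multipliers that make a polynomial nonnegative\<close>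

lemma poly_const_sign:
  fixes p :: "real poly"
  assumes "\<And>x. poly p x \<noteq> 0"
  shows "\<exists>c. c \<noteq> 0 \<and> (\<forall>x. 0 < c * poly p x)"
proof -
  have "0 < poly p 0 * poly p x" for x
  proof (rule ccontr)
    assume "\<not> ?thesis"
    then have neg: "poly p 0 * poly p x < 0"
      using assms[of 0] assms[of x] by (simp add: not_less order_le_less)
    consider "x < 0" | "x = 0" | "0 < x" by linarith
    then show False
    proof cases
      case 1
      then show ?thesis using poly_IVT[of x 0 p] neg assms by (auto simp: mult.commute)
    next
      case 2
      then show ?thesis using neg by (simp add: mult_less_0_iff)
    next
      case 3
      then show ?thesis using poly_IVT[of 0 x p] neg assms by auto
    qed
  qed
  then show ?thesis using assms[of 0] by blast
qed

text \<open>\<open>R\<close> is the set of real roots of odd multiplicity: splitting off a linear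
  factor at \<open>a\<close> toggles the membership of \<open>a\<close> in \<open>R\<close>.\<close>

lemma sign_change_factor:
  fixes p :: "real poly"
  assumes "p \<noteq> 0"
  shows "\<exists>R c. finite R \<and> c \<noteq> 0 \<and> (\<forall>x. 0 \<le> c * poly p x * (\<Prod>a\<in>R. x - a))"
  using assms
proof (induction "degree p" arbitrary: p rule: less_induct)
  case less
  show ?case
  proof (cases "\<exists>a. poly p a = 0")
    case False
    then obtain c where "c \<noteq> 0" "\<And>x. 0 < c * poly p x"
      using poly_const_sign[of p] by blast
    then show ?thesis by (intro exI[of _ "{}"] exI[of _ c]) (simp add: less_imp_le)
  next
    case True
    then obtain a p1 where p: "p = [:- a, 1:] * p1"
      by (auto simp: poly_eq_0_iff_dvd elim!: dvdE)
    with less.prems have "p1 \<noteq> 0" by auto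
    moreover have "degree p1 < degree p"
      unfolding p using \<open>p1 \<noteq> 0\<close> by (subst degree_mult_eq) auto
    ultimately obtain R c where R: "finite R" "c \<noteq> 0" "\<And>x. 0 \<le> c * poly p1 x * (\<Prod>a\<in>R. x - a)"
      using less.hyps by blast
    show ?thesis
    proof (cases "a \<in> R")
      case True
      have "c * poly p x * (\<Prod>a\<in>R - {a}. x - a) = c * poly p1 x * (\<Prod>a\<in>R. x - a)" for x
        using R(1) True by (subst prod.remove[of R a]) (auto simp: p algebra_simps)
      with R show ?thesis by (intro exI[of _ "R - {a}"] exI[of _ c]) (simp only: finite_Diff simp_thms)
    next
      case False
      have "c * poly p x * (\<Prod>a\<in>insert a R. x - a) = (x - a)\<^sup>2 * (c * poly p1 x * (\<Prod>a\<in>R. x - a))" for x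
        using R(1) False by (auto simp: p power2_eq_square algebra_simps)
      with R show ?thesis
        by (intro exI[of _ "insert a R"] exI[of _ c]) (simp only: finite_insert simp_thms zero_le_power2 mult_nonneg_nonneg)
    qed
  qed
qed

text \<open>One point is taken in each gap between neighbours in \<open>R\<close> and one beyond
  each end. Avoiding \<open>Z\<close> will keep the points off the zeros of another polynomial, and
  the bound \<open>\<beta>\<close> lets the induction place the next root to the right of all points
  chosen so far.\<close>

lemma alternates_prod_linear:
  fixes R Z :: "real set" and \<beta> :: real
  assumes "finite R" "finite Z" "\<And>a. a \<in> R \<Longrightarrow> a < \<beta>"
  shows "\<exists>t. alternates (\<lambda>x. \<Prod>a\<in>R. x - a) (card R) t \<and> (\<forall>i\<le>card R. t i \<notin> Z) \<and>
           t (card R) < \<beta> \<and> (\<forall>a\<in>R. a < t (card R))"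
  using assms(1,3)
proof (induction R arbitrary: \<beta> rule: finite_linorder_max_induct)
  case empty
  have "infinite ({\<beta> - 1<..<\<beta>} - Z)" using assms(2) by (simp add: Diff_infinite_finite infinite_Ioo)
  then obtain y where "y \<in> {\<beta> - 1<..<\<beta>} - Z" by (metis finite.emptyI ex_in_conv)
  then show ?case by (intro exI[of _ "\<lambda>_. y"]) (auto simp: alternates_def)
next
  case (insert b R)
  have bR: "b \<notin> R" using insert.hyps(2) by auto
  obtain t where t: "alternates (\<lambda>x. \<Prod>a\<in>R. x - a) (card R) t" "\<And>i. i \<le> card R \<Longrightarrow> t i \<notin> Z"
      "t (card R) < b" "\<And>a. a \<in> R \<Longrightarrow> a < t (card R)"
    using insert.IH[of b] insert.hyps(2) by auto
  have "infinite ({b<..<\<beta>} - Z)" using assms(2) insert.prems[of b] by (simp add: Diff_infinite_finite infinite_Ioo)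
  then obtain y where y: "y \<in> {b<..<\<beta>} - Z" by (metis finite.emptyI ex_in_conv)
  define n where "n = card R"
  have card: "card (insert b R) = Suc n" using insert.hyps(1) bR by (simp add: n_def)
  have mono: "i \<le> n \<Longrightarrow> t i \<le> t n" for i
  proof (induction rule: inc_induct)
    case (step k)
    then show ?case using t(1) by (auto simp: alternates_def n_def)
  qed simp
  have tb: "t i < b" if "i \<le> n" for i using mono[OF that] t(3) by (simp add: n_def)
  have pr: "(\<Prod>a\<in>insert b R. x - a) = (x - b) * (\<Prod>a\<in>R. x - a)" for x
    using insert.hyps(1) bR by simp
  have pos: "(\<Prod>a\<in>R. x - a) > 0" if "t n \<le> x" for x
    using t(4) that by (intro prod_pos) (force simp: n_def)
  have "alternates (\<lambda>x. \<Prod>a\<in>insert b R. x - a) (Suc n) (t(Suc n := y))"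
    unfolding alternates_def
  proof (intro allI impI)
    fix i assume i: "i < Suc n"
    show "(t(Suc n := y)) i < (t(Suc n := y)) (Suc i) \<and>
        (\<Prod>a\<in>insert b R. (t(Suc n := y)) i - a) * (\<Prod>a\<in>insert b R. (t(Suc n := y)) (Suc i) - a) < 0"
    proof (cases "i = n")
      case True
      have "(t n - b) * (y - b) < 0" using tb[of n] y by (simp add: mult_less_0_iff)
      moreover have "(\<Prod>a\<in>R. t n - a) * (\<Prod>a\<in>R. y - a) > 0"
        using pos[of "t n"] pos[of y] tb[of n] y by simp
      ultimately have "((t n - b) * (y - b)) * ((\<Prod>a\<in>R. t n - a) * (\<Prod>a\<in>R. y - a)) < 0"
        by (simp only: mult_less_0_iff) auto
      then show ?thesis using True tb[of n] y by (simp add: pr mult_ac)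
    next
      case False
      with i have i': "i < n" by simp
      then have "t i < t (Suc i)" and 1: "(\<Prod>a\<in>R. t i - a) * (\<Prod>a\<in>R. t (Suc i) - a) < 0"
        using t(1) by (auto simp: alternates_def n_def)
      moreover have "(t i - b) * (t (Suc i) - b) > 0"
        using tb[of i] tb[of "Suc i"] i' by (simp add: zero_less_mult_iff)
      then have "((t i - b) * (t (Suc i) - b)) * ((\<Prod>a\<in>R. t i - a) * (\<Prod>a\<in>R. t (Suc i) - a)) < 0"
        using 1 by (simp only: mult_less_0_iff) auto
      ultimately show ?thesis using i' by (simp add: pr mult_ac)
    qed
  qed
  moreover have "\<forall>i\<le>Suc n. (t(Suc n := y)) i \<notin> Z" using t(2) y by (auto simp: n_def)
  moreover have "\<forall>a\<in>insert b R. a < y" using t(3,4) y by force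
  moreover have "(t(Suc n := y)) (Suc n) = y" by simp
  ultimately show ?case using y unfolding card
    by (intro exI[of _ "t(Suc n := y)"]) (simp only: simp_thms Diff_iff greaterThanLessThan_iff)
qed

text \<open>The multiplier changes sign exactly where \<open>p\<close> does, so its degree is at
  most the number of sign changes of \<open>p\<close>, the quantity that
  \<open>alternates_sparse\<close> bounds.\<close>

lemma sign_factor_alternates:
  fixes p :: "real poly"
  assumes "p \<noteq> 0"
  shows "\<exists>q N t. q \<noteq> 0 \<and> degree q \<le> N \<and> (\<forall>x. 0 \<le> poly (q * p) x) \<and> alternates (poly p) N t"
proof -
  obtain R c where R: "finite R" "c \<noteq> 0" "\<And>x. 0 \<le> c * poly p x * (\<Prod>a\<in>R. x - a)"
    using sign_change_factor[OF assms] by blast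
  define q where "q = Polynomial.smult c (\<Prod>a\<in>R. [:- a, 1:])"
  have "finite {x. poly p x = 0}" using poly_roots_finite assms by blast
  moreover have "a < Max (insert 0 R) + 1" if "a \<in> R" for a
    using that R(1) by (meson Max_ge add_strict_increasing2 finite_insert insertI2 le_less_trans less_add_one)
  ultimately obtain t where t: "alternates (\<lambda>x. \<Prod>a\<in>R. x - a) (card R) t" "\<And>i. i \<le> card R \<Longrightarrow> poly p (t i) \<noteq> 0"
    using alternates_prod_linear[OF R(1), of "{x. poly p x = 0}" "Max (insert 0 R) + 1"] by auto
  have "alternates (poly p) (card R) t"
    unfolding alternates_def
  proof (intro allI impI)
    fix i assume i: "i < card R"
    let ?Q = "\<lambda>x. \<Prod>a\<in>R. x - a"
    have a: "t i < t (Suc i)" "?Q (t i) * ?Q (t (Suc i)) < 0" using t(1) i by (auto simp: alternates_def)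
    have "0 \<le> (c * poly p (t i) * ?Q (t i)) * (c * poly p (t (Suc i)) * ?Q (t (Suc i)))"
      using R(3) by simp
    also have "\<dots> = c\<^sup>2 * (?Q (t i) * ?Q (t (Suc i))) * (poly p (t i) * poly p (t (Suc i)))"
      by (simp add: power2_eq_square)
    finally have "poly p (t i) * poly p (t (Suc i)) \<le> 0"
      using a(2) R(2) by (auto simp: zero_le_mult_iff mult_le_0_iff mult_less_0_iff)
    moreover have "poly p (t i) \<noteq> 0" "poly p (t (Suc i)) \<noteq> 0" using t(2) i by auto
    ultimately show "t i < t (Suc i) \<and> poly p (t i) * poly p (t (Suc i)) < 0"
      using a(1) by (simp add: order_le_less)
  qed
  moreover have "q \<noteq> 0" using R by (auto simp: q_def)
  moreover have "degree q \<le> card R"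
    unfolding q_def using degree_prod_sum_le[OF R(1), of "\<lambda>a. [:- a, 1:]"] R(2) by simp
  moreover have "0 \<le> poly (q * p) x" for x
    using R(3)[of x] by (simp add: q_def poly_prod mult_ac minus_add_distrib)
  ultimately show ?thesis by blast
qed

section \<open>Gaussian means of polynomials\<close>

text \<open>The mean under the normal law with expectation \<open>\<mu>\<close> and variance 2. Its
  moment generating function is \<open>exp (\<mu> t + t^2)\<close>, which for
  \<open>\<mu> = -2 x\<close> is the inverse of the Hermite generating function at
  \<open>x\<close>.\<close>

definition gauss_mean :: "real \<Rightarrow> real poly \<Rightarrow> real" where
  "gauss_mean \<mu> p = (LBINT y. normal_density \<mu> (sqrt 2) y * poly p y)"

lemma poly_shift_expansion:
  fixes p :: "real poly"
  shows "p = (\<Sum>k\<le>degree p. Polynomial.smult (coeff (pcompose p [:\<mu>, 1:]) k) ([:- \<mu>, 1:] ^ k))"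
proof (rule poly_ext)
  fix y
  have "poly p y = poly (pcompose p [:\<mu>, 1:]) (y - \<mu>)"
    by (simp add: poly_pcompose)
  also have "\<dots> = (\<Sum>k\<le>degree p. coeff (pcompose p [:\<mu>, 1:]) k * (y - \<mu>) ^ k)"
    by (simp add: poly_altdef degree_pcompose)
  finally show "poly p y = poly (\<Sum>k\<le>degree p. Polynomial.smult (coeff (pcompose p [:\<mu>, 1:]) k) ([:- \<mu>, 1:] ^ k)) y"
    by (simp add: poly_sum)
qed

lemma integrable_gauss_poly: "integrable lborel (\<lambda>y. normal_density \<mu> (sqrt 2) y * poly p y)"
proof -
  have eq: "(\<lambda>y. normal_density \<mu> (sqrt 2) y * poly p y) =
     (\<lambda>y. \<Sum>k\<le>degree p. coeff (pcompose p [:\<mu>, 1:]) k * (normal_density \<mu> (sqrt 2) y * (y - \<mu>) ^ k))"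
    by (subst poly_shift_expansion[of p \<mu>]) (simp add: poly_sum sum_distrib_left mult_ac)
  show ?thesis
    unfolding eq
    by (intro Bochner_Integration.integrable_sum integrable_mult_right integrable_normal_moment) auto
qed

lemma gauss_mean_add: "gauss_mean \<mu> (p + q) = gauss_mean \<mu> p + gauss_mean \<mu> q"
  unfolding gauss_mean_def by (simp add: distrib_left integrable_gauss_poly)

lemma gauss_mean_smult: "gauss_mean \<mu> (Polynomial.smult c p) = c * gauss_mean \<mu> p"
  unfolding gauss_mean_def
  by (subst integral_mult_right_zero[symmetric]) (simp add: mult_ac)

lemma gauss_mean_0 [simp]: "gauss_mean \<mu> 0 = 0"
  by (simp add: gauss_mean_def)

lemma gauss_mean_sum: "gauss_mean \<mu> (\<Sum>i\<in>A. f i) = (\<Sum>i\<in>A. gauss_mean \<mu> (f i))"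
  by (induction A rule: infinite_finite_induct) (auto simp: gauss_mean_add)

lemma gauss_mean_1: "gauss_mean \<mu> 1 = 1"
  using integral_normal_moment_even[of "sqrt 2" \<mu> 0] by (simp add: gauss_mean_def)

text \<open>Both parities follow from the closed forms of the central moments. For
  \<open>k = 0\<close> the truncated \<open>k - 1\<close> is multiplied by 0.\<close>

lemma gauss_mean_central: "gauss_mean \<mu> ([:- \<mu>, 1:] ^ Suc k) = 2 * real k * gauss_mean \<mu> ([:- \<mu>, 1:] ^ (k - 1))"
proof -
  have e: "gauss_mean \<mu> ([:- \<mu>, 1:] ^ (2 * j)) = fact (2 * j) / fact j" for j
    using integral_normal_moment_even[of "sqrt 2" \<mu> j] by (simp add: gauss_mean_def)
  have o: "gauss_mean \<mu> ([:- \<mu>, 1:] ^ (2 * j + 1)) = 0" for j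
    using integral_normal_moment_odd[of "sqrt 2" \<mu> j]
    unfolding gauss_mean_def by (simp only: poly_power) simp
  show ?thesis
  proof (cases "even k")
    case True
    show ?thesis
    proof (cases "k = 0")
      case True then show ?thesis using o[of 0] by simp
    next
      case False
      with True obtain j where j: "k = 2 * Suc j" by (metis Suc_pred' dvdE mult_0_right neq0_conv)
      have "gauss_mean \<mu> ([:- \<mu>, 1:] ^ Suc k) = 0" using o[of "Suc j"] by (simp only: j Suc_eq_plus1)
      moreover have "k - 1 = 2 * j + 1" using j by simp
      then have "gauss_mean \<mu> ([:- \<mu>, 1:] ^ (k - 1)) = 0" using o[of j] by (simp only:)
      ultimately show ?thesis by simp
    qed
  next
    case False
    then obtain j where j: "k = 2 * j + 1" by (elim oddE)
    have "gauss_mean \<mu> ([:- \<mu>, 1:] ^ Suc k) = fact (2 * Suc j) / fact (Suc j)"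
      using e[of "Suc j"] unfolding j by (simp only: Suc_eq_plus1 mult_Suc_right) (simp add: algebra_simps)
    also have "\<dots> = 2 * real k * (fact (2 * j) / fact j)"
      unfolding j by (simp add: divide_simps) (simp add: algebra_simps)
    also have "fact (2 * j) / fact j = gauss_mean \<mu> ([:- \<mu>, 1:] ^ (k - 1))"
      using e[of j] by (simp add: j)
    finally show ?thesis .
  qed
qed

text \<open>Stein's identity for variance 2, that is, Gaussian integration by parts. By linearity it
  reduces to powers of \<open>y - \<mu>\<close>, where it is the moment recursion.\<close>

lemma gauss_mean_X_mult:
  "gauss_mean \<mu> ([:0, 1:] * p) = \<mu> * gauss_mean \<mu> p + 2 * gauss_mean \<mu> (pderiv p)"
proof -
  let ?B = "[:- \<mu>, 1:]"
  have B: "gauss_mean \<mu> ([:0, 1:] * ?B ^ k) = \<mu> * gauss_mean \<mu> (?B ^ k) + 2 * gauss_mean \<mu> (pderiv (?B ^ k))" for k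
  proof -
    have "[:0, 1:] * ?B ^ k = Polynomial.smult \<mu> (?B ^ k) + ?B ^ Suc k"
      by (rule poly_ext) (simp add: algebra_simps)
    then have "gauss_mean \<mu> ([:0, 1:] * ?B ^ k) = \<mu> * gauss_mean \<mu> (?B ^ k) + gauss_mean \<mu> (?B ^ Suc k)"
      by (simp only: gauss_mean_add gauss_mean_smult)
    moreover have "pderiv (?B ^ k) = Polynomial.smult (real k) (?B ^ (k - 1))"
      by (cases k) (simp_all only: pderiv_power_Suc, simp_all add: pderiv_pCons)
    ultimately show ?thesis
      by (simp only: gauss_mean_central gauss_mean_smult)
  qed
  define c where "c = (\<lambda>k. coeff (pcompose p [:\<mu>, 1:]) k)"
  have p: "p = (\<Sum>k\<le>degree p. Polynomial.smult (c k) (?B ^ k))"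
    unfolding c_def by (rule poly_shift_expansion)
  define n where "n = degree p"
  have p: "p = (\<Sum>k\<le>n. Polynomial.smult (c k) (?B ^ k))"
    using p by (simp only: n_def)
  have "pderiv p = (\<Sum>k\<le>n. Polynomial.smult (c k) (pderiv (?B ^ k)))"
    unfolding p using higher_pderiv_sum[of 1 "\<lambda>k. Polynomial.smult (c k) (?B ^ k)" "{..n}"] by (simp add: pderiv_smult)
  then have "\<mu> * gauss_mean \<mu> p + 2 * gauss_mean \<mu> (pderiv p) =
     (\<Sum>k\<le>n. c k * (\<mu> * gauss_mean \<mu> (?B ^ k) + 2 * gauss_mean \<mu> (pderiv (?B ^ k))))"
    by (simp only: gauss_mean_sum gauss_mean_smult p sum_distrib_left sum.distrib[symmetric]) (simp add: algebra_simps)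
  also have "\<dots> = gauss_mean \<mu> (\<Sum>k\<le>n. Polynomial.smult (c k) ([:0, 1:] * ?B ^ k))"
    by (simp only: B gauss_mean_sum gauss_mean_smult)
  also have "(\<Sum>k\<le>n. Polynomial.smult (c k) ([:0, 1:] * ?B ^ k)) = [:0, 1:] * p"
    unfolding p by (simp only: sum_distrib_left mult_smult_right)
  finally show ?thesis by simp
qed

lemma gauss_mean_pos:
  assumes "\<And>x. 0 \<le> poly p x" "p \<noteq> 0"
  shows "0 < gauss_mean \<mu> p"
proof -
  have nn: "AE y in lborel. 0 \<le> normal_density \<mu> (sqrt 2) y * poly p y"
    using assms(1) by simp
  have "gauss_mean \<mu> p \<noteq> 0"
  proof
    assume "gauss_mean \<mu> p = 0"
    then have "AE y in lborel. normal_density \<mu> (sqrt 2) y * poly p y = 0"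
      unfolding gauss_mean_def using integral_nonneg_eq_0_iff_AE[OF integrable_gauss_poly nn] by blast
    moreover have "normal_density \<mu> (sqrt 2) y > 0" for y by (rule normal_density_pos) simp
    ultimately have "AE y in lborel. poly p y = 0"
      by (auto elim!: eventually_mono simp: less_le)
    moreover have "AE y in lborel. y \<notin> {x. poly p x = 0}"
      using poly_roots_finite[OF assms(2)]
      by (intro AE_not_in finite_imp_null_set_lborel)
    ultimately have "AE y in (lborel :: real measure). False" by eventually_elim simp
    then have "emeasure lborel (UNIV :: real set) = 0"
      by (simp add: AE_iff_measurable[OF _ refl])
    then show False by simp
  qed
  moreover have "0 \<le> gauss_mean \<mu> p"
    unfolding gauss_mean_def using nn by (intro integral_nonneg_AE)
  ultimately show ?thesis by simp
qed

text \<open>Stein's identity trades a factor \<open>X\<close> for a derivative, either of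
  \<open>g\<close> or of the remaining power of \<open>X\<close>. The exponent of \<open>X\<close>
  plus the order of the derivative never grows, so it stays below \<open>s\<close>.\<close>

lemma gauss_mean_jet_orthogonal:
  assumes "\<And>i. i < s \<Longrightarrow> gauss_mean \<mu> ((pderiv ^^ i) g) = 0" "degree q < s"
  shows "gauss_mean \<mu> (q * g) = 0"
proof -
  have *: "gauss_mean \<mu> ([:0, 1:] ^ i * (pderiv ^^ l) g) = 0" if "i + l < s" for i l
    using that
  proof (induction i arbitrary: l rule: less_induct)
    case (less i)
    show ?case
    proof (cases i)
      case 0
      then show ?thesis using assms(1) less.prems by simp
    next
      case (Suc j)
      have d: "pderiv ([:0, 1:] ^ j :: real poly) = Polynomial.smult (real j) ([:0, 1:] ^ (j - 1))"
        by (cases j) (simp_all only: pderiv_power_Suc, simp_all add: pderiv_pCons)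
      have "gauss_mean \<mu> ([:0, 1:] ^ i * (pderiv ^^ l) g) = gauss_mean \<mu> ([:0, 1:] * ([:0, 1:] ^ j * (pderiv ^^ l) g))"
        unfolding Suc by (simp only: power_Suc mult.assoc)
      also have "\<dots> = \<mu> * gauss_mean \<mu> ([:0, 1:] ^ j * (pderiv ^^ l) g)
          + 2 * (gauss_mean \<mu> ([:0, 1:] ^ j * (pderiv ^^ Suc l) g)
             + real j * gauss_mean \<mu> ([:0, 1:] ^ (j - 1) * (pderiv ^^ l) g))"
        unfolding gauss_mean_X_mult pderiv_mult d gauss_mean_add mult_smult_right mult_smult_left
        by (simp add: gauss_mean_smult mult.commute[of "(pderiv ^^ l) g"])
      also have "\<dots> = 0"
        using less.IH[of j l] less.IH[of j "Suc l"] less.IH[of "j - 1" l] less.prems Suc by simp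
      finally show ?thesis .
    qed
  qed
  have "q * g = (\<Sum>i\<le>degree q. Polynomial.smult (coeff q i) ([:0, 1:] ^ i * (pderiv ^^ 0) g))"
    by (rule poly_ext) (simp add: poly_sum poly_altdef[of q] sum_distrib_left sum_distrib_right mult_ac)
  then have "gauss_mean \<mu> (q * g) = (\<Sum>i\<le>degree q. coeff q i * gauss_mean \<mu> ([:0, 1:] ^ i * (pderiv ^^ 0) g))"
    by (simp only: gauss_mean_sum gauss_mean_smult)
  also have "\<dots> = 0" using assms(2) by (intro sum.neutral ballI) (subst *, auto)
  finally show ?thesis .
qed

text \<open>Otherwise \<open>g\<close> is orthogonal to all polynomials of degree below
  \<open>card A\<close>. By the rule of signs these include a multiplier making \<open>g\<close>
  nonnegative, and a nonzero nonnegative polynomial has positive mean.\<close>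

lemma gauss_mean_jet_nonzero:
  assumes "finite A" "\<And>a. a \<in> A \<Longrightarrow> even (a + card {b \<in> A. b < a})"
    and "\<And>i. coeff g i \<noteq> 0 \<Longrightarrow> i \<in> A" "g \<noteq> 0"
  shows "\<exists>i<card A. gauss_mean \<mu> ((pderiv ^^ i) g) \<noteq> 0"
proof (rule ccontr)
  assume "\<not> ?thesis"
  then have z: "\<And>i. i < card A \<Longrightarrow> gauss_mean \<mu> ((pderiv ^^ i) g) = 0" by auto
  obtain q N t where q: "q \<noteq> 0" "degree q \<le> N" "\<And>x. 0 \<le> poly (q * g) x" "alternates (poly g) N t"
    using sign_factor_alternates[OF assms(4)] by blast
  have "N < card A" by (rule alternates_sparse[OF assms q(4)])
  then have "gauss_mean \<mu> (q * g) = 0"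
    by (intro gauss_mean_jet_orthogonal[of "card A"] z) (use q(2) in auto)
  moreover have "gauss_mean \<mu> (q * g) > 0"
    using q assms(4) by (intro gauss_mean_pos) auto
  ultimately show False by simp
qed

section \<open>The Krein--Adler theorem\<close>

lemma poly_higher_pderiv_hermite:
  "poly ((pderiv ^^ i) (hermite k)) x =
     (if i \<le> k then 2 ^ i * fact k * (poly (hermite (k - i)) x / fact (k - i)) else 0)"
proof (cases "i \<le> k")
  case True
  then show ?thesis using higher_pderiv_hermite[of i "k - i"] by simp
next
  case False
  then show ?thesis by (simp add: higher_pderiv_hermite_0)
qed

lemma higher_pderiv_monom_fact:
  "(pderiv ^^ i) (monom (1 / fact n) n) = (if i \<le> n then monom (1 / fact (n - i)) (n - i) else 0 :: real poly)"
proof (induction i)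
  case (Suc i)
  show ?case
  proof (cases "Suc i \<le> n")
    case True
    then obtain d where d: "n = i + Suc d" by (metis add_Suc_right le_add_diff_inverse plus_nat.simps(2))
    have "real (Suc d) * (1 / fact (Suc d)) = 1 / fact d" by (simp add: fact_Suc del: of_nat_Suc)
    then show ?thesis using Suc by (simp add: d pderiv_monom del: of_nat_Suc fact_Suc)
  next
    case False
    then show ?thesis using Suc by (cases "n = i") (auto simp: pderiv_monom)
  qed
qed simp

text \<open>The series of \<open>exp (2 x t - t^2)\<close> in \<open>t\<close>.\<close>

definition hermite_fps :: "real \<Rightarrow> real fps" where
  "hermite_fps x = Abs_fps (\<lambda>j. poly (hermite j) x / fact j)"

text \<open>The moment generating series for expectation \<open>-2 x\<close>, which is
  \<open>exp (-2 x t + t^2)\<close>.\<close>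

definition gauss_fps :: "real \<Rightarrow> real fps" where
  "gauss_fps x = Abs_fps (\<lambda>j. gauss_mean (- 2 * x) ([:0, 1:] ^ j) / fact j)"

text \<open>The recurrence is the coefficient form of \<open>F' = (a + b t) F\<close>. At
  \<open>j = 0\<close> the truncated \<open>j - 1\<close> is multiplied by 0.\<close>

lemma fps_deriv_egf:
  fixes c :: "nat \<Rightarrow> real"
  assumes "\<And>j. c (Suc j) = a * c j + b * real j * c (j - 1)"
  shows "fps_deriv (Abs_fps (\<lambda>j. c j / fact j)) = (fps_const a + fps_const b * fps_X) * Abs_fps (\<lambda>j. c j / fact j)"
proof (rule fps_ext)
  fix j
  have "real (Suc j) * (c (Suc j) / fact (Suc j)) = c (Suc j) / fact j"
    by (simp add: fact_Suc del: of_nat_Suc)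
  also have "\<dots> = a * (c j / fact j) + b * (if j = 0 then 0 else c (j - 1) / fact (j - 1))"
  proof (cases j)
    case (Suc n)
    have "b * real (Suc n) * c n / fact (Suc n) = b * (c n / fact n)"
      by (simp add: fact_Suc del: of_nat_Suc)
    then show ?thesis
      unfolding assms[of j] unfolding Suc by (simp add: add_divide_distrib del: of_nat_Suc fact_Suc)
  qed (use assms[of 0] in simp)
  finally show "fps_nth (fps_deriv (Abs_fps (\<lambda>j. c j / fact j))) j =
      fps_nth ((fps_const a + fps_const b * fps_X) * Abs_fps (\<lambda>j. c j / fact j)) j"
    by (simp add: distrib_right mult.assoc del: of_nat_Suc fact_Suc)
qed

lemma fps_deriv_hermite: "fps_deriv (hermite_fps x) = (fps_const (2 * x) + fps_const (- 2) * fps_X) * hermite_fps x"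
  unfolding hermite_fps_def
proof (rule fps_deriv_egf)
  fix j
  show "poly (hermite (Suc j)) x = 2 * x * poly (hermite j) x + - 2 * real j * poly (hermite (j - 1)) x"
    unfolding hermite.simps(2) by (cases j) (simp_all add: pderiv_hermite_Suc algebra_simps)
qed

lemma fps_deriv_gauss: "fps_deriv (gauss_fps x) = (fps_const (- 2 * x) + fps_const 2 * fps_X) * gauss_fps x"
  unfolding gauss_fps_def
proof (rule fps_deriv_egf)
  fix j
  have "pderiv ([:0, 1:] ^ j :: real poly) = Polynomial.smult (real j) ([:0, 1:] ^ (j - 1))"
    by (cases j) (simp_all only: pderiv_power_Suc, simp_all add: pderiv_pCons)
  then show "gauss_mean (- 2 * x) ([:0, 1:] ^ Suc j) =
      - 2 * x * gauss_mean (- 2 * x) ([:0, 1:] ^ j) + 2 * real j * gauss_mean (- 2 * x) ([:0, 1:] ^ (j - 1))"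
    unfolding power_Suc gauss_mean_X_mult by (simp add: gauss_mean_smult)
qed

text \<open>The two series solve first-order linear equations with opposite coefficients, so their
  product is constant.\<close>

lemma hermite_gauss_fps: "hermite_fps x * gauss_fps x = 1"
proof -
  have "fps_deriv (hermite_fps x * gauss_fps x) = 0"
    unfolding fps_deriv_mult fps_deriv_hermite fps_deriv_gauss
    by (simp add: algebra_simps flip: fps_const_neg)
  then have "hermite_fps x * gauss_fps x = fps_const (fps_nth (hermite_fps x * gauss_fps x) 0)"
    using fps_deriv_eq_0_iff by blast
  also have "\<dots> = 1" by (simp add: hermite_fps_def gauss_fps_def gauss_mean_1)
  finally show ?thesis .
qed

text \<open>A zero of the Wronskian gives a combination of the \<open>hermite (\<kappa> j)\<close>
  that vanishes to order \<open>r\<close>. Since the generating functions of the Hermite polynomials and of the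
  Gaussian moments are inverse to each other, passing to the complementary exponents and transposing
  yields a polynomial, supported on exponents of alternating parity, that is orthogonal to too many
  powers with respect to a Gaussian measure.\<close>

theorem krein_adler:
  assumes inj: "inj_on \<kappa> {..<r}"
    and gaps: "\<And>j. j \<notin> \<kappa> ` {..<r} \<Longrightarrow> even (card {k \<in> \<kappa> ` {..<r}. j < k})"
  shows "poly (hdet r \<kappa> id) x \<noteq> 0"
proof
  assume z: "poly (hdet r \<kappa> id) x = 0"
  let ?K = "\<kappa> ` {..<r}"
  have cK: "card ?K = r" using inj by (simp add: card_image)
  \<comment> \<open>A crude common bound for the exponents.\<close>
  define M where "M = (\<Sum>k\<in>?K. k)"
  have M: "k \<le> M" if "k \<in> ?K" for k unfolding M_def using that by (intro member_le_sum) auto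
  have "?K \<subseteq> {..M}" using M by auto
  then have rM: "r \<le> Suc M" using cK card_mono[of "{..M}" ?K] by simp
  \<comment> \<open>The complement of the exponents in \<open>{..M}\<close>, reflected at
    \<open>M\<close>. The even number of exponents above a gap becomes an even number of reflected
    exponents below an element \<open>a\<close> of \<open>A\<close>. Hence \<open>a\<close> has the
    parity of the number of elements of \<open>A\<close> below it, as
    \<open>alternates_sparse\<close> requires.\<close>
  define A where "A = {k. k \<le> M \<and> M - k \<notin> ?K}"
  have fA: "finite A" unfolding A_def by (rule finite_subset[of _ "{..M}"]) auto
  have card_refl: "card {b. b < a \<and> b \<le> M \<and> M - b \<in> ?K} = card {k \<in> ?K. M < k + a}" for a
  proof (rule bij_betw_same_card[of "\<lambda>b. M - b"])
    show "bij_betw (\<lambda>b. M - b) {b. b < a \<and> b \<le> M \<and> M - b \<in> ?K} {k \<in> ?K. M < k + a}"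
      by (rule bij_betwI[of _ _ _ "\<lambda>b. M - b"]) (use M in force)+
  qed
  define s where "s = card A"
  have s: "s + r = Suc M"
  proof -
    let ?X = "{b. b < Suc M \<and> b \<le> M \<and> M - b \<in> ?K}"
    have "{k \<in> ?K. M < k + Suc M} = ?K" by auto
    then have "card ?X = r"
      unfolding card_refl using cK by simp
    moreover have "card A + card ?X = card (A \<union> ?X)"
      by (rule card_Un_disjoint[symmetric, OF fA]) (auto simp: A_def)
    moreover have "A \<union> ?X = {..M}" by (auto simp: A_def)
    ultimately show ?thesis by (simp add: s_def)
  qed
  have parity: "even (a + card {b \<in> A. b < a})" if "a \<in> A" for a
  proof -
    have aM: "a \<le> M" "M - a \<notin> ?K" using that by (auto simp: A_def)
    let ?X = "{b. b < a \<and> b \<le> M \<and> M - b \<in> ?K}"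
    have "card {b \<in> A. b < a} + card ?X = card ({b \<in> A. b < a} \<union> ?X)"
      by (rule card_Un_disjoint[symmetric]) (use fA in \<open>auto simp: A_def\<close>)
    also have "{b \<in> A. b < a} \<union> ?X = {..<a}" using aM by (auto simp: A_def)
    finally have sum: "card {b \<in> A. b < a} + card ?X = a" by (simp only: card_lessThan)
    have "{k \<in> ?K. M < k + a} = {k \<in> ?K. M - a < k}" using aM by auto
    then have ev: "even (card {b. b < a \<and> b \<le> M \<and> M - b \<in> ?K})"
      unfolding card_refl using gaps[OF aM(2)] by simp
    have "even (a + p)" if "p + q = a" "even q" for p q using that by auto
    from this[OF sum ev] show ?thesis .
  qed
  obtain h where h: "bij_betw h {..<s} A"
    using ex_bij_betw_nat_finite[OF fA] unfolding s_def atLeast0LessThan by blast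
  have hA: "h a \<in> A" if "a < s" for a using h that by (auto simp: bij_betw_def)
  have hinj: "inj_on h {..<s}" using h by (simp add: bij_betw_def)

  obtain v j0 where v: "j0 < r" "v j0 \<noteq> 0"
      "\<And>i. i < r \<Longrightarrow> (\<Sum>j<r. poly ((pderiv ^^ i) (hermite (\<kappa> j))) x * v j) = 0"
    using z unfolding hdet_def poly_fdet fdet_0_iff by auto
  \<comment> \<open>The factorial of \<open>poly_higher_pderiv_hermite\<close> is moved into
    \<open>d\<close>. Then multiplication by the Hermite series turns derivatives into coefficients:
    up to \<open>2 ^ i\<close>, coefficient \<open>M - i\<close> of \<open>U\<close> is the
    derivative of order \<open>i\<close> of the combination at \<open>x\<close>. Its
    \<open>r\<close> vanishing derivatives leave, among the coefficients of \<open>U\<close> up to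
    index \<open>M\<close>, only the first \<open>s\<close>.\<close>
  define d where "d = (\<lambda>j. fact (\<kappa> j) * v j)"
  define D where "D = (\<Sum>j<r. fps_const (d j) * fps_X ^ (M - \<kappa> j))"
  define U where "U = D * hermite_fps x"
  have "U * gauss_fps x = D * (hermite_fps x * gauss_fps x)" unfolding U_def by (simp only: mult.assoc)
  then have D: "D = U * gauss_fps x" unfolding hermite_gauss_fps by simp
  have Dn: "fps_nth D l = (\<Sum>j<r. if l = M - \<kappa> j then d j else 0)" for l
    unfolding D_def by (auto simp: fps_sum_nth fps_X_power_nth if_distrib intro!: sum.cong cong: if_cong)
  have U0: "fps_nth U (M - i) = 0" if "i < r" for i
  proof -
    have "fps_nth U (M - i) = (\<Sum>j<r. d j * (if i \<le> \<kappa> j then poly (hermite (\<kappa> j - i)) x / fact (\<kappa> j - i) else 0))"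
      unfolding U_def D_def sum_distrib_right fps_sum_nth
    proof (intro sum.cong refl)
      fix j assume "j \<in> {..<r}"
      then have "\<kappa> j \<le> M" using M by auto
      moreover have "i \<le> M" using that rM by simp
      ultimately have "M - i < M - \<kappa> j \<longleftrightarrow> \<not> i \<le> \<kappa> j" "i \<le> \<kappa> j \<Longrightarrow> M - i - (M - \<kappa> j) = \<kappa> j - i" by auto
      then show "fps_nth (fps_const (d j) * fps_X ^ (M - \<kappa> j) * hermite_fps x) (M - i) =
          d j * (if i \<le> \<kappa> j then poly (hermite (\<kappa> j - i)) x / fact (\<kappa> j - i) else 0)"
        by (simp add: mult.assoc fps_X_power_mult_nth hermite_fps_def)
    qed
    then have "2 ^ i * fps_nth U (M - i) = (\<Sum>j<r. poly ((pderiv ^^ i) (hermite (\<kappa> j))) x * v j)"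
      unfolding poly_higher_pderiv_hermite by (auto simp: sum_distrib_left d_def intro!: sum.cong)
    then show ?thesis using v(3)[OF that] by simp
  qed
  have U0': "fps_nth U i = 0" if "s \<le> i" "i \<le> M" for i
    using U0[of "M - i"] that s by simp
  \<comment> \<open>\<open>D\<close> is supported on the reflected exponents and so vanishes at the
    indices \<open>h a\<close>. Since \<open>D\<close> is \<open>U\<close> times the Gaussian
    series, the first \<open>s\<close> coefficients of \<open>U\<close> form a kernel vector of this
    square matrix.\<close>
  define B where "B = (\<lambda>a i. if i \<le> h a then fps_nth (gauss_fps x) (h a - i) else 0)"
  have DU: "fps_nth D l = (\<Sum>i<s. fps_nth U i * (if i \<le> l then fps_nth (gauss_fps x) (l - i) else 0))" if "l \<le> M" for l
  proof -
    have "fps_nth D l = (\<Sum>i\<in>{0..l}. fps_nth U i * fps_nth (gauss_fps x) (l - i))"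
      by (subst D) (simp add: fps_mult_nth)
    also have "\<dots> = (\<Sum>i\<in>{..<s} \<inter> {0..l}. fps_nth U i * fps_nth (gauss_fps x) (l - i))"
      using that by (intro sum.mono_neutral_right) (auto intro: U0')
    also have "\<dots> = (\<Sum>i<s. fps_nth U i * (if i \<le> l then fps_nth (gauss_fps x) (l - i) else 0))"
      by (intro sum.mono_neutral_cong_left) auto
    finally show ?thesis .
  qed
  have "(\<Sum>i<s. B a i * fps_nth U i) = 0" if "a < s" for a
  proof -
    have ha: "h a \<le> M" "M - h a \<notin> ?K" using hA[OF that] by (auto simp: A_def)
    have "fps_nth D (h a) = 0"
      unfolding Dn
    proof (intro sum.neutral ballI)
      fix j assume j: "j \<in> {..<r}"
      have "h a \<noteq> M - \<kappa> j"
      proof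
        assume "h a = M - \<kappa> j"
        then have "M - h a = \<kappa> j" using M[of "\<kappa> j"] j by auto
        with ha(2) j show False by auto
      qed
      then show "(if h a = M - \<kappa> j then d j else 0) = 0" by simp
    qed
    then show ?thesis using DU[OF ha(1)] by (simp add: B_def mult.commute)
  qed
  moreover have "\<exists>i<s. fps_nth U i \<noteq> 0"
  proof (rule ccontr)
    assume "\<not> ?thesis"
    then have "fps_nth D (M - \<kappa> j0) = 0" by (subst DU) auto
    moreover have "M - \<kappa> j0 = M - \<kappa> j \<longleftrightarrow> j = j0" if "j < r" for j
    proof -
      have "\<kappa> j \<le> M" "\<kappa> j0 \<le> M" using M that v(1) by auto
      then have "M - \<kappa> j0 = M - \<kappa> j \<longleftrightarrow> \<kappa> j0 = \<kappa> j" by auto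
      then show ?thesis using inj that v(1) by (auto simp: inj_on_def)
    qed
    then have "fps_nth D (M - \<kappa> j0) = (\<Sum>j<r. if j = j0 then d j else 0)"
      unfolding Dn by (intro sum.cong) auto
    then have "fps_nth D (M - \<kappa> j0) = d j0"
      using v(1) by (simp only: sum.delta finite_lessThan lessThan_iff if_True)
    ultimately show False using v(2) by (simp add: d_def)
  qed
  ultimately have "fdet s B = 0" unfolding fdet_0_iff by blast
  \<comment> \<open>A kernel vector of the transpose combines the indices \<open>h a\<close>
    instead. Used as weights of the powers \<open>x ^ h a / fact (h a)\<close>, whose derivatives
    have the same shape, it gives a polynomial whose first \<open>s\<close> derivatives all have
    Gaussian mean 0.\<close>
  then have "fdet s (\<lambda>i a. B a i) = 0" unfolding fdet_transpose[of s B] .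
  then obtain \<gamma> a0 where \<gamma>: "a0 < s" "\<gamma> a0 \<noteq> 0" "\<And>i. i < s \<Longrightarrow> (\<Sum>a<s. B a i * \<gamma> a) = 0"
    unfolding fdet_0_iff by blast
  define g where "g = (\<Sum>a<s. Polynomial.smult (\<gamma> a) (monom (1 / fact (h a)) (h a)))"
  have "gauss_mean (- 2 * x) ((pderiv ^^ i) g) = (\<Sum>a<s. B a i * \<gamma> a)" for i
  proof -
    have m: "monom c n = Polynomial.smult c ([:0, 1:] ^ n)" for c :: real and n
      by (rule monom_altdef)
    have "gauss_mean (- 2 * x) ((pderiv ^^ i) g) =
      (\<Sum>a<s. \<gamma> a * gauss_mean (- 2 * x) (if i \<le> h a then monom (1 / fact (h a - i)) (h a - i) else 0))"
      unfolding g_def higher_pderiv_sum higher_pderiv_smult higher_pderiv_monom_fact gauss_mean_sum gauss_mean_smult ..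
    also have "\<dots> = (\<Sum>a<s. B a i * \<gamma> a)"
      by (intro sum.cong refl) (simp add: B_def m gauss_mean_smult gauss_fps_def)
    finally show ?thesis .
  qed
  with \<gamma>(3) have "\<not> (\<exists>i<s. gauss_mean (- 2 * x) ((pderiv ^^ i) g) \<noteq> 0)" by simp
  moreover have "\<exists>i<card A. gauss_mean (- 2 * x) ((pderiv ^^ i) g) \<noteq> 0"
  proof (rule gauss_mean_jet_nonzero[OF fA parity])
    have cg: "coeff g i = (\<Sum>a<s. if h a = i then \<gamma> a / fact (h a) else 0)" for i
      unfolding g_def coeff_sum by (intro sum.cong) auto
    show "i \<in> A" if "coeff g i \<noteq> 0" for i
    proof (rule ccontr)
      assume "i \<notin> A"
      then have "coeff g i = 0" unfolding cg using hA by (intro sum.neutral) auto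
      with that show False by simp
    qed
    have "coeff g (h a0) = (\<Sum>a<s. if a = a0 then \<gamma> a / fact (h a) else 0)"
      unfolding cg using hinj \<gamma>(1) by (intro sum.cong) (auto simp: inj_on_def)
    then have "coeff g (h a0) \<noteq> 0" using \<gamma>(1,2) by simp
    then show "g \<noteq> 0" by auto
  qed
  ultimately show False unfolding s_def by contradiction
qed

section \<open>Degrees of Hermite Wronskians\<close>

lemma coeff_prod_degree_bound:
  fixes f :: "'b \<Rightarrow> 'a::comm_ring_1 poly"
  assumes "\<And>j. j \<in> S \<Longrightarrow> degree (f j) \<le> d j"
  shows "degree (prod f S) \<le> sum d S \<and> coeff (prod f S) (sum d S) = (\<Prod>j\<in>S. coeff (f j) (d j))"
  using assms
proof (induction S rule: infinite_finite_induct)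
  case (insert x S)
  then have IH: "degree (prod f S) \<le> sum d S" "coeff (prod f S) (sum d S) = (\<Prod>j\<in>S. coeff (f j) (d j))"
    and dx: "degree (f x) \<le> d x" by auto
  have "coeff (f x * prod f S) (d x + sum d S) = coeff (f x) (d x) * coeff (prod f S) (sum d S)"
  proof -
    have "coeff (f x) i * coeff (prod f S) (d x + sum d S - i) = 0" if "i \<noteq> d x" "i \<le> d x + sum d S" for i
    proof (cases "i < d x")
      case True
      then have "degree (prod f S) < d x + sum d S - i" using IH(1) by linarith
      then show ?thesis by (simp add: coeff_eq_0)
    next
      case False
      then have "degree (f x) < i" using that dx by linarith
      then show ?thesis by (simp add: coeff_eq_0)
    qed
    then have "(\<Sum>i\<le>d x + sum d S. coeff (f x) i * coeff (prod f S) (d x + sum d S - i)) =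
        (\<Sum>i\<in>{d x}. coeff (f x) i * coeff (prod f S) (d x + sum d S - i))"
      by (intro sum.mono_neutral_right) auto
    then show ?thesis by (simp add: coeff_mult)
  qed
  moreover have "degree (f x * prod f S) \<le> d x + sum d S"
    using degree_mult_le[of "f x" "prod f S"] IH(1) dx by linarith
  ultimately show ?case using insert.hyps IH by simp
qed auto

text \<open>The degree bound depends on the column only, so every permutation product has the same
  total bound, and the formal leading coefficients, possibly zero, form a determinant again.\<close>

lemma fdet_degree_bound:
  fixes a :: "nat \<Rightarrow> nat \<Rightarrow> 'a::comm_ring_1 poly"
  assumes "\<And>i j. i < n \<Longrightarrow> j < n \<Longrightarrow> degree (a i j) \<le> d j"
  shows "degree (fdet n a) \<le> (\<Sum>j<n. d j)"
    and "coeff (fdet n a) (\<Sum>j<n. d j) = fdet n (\<lambda>i j. coeff (a i j) (d j))"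
proof -
  have D: "(\<Sum>i=0..<n. d (p i)) = (\<Sum>j<n. d j)" if "p permutes {0..<n}" for p
    using sum.permute[OF that, of d] by (simp add: atLeast0LessThan comp_def)
  have b: "degree (\<Prod>i=0..<n. a i (p i)) \<le> (\<Sum>j<n. d j)"
      "coeff (\<Prod>i=0..<n. a i (p i)) (\<Sum>j<n. d j) = (\<Prod>i=0..<n. coeff (a i (p i)) (d (p i)))"
    if "p permutes {0..<n}" for p
  proof -
    have "degree (a i (p i)) \<le> d (p i)" if "i \<in> {0..<n}" for i
      using assms[of i "p i"] permutes_in_image[OF \<open>p permutes {0..<n}\<close>, of i] that by auto
    from coeff_prod_degree_bound[of "{0..<n}" "\<lambda>i. a i (p i)" "\<lambda>i. d (p i)", OF this]
    show "degree (\<Prod>i=0..<n. a i (p i)) \<le> (\<Sum>j<n. d j)"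
      "coeff (\<Prod>i=0..<n. a i (p i)) (\<Sum>j<n. d j) = (\<Prod>i=0..<n. coeff (a i (p i)) (d (p i)))"
      unfolding D[OF that] by auto
  qed
  have s: "signof p * q = Polynomial.smult (signof p) q" for p and q :: "'a poly"
    by (simp add: sign_def)
  show "degree (fdet n a) \<le> (\<Sum>j<n. d j)"
    unfolding fdet_leibniz s
    by (intro degree_sum_le) (auto intro: order_trans[OF degree_smult_le] b finite_permutations)
  show "coeff (fdet n a) (\<Sum>j<n. d j) = fdet n (\<lambda>i j. coeff (a i j) (d j))"
    unfolding fdet_leibniz s coeff_sum by (intro sum.cong refl) (simp add: b)
qed

text \<open>Multiplying row \<open>i\<close> by \<open>x ^ i\<close> undoes the drop in degree, so
  that all entries of a column obey one common bound.\<close>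

definition shifted_deriv :: "nat \<Rightarrow> nat \<Rightarrow> real poly" where
  "shifted_deriv i k = monom 1 i * (pderiv ^^ i) (hermite k)"

lemma shifted_deriv:
  "degree (shifted_deriv i k) \<le> k" "coeff (shifted_deriv i k) k = 2 ^ k * (\<Prod>l<i. real k - real l)"
proof -
  have "degree (shifted_deriv i k) \<le> k \<and> coeff (shifted_deriv i k) k = 2 ^ k * (\<Prod>l<i. real k - real l)"
  proof (cases "i \<le> k")
    case True
    have h: "(pderiv ^^ i) (hermite k) = Polynomial.smult (2 ^ i * fact k / fact (k - i)) (hermite (k - i))"
      using higher_pderiv_hermite[of i "k - i"] True by simp
    have "degree (shifted_deriv i k) \<le> i + (k - i)"
      unfolding shifted_deriv_def h
      by (rule order_trans[OF degree_mult_le]) (simp add: degree_monom_eq)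
    moreover have "(\<Prod>l<i. real k - real l) = fact k / fact (k - i)"
      using True
    proof (induction i)
      case (Suc i)
      then obtain d where d: "k = i + Suc d" by (metis Suc_le_eq add_Suc_right less_imp_Suc_add)
      show ?case using Suc by (simp add: d)
    qed simp
    moreover have "coeff (shifted_deriv i k) k = 2 ^ i * 2 ^ (k - i) * (fact k / fact (k - i))"
      unfolding shifted_deriv_def h using True by (simp add: coeff_monom_mult lead_coeff_hermite)
    moreover have "2 ^ i * 2 ^ (k - i) = (2 :: real) ^ k" using True by (simp flip: power_add)
    ultimately show ?thesis using True by simp
  next
    case False
    then have "(pderiv ^^ i) (hermite k) = 0" by (simp add: higher_pderiv_hermite_0)
    moreover have "(\<Prod>l<i. real k - real l) = 0" using False by (auto simp: prod_zero_iff)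
    ultimately show ?thesis by (simp add: shifted_deriv_def)
  qed
  then show "degree (shifted_deriv i k) \<le> k" "coeff (shifted_deriv i k) k = 2 ^ k * (\<Prod>l<i. real k - real l)"
    by auto
qed

lemma monom_mult_hdet:
  "monom 1 (\<Sum>i<n. s i) * hdet n \<kappa> s = fdet n (\<lambda>i j. shifted_deriv (s i) (\<kappa> j))"
proof -
  have "monom 1 (\<Sum>i\<in>S. s i) = (\<Prod>i\<in>S. monom 1 (s i) :: real poly)" for S
  proof (induction S rule: infinite_finite_induct)
    case (insert x S)
    then show ?case by (simp flip: insert.IH add: mult_monom)
  qed auto
  then show ?thesis
    unfolding hdet_def fdet_leibniz shifted_deriv_def prod.distrib atLeast0LessThan
    by (simp add: sum_distrib_left mult_ac)
qed

lemma degree_hdet_le: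
  assumes "hdet n \<kappa> s \<noteq> 0"
  shows "degree (hdet n \<kappa> s) + (\<Sum>i<n. s i) \<le> (\<Sum>j<n. \<kappa> j)"
proof -
  have "degree (monom 1 (\<Sum>i<n. s i) * hdet n \<kappa> s) \<le> (\<Sum>j<n. \<kappa> j)"
    unfolding monom_mult_hdet by (intro fdet_degree_bound shifted_deriv)
  then show ?thesis
    using assms by (subst (asm) degree_mult_eq) (auto simp: degree_monom_eq)
qed

text \<open>A Vandermonde determinant in the basis of falling factorials: a dependence between them
  at the points \<open>\<kappa> j\<close> would be a nonzero polynomial of degree less than
  \<open>r\<close> with \<open>r\<close> zeros.\<close>

lemma falling_factorial_det_nonzero:
  assumes "inj_on \<kappa> {..<r}"
  shows "fdet r (\<lambda>i j. 2 ^ \<kappa> j * (\<Prod>l<i. real (\<kappa> j) - real l)) \<noteq> 0"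
proof
  assume "fdet r (\<lambda>i j. 2 ^ \<kappa> j * (\<Prod>l<i. real (\<kappa> j) - real l)) = 0"
  then have "fdet r (\<lambda>j i. 2 ^ \<kappa> j * (\<Prod>l<i. real (\<kappa> j) - real l)) = 0"
    by (subst fdet_transpose[symmetric])
  then obtain u where u: "\<exists>i<r. u i \<noteq> 0"
      "\<And>j. j < r \<Longrightarrow> (\<Sum>i<r. 2 ^ \<kappa> j * (\<Prod>l<i. real (\<kappa> j) - real l) * u i) = 0"
    unfolding fdet_0_iff by blast
  define b where "b = (\<lambda>i. \<Prod>l<i. [:- real l, 1:])"
  define q where "q = (\<Sum>i<r. Polynomial.smult (u i) (b i))"
  have pb: "degree (b i) = i" "coeff (b i) i = 1" for i
  proof -
    have "degree (b i) = i" unfolding b_def by (subst degree_prod_eq_sum_degree) auto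
    moreover have "lead_coeff (b i) = 1" unfolding b_def by (subst lead_coeff_prod) auto
    ultimately show "degree (b i) = i" "coeff (b i) i = 1" by auto
  qed
  have roots: "poly q (real (\<kappa> j)) = 0" if "j < r" for j
  proof -
    have "(\<Sum>i<r. 2 ^ \<kappa> j * (\<Prod>l<i. real (\<kappa> j) - real l) * u i) = 2 ^ \<kappa> j * poly q (real (\<kappa> j))"
      by (simp add: q_def b_def poly_sum poly_prod sum_distrib_left mult_ac)
    then show ?thesis using u(2)[OF that] by simp
  qed
  define m where "m = Max {i. i < r \<and> u i \<noteq> 0}"
  have "finite {i. i < r \<and> u i \<noteq> 0}" "{i. i < r \<and> u i \<noteq> 0} \<noteq> {}" using u(1) by auto
  then have m: "m < r" "u m \<noteq> 0" "\<And>i. i < r \<Longrightarrow> m < i \<Longrightarrow> u i = 0"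
    using Max_in[of "{i. i < r \<and> u i \<noteq> 0}"] Max_ge[of "{i. i < r \<and> u i \<noteq> 0}"]
    unfolding m_def[symmetric] by (auto simp: not_le[symmetric])
  have "coeff q m = (\<Sum>i<r. if i = m then u i else 0)"
    unfolding q_def coeff_sum
  proof (intro sum.cong refl)
    fix i assume i: "i \<in> {..<r}"
    consider "i < m" | "i = m" | "m < i" by linarith
    then show "coeff (Polynomial.smult (u i) (b i)) m = (if i = m then u i else 0)"
    proof cases
      case 1
      then show ?thesis using pb(1)[of i] by (simp add: coeff_eq_0)
    qed (use m(3)[of i] i pb in auto)
  qed
  then have "coeff q m \<noteq> 0" using m by simp
  then have "q \<noteq> 0" by auto
  have dq: "degree q < r"
    unfolding q_def using m(1) by (intro degree_sum_less) (auto intro: le_less_trans[OF degree_smult_le] simp: pb)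
  have "(\<lambda>j. real (\<kappa> j)) ` {..<r} \<subseteq> {x. poly q x = 0}" using roots by auto
  then have "card ((\<lambda>j. real (\<kappa> j)) ` {..<r}) \<le> card {x. poly q x = 0}"
    using poly_roots_finite[OF \<open>q \<noteq> 0\<close>] by (intro card_mono)
  moreover have "card ((\<lambda>j. real (\<kappa> j)) ` {..<r}) = r"
    using assms by (subst card_image) (auto simp: inj_on_def)
  ultimately show False
    using card_poly_roots_bound[OF \<open>q \<noteq> 0\<close>] dq by linarith
qed

text \<open>After the rescaling by powers of \<open>x\<close> the formal leading coefficient is the
  determinant of \<open>falling_factorial_det_nonzero\<close>. For the exponents
  \<open>rev la ! k + k\<close> the degree is the size of the partition.\<close>

lemma degree_hdet_id:
  assumes "inj_on \<kappa> {..<r}"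
  shows "hdet r \<kappa> id \<noteq> 0" "degree (hdet r \<kappa> id) + (\<Sum>i<r. i) = (\<Sum>j<r. \<kappa> j)"
proof -
  have "coeff (monom 1 (\<Sum>i<r. id i) * hdet r \<kappa> id) (\<Sum>j<r. \<kappa> j) =
      fdet r (\<lambda>i j. coeff (shifted_deriv (id i) (\<kappa> j)) (\<kappa> j))"
    unfolding monom_mult_hdet by (intro fdet_degree_bound shifted_deriv)
  also have "\<dots> \<noteq> 0"
    unfolding shifted_deriv id_apply by (rule falling_factorial_det_nonzero[OF assms])
  finally have c: "coeff (monom 1 (\<Sum>i<r. id i) * hdet r \<kappa> id) (\<Sum>j<r. \<kappa> j) \<noteq> 0" .
  then show nz: "hdet r \<kappa> id \<noteq> 0" by auto
  have "(\<Sum>j<r. \<kappa> j) \<le> degree (monom 1 (\<Sum>i<r. id i) * hdet r \<kappa> id)"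
    using c by (rule le_degree)
  then have "(\<Sum>j<r. \<kappa> j) \<le> (\<Sum>i<r. i) + degree (hdet r \<kappa> id)"
    using nz by (subst (asm) degree_mult_eq) (auto simp: degree_monom_eq)
  moreover have "degree (hdet r \<kappa> id) + (\<Sum>i<r. i) \<le> (\<Sum>j<r. \<kappa> j)"
    using degree_hdet_le[OF nz] by simp
  ultimately show "degree (hdet r \<kappa> id) + (\<Sum>i<r. i) = (\<Sum>j<r. \<kappa> j)" by simp
qed

text \<open>The cofactor of row \<open>i\<close> in the last column of the larger Wronskian. It does
  not involve that column, hence does not depend on \<open>n\<close>.\<close>

definition hcof :: "nat \<Rightarrow> (nat \<Rightarrow> nat) \<Rightarrow> nat \<Rightarrow> real poly" where
  "hcof r \<kappa> i = (- 1) ^ (i + r) * hdet r \<kappa> (\<lambda>l. if l < i then l else Suc l)"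

lemma hcof_last: "hcof r \<kappa> r = hdet r \<kappa> id"
proof -
  have "hdet r \<kappa> (\<lambda>l. if l < r then l else Suc l) = hdet r \<kappa> id"
    by (rule hdet_cong) auto
  then show ?thesis by (simp add: hcof_def flip: mult_2)
qed

text \<open>Leaving out row \<open>i\<close> instead of row \<open>r\<close> raises the total order
  of differentiation and so lowers the degree bound. The strict inequality supplies the factor
  \<open>\<bar>x\<bar>\<close> in \<open>hcof_bound\<close>.\<close>

lemma degree_hcof_less:
  assumes "inj_on \<kappa> {..<r}" "i < r" "hcof r \<kappa> i \<noteq> 0"
  shows "degree (hcof r \<kappa> i) < degree (hdet r \<kappa> id)"
proof -
  let ?s = "\<lambda>l. if l < i then l else Suc l"
  have d: "degree (hcof r \<kappa> i) = degree (hdet r \<kappa> ?s)"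
    by (cases "even (i + r)") (auto simp: hcof_def)
  have "hdet r \<kappa> ?s \<noteq> 0" using assms(3) by (auto simp: hcof_def)
  from degree_hdet_le[OF this] have "degree (hcof r \<kappa> i) + (\<Sum>l<r. ?s l) \<le> (\<Sum>j<r. \<kappa> j)"
    unfolding d .
  moreover have "(\<Sum>l<r. l) < (\<Sum>l<r. ?s l)"
    using assms(2) by (intro sum_strict_mono_ex1) (auto intro!: bexI[of _ i])
  ultimately show ?thesis using degree_hdet_id(2)[OF assms(1)] by linarith
qed

lemma exc_expansion:
  "hdet (Suc r) (\<kappa>(r := N)) id = (\<Sum>i\<le>r. hcof r \<kappa> i * (pderiv ^^ i) (hermite N))"
proof -
  have "fdet r (\<lambda>i' j. (pderiv ^^ id (if i' < i then i' else Suc i')) (hermite ((\<kappa>(r := N)) j))) =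
      hdet r \<kappa> (\<lambda>l. if l < i then l else Suc l)" for i
    unfolding hdet_def by (rule fdet_cong) auto
  then show ?thesis
    unfolding hdet_def[of "Suc r"] fdet_laplace_last_column hcof_def
    by (intro sum.cong refl) (simp add: mult_ac)
qed

text \<open>This bound closes the count of zeros: once \<open>degree W + n\<close> distinct zeros
  are found, there are no others.\<close>

lemma degree_exc_le:
  assumes "inj_on \<kappa> {..<r}"
  shows "degree (hdet (Suc r) (\<kappa>(r := n + r)) id) \<le> degree (hdet r \<kappa> id) + n"
proof (cases "hdet (Suc r) (\<kappa>(r := n + r)) id = 0")
  case False
  have "(\<Sum>j<r. (\<kappa>(r := n + r)) j) = (\<Sum>j<r. \<kappa> j)" by (intro sum.cong) auto
  then show ?thesis
    using degree_hdet_le[OF False] degree_hdet_id(2)[OF assms] by simp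
qed simp

section \<open>Approximation by a multiple of a Hermite polynomial\<close>

text \<open>Evaluation at a real or a complex point alike, so that one error estimate serves both
  the sign changes and the non-real zeros.\<close>

definition rpoly :: "real poly \<Rightarrow> 'a::{real_algebra_1,comm_ring_1} \<Rightarrow> 'a" where
  "rpoly p z = poly (map_poly of_real p) z"

lemma map_poly_of_real_add: "map_poly of_real (p + q) = map_poly of_real p + (map_poly of_real q :: 'a::{real_algebra_1,comm_ring_1} poly)"
  by (rule poly_eqI) (simp add: coeff_map_poly)

lemma map_poly_of_real_smult: "map_poly of_real (Polynomial.smult c p) = Polynomial.smult (of_real c) (map_poly of_real p :: 'a::{real_algebra_1,comm_ring_1} poly)"
  by (rule poly_eqI) (simp add: coeff_map_poly)

lemma map_poly_of_real_mult: "map_poly of_real (p * q) = map_poly of_real p * (map_poly of_real q :: 'a::{real_algebra_1,comm_ring_1} poly)"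
  by (rule poly_eqI) (simp add: coeff_map_poly coeff_mult)

lemma map_poly_of_real_pderiv: "map_poly of_real (pderiv p) = pderiv (map_poly of_real p :: 'a::real_normed_field poly)"
  by (rule poly_eqI) (simp add: coeff_map_poly coeff_pderiv)

lemma rpoly_0 [simp]: "rpoly 0 z = 0"
  by (simp add: rpoly_def)

lemma rpoly_pCons [simp]: "rpoly (pCons a p) z = of_real a + z * rpoly p z"
  by (simp add: rpoly_def map_poly_pCons)

lemma rpoly_add [simp]: "rpoly (p + q) z = rpoly p z + rpoly q z"
  by (simp add: rpoly_def map_poly_of_real_add)

lemma rpoly_smult [simp]: "rpoly (Polynomial.smult c p) z = of_real c * rpoly p z"
  by (simp add: rpoly_def map_poly_of_real_smult)

lemma rpoly_mult [simp]: "rpoly (p * q) z = rpoly p z * rpoly q z"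
  by (simp add: rpoly_def map_poly_of_real_mult)

lemma rpoly_sum [simp]: "rpoly (\<Sum>i\<in>A. f i) z = (\<Sum>i\<in>A. rpoly (f i) z)"
  by (induction A rule: infinite_finite_induct) auto

lemma rpoly_of_real [simp]: "rpoly p (of_real x) = of_real (poly p x)"
  by (induction p) auto

lemma rpoly_real [simp]: "rpoly p x = poly p x" for x :: real
  using rpoly_of_real[of p x, where 'a = real] by simp

text \<open>The recurrence that Hermite's equation imposes on the derivatives of
  \<open>hermite (n + r)\<close>, read downwards from order \<open>r\<close>; index \<open>i\<close>
  stands for order \<open>r - i\<close>. The growing divisor is the damping.\<close>

fun damped_rec :: "nat \<Rightarrow> 'a \<Rightarrow> 'a \<Rightarrow> 'a \<Rightarrow> nat \<Rightarrow> 'a::real_normed_field" where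
  "damped_rec n z a b 0 = a"
| "damped_rec n z a b (Suc 0) = b"
| "damped_rec n z a b (Suc (Suc i)) =
     (2 * z * damped_rec n z a b (Suc i) - damped_rec n z a b i) / of_nat (2 * (n + i + 2))"

text \<open>A step divides at most \<open>2 * R + 1\<close> by at least \<open>2 * n\<close>, which
  is at most \<open>(R + 1) / n\<close> and hence at most 1, so the bound 1 for the preceding values
  persists. Index 0 obeys only the bound 1, whence \<open>0 < i\<close>.\<close>

lemma damped_rec_bound:
  assumes "norm z \<le> R" "R + 1 \<le> real n" "norm a \<le> 1" "norm b \<le> (R + 1) / real n" "0 < i"
  shows "norm (damped_rec n z a b i) \<le> (R + 1) / real n"
proof -
  have R: "0 \<le> R" using assms(1) norm_ge_zero[of z] by linarith
  have n: "0 < real n" using assms(2) R by linarith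
  have le1: "(R + 1) / real n \<le> 1" using assms(2) n by simp
  have "norm (damped_rec n z a b i) \<le> (if i = 0 then 1 else (R + 1) / real n)" for i
  proof (induction i rule: less_induct)
    case (less i)
    consider "i = 0" | "i = Suc 0" | k where "i = Suc (Suc k)" by (metis not0_implies_Suc)
    then show ?case
    proof cases
      case 3
      have 1: "norm (damped_rec n z a b (Suc k)) \<le> 1" "norm (damped_rec n z a b k) \<le> 1"
        using less.IH[of "Suc k"] less.IH[of k] 3 le1 by (auto split: if_splits)
      have "norm (2 * z * damped_rec n z a b (Suc k) - damped_rec n z a b k) \<le>
          2 * norm z * norm (damped_rec n z a b (Suc k)) + norm (damped_rec n z a b k)"
        by (rule order_trans[OF norm_triangle_ineq4]) (simp add: norm_mult)
      also have "\<dots> \<le> 2 * R * 1 + 1"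
        using assms(1) 1 R by (intro add_mono mult_mono) auto
      also have "\<dots> \<le> 2 * (R + 1)" by simp
      finally have "norm (2 * z * damped_rec n z a b (Suc k) - damped_rec n z a b k) \<le> 2 * (R + 1)" .
      then have "norm (damped_rec n z a b i) \<le> 2 * (R + 1) / real (2 * (n + k + 2))"
        unfolding 3 damped_rec.simps norm_divide norm_of_nat by (intro divide_right_mono) auto
      also have "\<dots> \<le> 2 * (R + 1) / (2 * real n)"
        using R n by (intro divide_left_mono) auto
      also have "\<dots> = (R + 1) / real n"
        by (rule mult_divide_mult_cancel_left) simp
      finally show ?thesis by (simp only: 3 nat.distinct if_False)
    qed (use assms in auto)
  qed
  from this[of i] assms(5) show ?thesis by simp
qed

text \<open>Every derivative of order below \<open>r\<close> is a combination of \<open>g\<close>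
  and its derivative with coefficients of order \<open>1 / n\<close>. In the expansion along the
  last column, row \<open>r\<close> contributes exactly \<open>W * g\<close> and the other rows form
  the error.\<close>

lemma norm_exc_minus_le:
  fixes z :: "'a::real_normed_field" and n r :: nat
  assumes "norm z \<le> R" "R + 1 \<le> real n"
  defines "g \<equiv> (pderiv ^^ r) (hermite (n + r))"
  shows "norm (rpoly (hdet (Suc r) (\<kappa>(r := n + r)) id) z - rpoly (hdet r \<kappa> id) z * rpoly g z)
     \<le> (\<Sum>i<r. norm (rpoly (hcof r \<kappa> i) z)) * ((R + 1) / real n * (norm (rpoly g z) + norm (rpoly (pderiv g) z)))"
proof -
  have R: "0 \<le> R" using assms(1) norm_ge_zero[of z] by linarith
  have n: "0 < real n" using assms(2) R by linarith
  let ?y = "\<lambda>j. rpoly ((pderiv ^^ j) (hermite (n + r))) z"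
  \<comment> \<open>The coefficients of \<open>?y r\<close> and \<open>?y (Suc r)\<close> in
    \<open>?y (r - i)\<close>. Their start values come from \<open>?y r\<close> itself and from one
    step of the recurrence, \<open>2 (n + 1) y_(r-1) = 2 z y_r - y_(r+1)\<close>.\<close>
  let ?a = "damped_rec n z 1 (z / of_nat (n + 1))"
  let ?b = "damped_rec n z 0 (- 1 / of_nat (2 * (n + 1)))"
  have step: "of_nat (2 * (n + r - j)) * ?y j = 2 * z * ?y (Suc j) - ?y (Suc (Suc j))" if "j \<le> n + r" for j
  proof -
    have h1: "?y (Suc (Suc j)) = 2 * z * ?y (Suc j) + of_real (2 * real j - 2 * real (n + r)) * ?y j"
      unfolding hermite_ode_higher by (simp add: mult.commute)
    have h2: "of_real (2 * real j - 2 * real (n + r)) = - (of_nat (2 * (n + r - j)) :: 'a)"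
      using that by (simp add: of_nat_diff algebra_simps)
    have "d * u = w - (w + - d * u)" for d u w :: 'a by simp
    then show ?thesis unfolding h1 h2 .
  qed
  have nz: "(of_nat (2 * (n + Suc i)) :: 'a) \<noteq> 0" for i
    by (metis add_Suc_right mult_is_0 nat.distinct(1) numeral_eq_Suc of_nat_eq_0_iff)
  have y: "?y (r - i) = ?a i * ?y r + ?b i * ?y (Suc r)" if "i \<le> r" for i
    using that
  proof (induction i rule: less_induct)
    case (less i)
    consider "i = 0" | "i = Suc 0" | k where "i = Suc (Suc k)" by (metis not0_implies_Suc)
    then show ?case
    proof cases
      case 2
      then have j: "Suc (r - i) = r" "n + r - (r - i) = n + 1" using less.prems by auto
      have "of_nat (2 * (n + 1)) * ?y (r - i) = 2 * z * ?y r - ?y (Suc r)"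
        using step[of "r - i"] unfolding j by simp
      moreover have "(of_nat (2 * (n + 1)) :: 'a) \<noteq> 0" using nz[of 0] by simp
      ultimately have "?y (r - i) = (2 * z * ?y r - ?y (Suc r)) / of_nat (2 * (n + 1))"
        by (simp only: eq_divide_eq) (simp add: mult.commute)
      also have "\<dots> = 2 * z / of_nat (2 * (n + 1)) * ?y r + (- 1 / of_nat (2 * (n + 1))) * ?y (Suc r)"
        by (simp only: diff_divide_distrib times_divide_eq_left) simp
      also have "2 * z / of_nat (2 * (n + 1)) = z / of_nat (n + 1)"
        by (simp only: of_nat_mult of_nat_numeral mult_divide_mult_cancel_left_if) simp
      finally show ?thesis by (simp add: 2)
    next
      case 3
      then have j: "Suc (r - i) = r - Suc k" "Suc (r - Suc k) = r - k" "n + r - (r - i) = n + Suc (Suc k)"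
        using less.prems by auto
      have "of_nat (2 * (n + Suc (Suc k))) * ?y (r - i) = 2 * z * ?y (r - Suc k) - ?y (r - k)"
        using step[of "r - i"] unfolding j by simp
      then have "?y (r - i) = (2 * z * ?y (r - Suc k) - ?y (r - k)) / of_nat (2 * (n + Suc (Suc k)))"
        using nz[of "Suc k"] by (simp only: eq_divide_eq) (simp add: mult.commute)
      also have "\<dots> = (2 * z * (?a (Suc k) * ?y r + ?b (Suc k) * ?y (Suc r)) - (?a k * ?y r + ?b k * ?y (Suc r)))
          / of_nat (2 * (n + Suc (Suc k)))"
        using less.IH[of "Suc k"] less.IH[of k] less.prems 3 by simp
      also have "\<dots> = ?a i * ?y r + ?b i * ?y (Suc r)"
        unfolding 3 damped_rec.simps
        by (simp only: diff_divide_distrib add_divide_distrib distrib_left times_divide_eq_left left_diff_distrib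
            mult.assoc numeral_2_eq_2 add_Suc_right add_0_right) (simp add: algebra_simps)
      finally show ?thesis .
    qed simp
  qed
  define c where "c = (R + 1) / real n"
  have lin: "norm (a * u + b * w) \<le> c * (norm u + norm w)" if "norm a \<le> c" "norm b \<le> c" for a b u w :: 'a
    by (rule order_trans[OF norm_triangle_ineq])
      (simp add: norm_mult distrib_left add_mono mult_right_mono that)
  have bnd: "norm (?y j) \<le> c * (norm (?y r) + norm (?y (Suc r)))" if "j < r" for j
  proof -
    have "norm (?a (r - j)) \<le> c" unfolding c_def
    proof (rule damped_rec_bound[OF assms(1,2)])
      have "norm z / real (n + 1) \<le> (R + 1) / real n"
        using assms(1) R n by (intro frac_le) auto
      then show "norm (z / of_nat (n + 1)) \<le> (R + 1) / real n"
        by (simp only: norm_divide norm_of_nat)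
    qed (use that in auto)
    moreover have "norm (?b (r - j)) \<le> c" unfolding c_def
    proof (rule damped_rec_bound[OF assms(1,2)])
      have "1 / real (2 * (n + 1)) \<le> (R + 1) / real n"
        using R n by (intro frac_le) auto
      then show "norm (- 1 / of_nat (2 * (n + 1)) :: 'a) \<le> (R + 1) / real n"
        by (simp only: norm_divide norm_of_nat norm_minus_cancel norm_one)
    qed (use that in auto)
    moreover have "?y j = ?a (r - j) * ?y r + ?b (r - j) * ?y (Suc r)"
      using y[of "r - j"] that by simp
    ultimately show ?thesis by (simp only: lin)
  qed
  have "rpoly (hdet (Suc r) (\<kappa>(r := n + r)) id) z - rpoly (hdet r \<kappa> id) z * rpoly g z =
      (\<Sum>i<r. rpoly (hcof r \<kappa> i) z * ?y i)"
    unfolding exc_expansion lessThan_Suc_atMost[symmetric] by (simp add: g_def hcof_last)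
  also have "norm \<dots> \<le> (\<Sum>i<r. norm (rpoly (hcof r \<kappa> i) z) * (c * (norm (?y r) + norm (?y (Suc r)))))"
    by (intro sum_norm_le) (auto simp only: norm_mult lessThan_iff intro!: mult_left_mono bnd norm_ge_zero)
  finally show ?thesis by (simp only: g_def sum_distrib_right c_def funpow.simps comp_def)
qed

section \<open>Real zeros\<close>

lemma poly_ratio_bounded_interval:
  fixes p q :: "real poly"
  assumes "\<And>x. x \<in> {-1..1} \<Longrightarrow> poly q x \<noteq> 0"
  shows "\<exists>D\<ge>0. \<forall>x\<in>{-1..1}. \<bar>poly p x\<bar> \<le> D * \<bar>poly q x\<bar>"
proof -
  have "compact ((\<lambda>x. poly p x / poly q x) ` {-1..1})"
    using assms by (intro compact_continuous_image continuous_intros) auto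
  then obtain D where D: "\<And>x. x \<in> {-1..1} \<Longrightarrow> \<bar>poly p x / poly q x\<bar> \<le> D"
    by (force dest!: compact_imp_bounded simp: bounded_iff)
  have "\<bar>poly p x\<bar> \<le> D * \<bar>poly q x\<bar>" if "x \<in> {-1..1}" for x
    using D[OF that] assms[OF that] by (simp add: abs_divide divide_le_eq)
  moreover have "0 \<le> D" by (rule order_trans[OF abs_ge_zero D[of 0]]) simp
  ultimately show ?thesis by blast
qed

text \<open>The substitution \<open>x = 1 / t\<close> reduces the neighbourhood of infinity to a compact interval.\<close>

lemma poly_ratio_bounded:
  fixes p q :: "real poly"
  assumes q: "\<And>x. poly q x \<noteq> 0" and d: "degree p \<le> degree q"
  shows "\<exists>D\<ge>0. \<forall>x. \<bar>poly p x\<bar> \<le> D * \<bar>poly q x\<bar>"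
proof -
  let ?p = "monom 1 (degree q - degree p) * reflect_poly p"
  have "q \<noteq> 0" using q[of 0] by auto
  have rq: "poly (reflect_poly q) t \<noteq> 0" for t
    using q[of "inverse t"] \<open>q \<noteq> 0\<close> by (cases "t = 0") (auto simp: poly_reflect_poly_nz)
  obtain D1 where D1: "0 \<le> D1" "\<And>x. x \<in> {-1..1} \<Longrightarrow> \<bar>poly p x\<bar> \<le> D1 * \<bar>poly q x\<bar>"
    using poly_ratio_bounded_interval[of q p] q by blast
  obtain D2 where D2: "0 \<le> D2" "\<And>x. x \<in> {-1..1} \<Longrightarrow> \<bar>poly ?p x\<bar> \<le> D2 * \<bar>poly (reflect_poly q) x\<bar>"
    using poly_ratio_bounded_interval[of "reflect_poly q" ?p] rq by blast
  have "\<bar>poly p x\<bar> \<le> max D1 D2 * \<bar>poly q x\<bar>" for x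
  proof (cases "x \<in> {-1..1}")
    case True
    have "D1 * \<bar>poly q x\<bar> \<le> max D1 D2 * \<bar>poly q x\<bar>" by (intro mult_right_mono) auto
    with D1(2)[OF True] show ?thesis by linarith
  next
    case False
    define t where "t = inverse x"
    have x: "x = inverse t" "t \<noteq> 0" using False by (auto simp: t_def)
    have "\<bar>x\<bar> \<ge> 1" using False by auto
    then have "\<bar>t\<bar> \<le> 1" unfolding t_def by (simp add: abs_inverse inverse_le_1_iff)
    then have "t \<in> {-1..1}" by auto
    from D2(2)[OF this] have "\<bar>t ^ (degree q - degree p) * t ^ degree p * poly p x\<bar> \<le> D2 * \<bar>t ^ degree q * poly q x\<bar>"
      using x(2) by (simp add: poly_reflect_poly_nz poly_monom x(1) mult.assoc)
    also have "t ^ (degree q - degree p) * t ^ degree p = t ^ degree q"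
      using d by (simp flip: power_add)
    finally have "\<bar>t\<bar> ^ degree q * \<bar>poly p x\<bar> \<le> \<bar>t\<bar> ^ degree q * (D2 * \<bar>poly q x\<bar>)"
      by (simp add: abs_mult power_abs mult_ac)
    then have "\<bar>poly p x\<bar> \<le> D2 * \<bar>poly q x\<bar>" using x(2) by simp
    moreover have "D2 * \<bar>poly q x\<bar> \<le> max D1 D2 * \<bar>poly q x\<bar>" by (intro mult_right_mono) auto
    ultimately show ?thesis by linarith
  qed
  then show ?thesis using D1(1) by (intro exI[of _ "max D1 D2"]) auto
qed

section \<open>Zeros and critical points of the Hermite polynomials\<close>

lemma hermite_three_term:
  "poly (hermite (Suc (Suc n))) x = 2 * x * poly (hermite (Suc n)) x - 2 * (real n + 1) * poly (hermite n) x"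
  unfolding hermite.simps(2)[of "Suc n"] pderiv_hermite_Suc by simp

text \<open>From \<open>sqrt (2 * n)\<close> on, the positive term of the three-term recurrence
  dominates, and inductively each quotient of consecutive polynomials is at least \<open>x\<close>.
  At \<open>sqrt (2 * n)\<close> this bounds the logarithmic derivative of \<open>hermite n\<close>
  by \<open>sqrt (2 * n)\<close>.\<close>

lemma hermite_pos:
  assumes "0 < x" "2 * real n \<le> x\<^sup>2" "k \<le> n"
  shows "0 < poly (hermite k) x" "x * poly (hermite k) x \<le> poly (hermite (Suc k)) x"
proof -
  have "0 < poly (hermite k) x \<and> x * poly (hermite k) x \<le> poly (hermite (Suc k)) x"
    using assms(3)
  proof (induction k)
    case 0
    then show ?case using assms(1) by (simp add: hermite.simps(2))
  next
    case (Suc k)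
    then have IH: "0 < poly (hermite k) x" "x * poly (hermite k) x \<le> poly (hermite (Suc k)) x" by auto
    have pos: "0 < poly (hermite (Suc k)) x" using IH assms(1) by (meson less_le_trans mult_pos_pos)
    have "x * (2 * (real k + 1) * poly (hermite k) x) \<le> 2 * (real k + 1) * poly (hermite (Suc k)) x"
      using IH(2) mult_left_mono[OF IH(2), of "2 * (real k + 1)"] by (simp add: mult_ac)
    also have "\<dots> \<le> x\<^sup>2 * poly (hermite (Suc k)) x"
      using Suc.prems assms(2) pos by (intro mult_right_mono) auto
    finally have "x * (2 * (real k + 1) * poly (hermite k) x) \<le> x * (x * poly (hermite (Suc k)) x)"
      by (simp add: power2_eq_square mult_ac)
    then have "2 * (real k + 1) * poly (hermite k) x \<le> x * poly (hermite (Suc k)) x"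
      using assms(1) by (simp only: mult_le_cancel_left_pos)
    then show ?case unfolding hermite_three_term using pos by (simp add: algebra_simps)
  qed
  then show "0 < poly (hermite k) x" "x * poly (hermite k) x \<le> poly (hermite (Suc k)) x" by auto
qed

lemma hermite_minus: "poly (hermite k) (- x) = (- 1) ^ k * poly (hermite k) x"
proof (induction k rule: less_induct)
  case (less k)
  consider "k = 0" | "k = Suc 0" | j where "k = Suc (Suc j)" by (metis not0_implies_Suc)
  then show ?case
  proof cases
    case 3
    then show ?thesis
      unfolding 3 hermite_three_term using less.IH[of j] less.IH[of "Suc j"] 3 by (simp add: algebra_simps)
  qed (simp_all add: hermite.simps(2))
qed

lemma prod_linear_sign:
  fixes b :: real
  assumes "finite S" "b \<notin> S"
  shows "0 < (- 1) ^ card {a \<in> S. b < a} * (\<Prod>a\<in>S. b - a)"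
  using assms
proof (induction S rule: finite_induct)
  case (insert c S)
  show ?case
  proof (cases "b < c")
    case True
    then have "{a \<in> insert c S. b < a} = insert c {a \<in> S. b < a}" by auto
    then have eq: "(- 1) ^ card {a \<in> insert c S. b < a} * (\<Prod>a\<in>insert c S. b - a) =
        (c - b) * ((- 1) ^ card {a \<in> S. b < a} * (\<Prod>a\<in>S. b - a))"
      using insert.hyps by (simp add: algebra_simps)
    show ?thesis unfolding eq by (rule mult_pos_pos) (use insert True in auto)
  next
    case False
    then have "{a \<in> insert c S. b < a} = {a \<in> S. b < a}" by auto
    then have eq: "(- 1) ^ card {a \<in> insert c S. b < a} * (\<Prod>a\<in>insert c S. b - a) =
        (b - c) * ((- 1) ^ card {a \<in> S. b < a} * (\<Prod>a\<in>S. b - a))"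
      using insert.hyps by (simp add: algebra_simps)
    show ?thesis unfolding eq by (rule mult_pos_pos) (use insert False in auto)
  qed
qed simp

lemma alternates_imp_roots:
  assumes "alternates (poly p) N t"
  shows "\<exists>S. finite S \<and> card S = N \<and> (\<forall>x\<in>S. poly p x = 0)"
proof -
  have "\<exists>s. t i < s \<and> s < t (Suc i) \<and> poly p s = 0" if i: "i < N" for i
  proof -
    have a: "t i < t (Suc i)" "poly p (t i) * poly p (t (Suc i)) < 0"
      using assms i by (auto simp: alternates_def)
    show ?thesis using poly_IVT[OF a] by auto
  qed
  then obtain s where s: "\<And>i. i < N \<Longrightarrow> t i < s i \<and> s i < t (Suc i) \<and> poly p (s i) = 0" by metis
  have mono: "t i \<le> t j" if "i \<le> j" "j \<le> N" for i j
    using that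
  proof (induction j rule: dec_induct)
    case (step k)
    then have "t k < t (Suc k)" using assms by (auto simp: alternates_def)
    then show ?case using step by simp
  qed simp
  have lt: "s i < s j" if "i < j" "j < N" for i j
    using s[of i] s[of j] mono[of "Suc i" j] that by force
  have "inj_on s {..<N}"
    by (rule inj_onI) (metis lessThan_iff less_irrefl linorder_neqE_nat lt)
  then show ?thesis using s by (intro exI[of _ "s ` {..<N}"]) (auto simp: card_image)
qed

text \<open>At a zero of \<open>hermite n\<close> the recursion reduces
  \<open>hermite (Suc n)\<close> to minus the derivative of \<open>hermite n\<close>, whose signs
  alternate along simple zeros. The ends \<open>-B\<close> and \<open>B\<close> lie outside all
  these zeros and contribute the two missing points.\<close>

lemma hermite_alternates_step:
  assumes S: "finite S" "card S = n" "hermite n = Polynomial.smult (2 ^ n) (\<Prod>a\<in>S. [:- a, 1:])"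
    and B: "0 < B" "2 * (real n + 1) \<le> B\<^sup>2"
  shows "\<exists>t. alternates (poly (hermite (Suc n))) (Suc n) t \<and> t 0 = - B \<and> t (Suc n) = B \<and>
           (\<forall>i. 0 < i \<and> i \<le> n \<longrightarrow> poly (hermite n) (t i) = 0)"
proof -
  have root: "poly (hermite n) b = 0" if "b \<in> S" for b
    using that S(1) by (auto simp: S(3) poly_prod)
  have inB: "- B < b \<and> b < B" if "b \<in> S" for b
  proof (rule ccontr)
    assume "\<not> ?thesis"
    then have "B \<le> \<bar>b\<bar>" by auto
    then have "2 * real n \<le> \<bar>b\<bar>\<^sup>2" "0 < \<bar>b\<bar>"
      using B power_mono[of B "\<bar>b\<bar>" 2] by auto
    then have "0 < poly (hermite n) \<bar>b\<bar>" by (intro hermite_pos(1)) auto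
    then have "poly (hermite n) b \<noteq> 0"
      using hermite_minus[of n b] by (cases "b \<ge> 0") auto
    with root[OF that] show False by simp
  qed
  have Hb: "poly (hermite (Suc n)) b = - (2 ^ n * (\<Prod>a\<in>S - {b}. b - a))" if b: "b \<in> S" for b
  proof -
    have "poly (pderiv (\<Prod>a\<in>S. [:- a, 1:])) b = (\<Sum>a\<in>S. \<Prod>c\<in>S - {a}. b - c)"
      by (simp add: pderiv_prod poly_sum poly_prod pderiv_pCons)
    also have "\<dots> = (\<Sum>a\<in>{b}. \<Prod>c\<in>S - {a}. b - c)"
      using S(1) b by (intro sum.mono_neutral_right) (auto simp: prod_zero_iff)
    finally have "poly (pderiv (hermite n)) b = 2 ^ n * (\<Prod>a\<in>S - {b}. b - a)"
      unfolding S(3) by (simp add: pderiv_smult)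
    then show ?thesis using root[OF b] by (simp add: hermite.simps(2))
  qed
  define w where "w = (\<lambda>i. sorted_list_of_set S ! i)"
  have len: "length (sorted_list_of_set S) = n" using S by simp
  have w_mono: "w i < w j" if "i < j" "j < n" for i j
    unfolding w_def using that len strict_sorted_list_of_set[of S] by (simp add: sorted_wrt_nth_less)
  have wS: "w i \<in> S" if "i < n" for i
    unfolding w_def using that len S(1) nth_mem[of i "sorted_list_of_set S"] by simp
  have Sw: "S = w ` {..<n}"
  proof -
    have "S = set (sorted_list_of_set S)" using S(1) by simp
    also have "\<dots> = w ` {..<n}" unfolding set_conv_nth len w_def by auto
    finally show ?thesis .
  qed
  have w_inj: "inj_on w {..<n}"
    by (rule inj_onI) (metis lessThan_iff less_irrefl linorder_neqE_nat w_mono)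
  have cnt: "card {a \<in> S - {w k}. w k < a} = n - 1 - k" if "k < n" for k
  proof -
    have "{a \<in> S - {w k}. w k < a} = w ` {k<..<n}"
    proof (intro equalityI subsetI)
      fix a assume "a \<in> {a \<in> S - {w k}. w k < a}"
      then obtain j where j: "j < n" "a = w j" "w k < w j" unfolding Sw by auto
      then have "k < j" using w_mono[of j k] that by (metis less_asym linorder_neqE_nat less_irrefl)
      with j show "a \<in> w ` {k<..<n}" by auto
    next
      fix a assume "a \<in> w ` {k<..<n}"
      then obtain j where "k < j" "j < n" "a = w j" by auto
      then show "a \<in> {a \<in> S - {w k}. w k < a}" using w_mono[of k j] wS[of j] by auto
    qed
    moreover have "inj_on w {k<..<n}" by (rule inj_on_subset[OF w_inj]) auto
    ultimately show ?thesis by (simp add: card_image)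
  qed
  define t where "t = (\<lambda>i. if i = 0 then - B else if i \<le> n then w (i - 1) else B)"
  have HB: "0 < poly (hermite (Suc n)) B" using B by (intro hermite_pos(1)[of B "Suc n"]) auto
  have sgn: "0 < (- 1) ^ (Suc n - i) * poly (hermite (Suc n)) (t i)" if "i \<le> Suc n" for i
  proof -
    have "i = 0 \<or> i = Suc n \<or> (\<exists>k. i = Suc k \<and> k < n)" using that by (cases i) auto
    then consider "i = 0" | "i = Suc n" | k where "i = Suc k" "k < n" by blast
    then show ?thesis
    proof cases
      case 1
      then show ?thesis using HB by (simp add: t_def hermite_minus flip: power_add mult.assoc)
    next
      case 2
      then show ?thesis using HB by (simp add: t_def)
    next
      case 3
      have "0 < (- 1) ^ (n - 1 - k) * (\<Prod>a\<in>S - {w k}. w k - a)"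
        using prod_linear_sign[of "S - {w k}" "w k"] S(1) unfolding cnt[OF 3(2)] by simp
      then have "0 < 2 ^ n * ((- 1) ^ (n - 1 - k) * (\<Prod>a\<in>S - {w k}. w k - a))" by simp
      moreover have "n - k = Suc (n - 1 - k)" using 3 by simp
      ultimately show ?thesis using 3 Hb[OF wS[OF 3(2)]] by (simp add: t_def mult_ac)
    qed
  qed
  have "t i < t (Suc i) \<and> poly (hermite (Suc n)) (t i) * poly (hermite (Suc n)) (t (Suc i)) < 0" if "i < Suc n" for i
  proof
    show "t i < t (Suc i)"
      unfolding t_def using that inB wS w_mono[of "i - 1" i] B(1) by (cases i) auto
    have e: "Suc n - i = Suc (Suc n - Suc i)" using that by simp
    have "0 < (- 1) ^ (Suc n - i) * poly (hermite (Suc n)) (t i)" by (rule sgn) (use that in simp)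
    then have "0 < (- 1) * (- 1) ^ (Suc n - Suc i) * poly (hermite (Suc n)) (t i)"
      by (simp only: e power_Suc)
    moreover have "0 < (- 1) ^ (Suc n - Suc i) * poly (hermite (Suc n)) (t (Suc i))"
      by (rule sgn) (use that in simp)
    ultimately have "0 < ((- 1) * (- 1) ^ (Suc n - Suc i) * poly (hermite (Suc n)) (t i)) *
        ((- 1) ^ (Suc n - Suc i) * poly (hermite (Suc n)) (t (Suc i)))"
      by (rule mult_pos_pos)
    also have "\<dots> = - (((- 1) ^ (Suc n - Suc i) * (- 1) ^ (Suc n - Suc i)) *
        (poly (hermite (Suc n)) (t i) * poly (hermite (Suc n)) (t (Suc i))))"
      by (simp only: mult_ac mult_minus_left mult_1)
    also have "(- 1) ^ (Suc n - Suc i) * (- 1) ^ (Suc n - Suc i) = (1 :: real)"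
      by (simp flip: power_add mult_2)
    finally show "poly (hermite (Suc n)) (t i) * poly (hermite (Suc n)) (t (Suc i)) < 0"
      by (simp only: mult_1_left neg_0_less_iff_less)
  qed
  then have "alternates (poly (hermite (Suc n))) (Suc n) t" unfolding alternates_def by blast
  then show ?thesis using root wS by (intro exI[of _ t]) (auto simp: t_def)
qed

lemma hermite_real_rooted:
  "\<exists>S. finite S \<and> card S = n \<and> hermite n = Polynomial.smult (2 ^ n) (\<Prod>a\<in>S. [:- a, 1:])"
proof (induction n)
  case 0
  then show ?case by (intro exI[of _ "{}"]) simp
next
  case (Suc n)
  then obtain S where S: "finite S" "card S = n" "hermite n = Polynomial.smult (2 ^ n) (\<Prod>a\<in>S. [:- a, 1:])" by blast
  obtain t where "alternates (poly (hermite (Suc n))) (Suc n) t"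
    using hermite_alternates_step[OF S, of "sqrt (2 * (real n + 1))"] by auto
  from alternates_imp_roots[OF this]
  obtain S' where S': "finite S'" "card S' = Suc n" "\<And>x. x \<in> S' \<Longrightarrow> poly (hermite (Suc n)) x = 0"
    by blast
  define q where "q = Polynomial.smult (2 ^ Suc n :: real) (\<Prod>a\<in>S'. [:- a, 1:])"
  have dp: "degree (\<Prod>a\<in>S'. [:- a, 1:] :: real poly) = Suc n"
    using S'(2) by (subst degree_prod_eq_sum_degree) auto
  have "lead_coeff (\<Prod>a\<in>S'. [:- a, 1:] :: real poly) = 1" by (subst lead_coeff_prod) auto
  then have q: "degree q = Suc n" "coeff q (Suc n) = 2 ^ Suc n"
    using dp by (auto simp: q_def)
  have "hermite (Suc n) - q = 0"
  proof (rule ccontr)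
    assume nz: "hermite (Suc n) - q \<noteq> 0"
    have "degree (hermite (Suc n) - q) < Suc n"
    proof (rule ccontr)
      assume "\<not> ?thesis"
      moreover have "degree (hermite (Suc n) - q) \<le> Suc n"
        using degree_diff_le_max[of "hermite (Suc n)" q] q(1) by simp
      ultimately have "degree (hermite (Suc n) - q) = Suc n" by simp
      moreover have "coeff (hermite (Suc n) - q) (Suc n) = 0" using q(2) by (simp add: lead_coeff_hermite)
      ultimately show False using nz by (metis leading_coeff_0_iff)
    qed
    moreover have "S' \<subseteq> {x. poly (hermite (Suc n) - q) x = 0}"
      using S' by (auto simp: q_def poly_prod)
    then have "Suc n \<le> card {x. poly (hermite (Suc n) - q) x = 0}"
      using S'(2) card_mono[OF poly_roots_finite[OF nz]] by metis
    ultimately show False using card_poly_roots_bound[OF nz] by linarith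
  qed
  then show ?case using S' by (intro exI[of _ S']) (simp add: q_def)
qed

text \<open>The inner points are critical points of \<open>hermite n\<close>, where the derivative
  in the error estimate vanishes. At the two ends it does not vanish, but the logarithmic derivative
  is at most \<open>sqrt (2 * n)\<close>.\<close>

lemma hermite_alternates:
  assumes "0 < n"
  shows "\<exists>t. alternates (poly (hermite n)) n t \<and>
     (\<forall>i\<le>n. \<bar>t i\<bar> \<le> sqrt (2 * real n) \<and>
        (poly (pderiv (hermite n)) (t i) = 0 \<or>
          \<bar>t i\<bar> = sqrt (2 * real n) \<and> \<bar>poly (pderiv (hermite n)) (t i)\<bar> \<le> sqrt (2 * real n) * \<bar>poly (hermite n) (t i)\<bar>))"
proof -
  obtain m where n: "n = Suc m" using assms by (cases n) auto
  define B where "B = sqrt (2 * real n)"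
  have B: "0 < B" "B\<^sup>2 = 2 * real n" using n by (auto simp: B_def)
  obtain S where S: "finite S" "card S = m" "hermite m = Polynomial.smult (2 ^ m) (\<Prod>a\<in>S. [:- a, 1:])"
    using hermite_real_rooted by blast
  obtain t where t: "alternates (poly (hermite n)) n t" "t 0 = - B" "t n = B"
     "\<And>i. 0 < i \<Longrightarrow> i \<le> m \<Longrightarrow> poly (hermite m) (t i) = 0"
    using hermite_alternates_step[OF S, of B] B unfolding n by (auto simp: algebra_simps)
  have mono: "t i \<le> t j" if "i \<le> j" "j \<le> n" for i j
    using that
  proof (induction j rule: dec_induct)
    case (step k)
    then have "t k < t (Suc k)" using t(1) by (auto simp: alternates_def)
    then show ?case using step by simp
  qed simp
  have "\<bar>t i\<bar> \<le> B" if "i \<le> n" for i using mono[of 0 i] mono[of i n] t(2,3) that by auto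
  moreover have d: "poly (pderiv (hermite n)) x = 2 * real n * poly (hermite m) x" for x
    unfolding n pderiv_hermite_Suc by simp
  have e: "\<bar>poly (pderiv (hermite n)) B\<bar> \<le> B * \<bar>poly (hermite n) B\<bar>"
  proof -
    have 1: "0 < poly (hermite m) B" "0 < poly (hermite n) B" using B n by (auto intro!: hermite_pos(1)[of B n])
    have 2: "B * poly (hermite m) B \<le> poly (hermite n) B" using hermite_pos(2)[of B n m] B n by auto
    have "poly (pderiv (hermite n)) B = B * (B * poly (hermite m) B)"
      unfolding d B(2)[symmetric] by (simp add: power2_eq_square)
    also have "\<dots> \<le> B * poly (hermite n) B" using B 2 by (intro mult_left_mono) auto
    finally show ?thesis using 1 B by (simp add: d)
  qed
  have e': "\<bar>poly (pderiv (hermite n)) (- B)\<bar> \<le> B * \<bar>poly (hermite n) (- B)\<bar>"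
    using e unfolding d hermite_minus by (simp add: abs_mult power_abs)
  have "poly (pderiv (hermite n)) (t i) = 0 \<or>
      \<bar>t i\<bar> = B \<and> \<bar>poly (pderiv (hermite n)) (t i)\<bar> \<le> B * \<bar>poly (hermite n) (t i)\<bar>" if i: "i \<le> n" for i
  proof -
    consider "i = 0" | "i = n" | "0 < i" "i \<le> m" using i n by linarith
    then show ?thesis by cases (use t e e' B in \<open>auto simp: d\<close>)
  qed
  ultimately show ?thesis using t(1) unfolding B_def by blast
qed

section \<open>Sign changes of the exceptional polynomial on the real line\<close>

locale zero_free_wronskian =
  fixes r :: nat and \<kappa> :: "nat \<Rightarrow> nat"
  assumes inj: "inj_on \<kappa> {..<r}"
    and real_zero_free: "poly (hdet r \<kappa> id) x \<noteq> 0"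
begin

definition W :: "real poly" where "W = hdet r \<kappa> id"

definition P :: "nat \<Rightarrow> real poly" where "P n = hdet (Suc r) (\<kappa>(r := n + r)) id"

definition g :: "nat \<Rightarrow> real poly" where "g n = (pderiv ^^ r) (hermite (n + r))"

lemma W_real: "poly W x \<noteq> 0"
  using real_zero_free by (simp add: W_def)

lemma g_hermite: "\<exists>c>0. g n = Polynomial.smult c (hermite n)"
  unfolding g_def higher_pderiv_hermite by (intro exI[of _ "2 ^ r * fact (n + r) / fact n"]) auto

lemma P_minus_le:
  fixes z :: "'a::real_normed_field"
  assumes "norm z \<le> R" "R + 1 \<le> real n"
  shows "norm (rpoly (P n) z - rpoly W z * rpoly (g n) z)
     \<le> (\<Sum>i<r. norm (rpoly (hcof r \<kappa> i) z)) * ((R + 1) / real n * (norm (rpoly (g n) z) + norm (rpoly (pderiv (g n)) z)))"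
  unfolding P_def W_def g_def by (rule norm_exc_minus_le[OF assms])

text \<open>\<open>W\<close> has no real zero and larger degree than each cofactor, even by at least
  one, which pays for the factor \<open>\<bar>x\<bar>\<close> in the second bound.\<close>

lemma hcof_bound:
  "\<exists>D\<ge>0. \<forall>x::real. (\<Sum>i<r. \<bar>poly (hcof r \<kappa> i) x\<bar>) \<le> D * \<bar>poly W x\<bar> \<and>
      \<bar>x\<bar> * (\<Sum>i<r. \<bar>poly (hcof r \<kappa> i) x\<bar>) \<le> D * \<bar>poly W x\<bar>"
proof -
  have "\<exists>D\<ge>0. \<forall>x. \<bar>poly (hcof r \<kappa> i) x\<bar> \<le> D * \<bar>poly W x\<bar>" if "i < r" for i
    using degree_hcof_less[OF inj that] W_real unfolding W_def[symmetric]
    by (cases "hcof r \<kappa> i = 0") (auto intro!: poly_ratio_bounded)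
  then obtain D1 where D1: "\<And>i. i < r \<Longrightarrow> 0 \<le> D1 i" "\<And>i x. i < r \<Longrightarrow> \<bar>poly (hcof r \<kappa> i) x\<bar> \<le> D1 i * \<bar>poly W x\<bar>"
    by metis
  have "\<exists>D\<ge>0. \<forall>x. \<bar>poly ([:0, 1:] * hcof r \<kappa> i) x\<bar> \<le> D * \<bar>poly W x\<bar>" if i: "i < r" for i
  proof (rule poly_ratio_bounded)
    show "degree ([:0, 1:] * hcof r \<kappa> i) \<le> degree W"
    proof (cases "hcof r \<kappa> i = 0")
      case False
      then show ?thesis using degree_hcof_less[OF inj i] by (simp add: W_def)
    qed simp
  qed (use W_real in auto)
  then obtain D2 where D2: "\<And>i. i < r \<Longrightarrow> 0 \<le> D2 i"
      "\<And>i x. i < r \<Longrightarrow> \<bar>poly ([:0, 1:] * hcof r \<kappa> i) x\<bar> \<le> D2 i * \<bar>poly W x\<bar>"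
    by metis
  define D where "D = (\<Sum>i<r. D1 i) + (\<Sum>i<r. D2 i)"
  have nn: "0 \<le> (\<Sum>i<r. D1 i)" "0 \<le> (\<Sum>i<r. D2 i)" using D1 D2 by (auto intro!: sum_nonneg)
  have "(\<Sum>i<r. \<bar>poly (hcof r \<kappa> i) x\<bar>) \<le> D * \<bar>poly W x\<bar>" for x
  proof -
    have "(\<Sum>i<r. \<bar>poly (hcof r \<kappa> i) x\<bar>) \<le> (\<Sum>i<r. D1 i * \<bar>poly W x\<bar>)"
      using D1 by (intro sum_mono) auto
    also have "\<dots> \<le> D * \<bar>poly W x\<bar>"
      unfolding D_def sum_distrib_right[symmetric] using nn by (intro mult_right_mono) auto
    finally show ?thesis .
  qed
  moreover have "\<bar>x\<bar> * (\<Sum>i<r. \<bar>poly (hcof r \<kappa> i) x\<bar>) \<le> D * \<bar>poly W x\<bar>" for x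
  proof -
    have "\<bar>x\<bar> * (\<Sum>i<r. \<bar>poly (hcof r \<kappa> i) x\<bar>) = (\<Sum>i<r. \<bar>poly ([:0, 1:] * hcof r \<kappa> i) x\<bar>)"
      by (simp add: sum_distrib_left abs_mult)
    also have "\<dots> \<le> (\<Sum>i<r. D2 i * \<bar>poly W x\<bar>)"
      using D2 by (intro sum_mono) auto
    also have "\<dots> \<le> D * \<bar>poly W x\<bar>"
      unfolding D_def sum_distrib_right[symmetric] using nn by (intro mult_right_mono) auto
    finally show ?thesis .
  qed
  moreover have "0 \<le> D" using nn by (simp add: D_def)
  ultimately show ?thesis by blast
qed

text \<open>At the alternation points of \<open>hermite n\<close> the error is smaller than
  \<open>W * g\<close>, so \<open>P n\<close> inherits the sign of \<open>W * g\<close>, and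
  \<open>W\<close> has constant sign. At the ends the derivative of \<open>g\<close> can be
  \<open>R\<close> times \<open>g\<close>; then \<open>(R + 1) / n * (R + 1)\<close> tends to 2 and
  not to 0. The second cofactor bound gains the missing factor \<open>1 / R\<close>, because
  \<open>\<bar>x\<bar> = R\<close> there.\<close>

lemma P_alternates:
  assumes n: "0 < n" and D: "0 \<le> D" "\<And>x::real. (\<Sum>i<r. \<bar>poly (hcof r \<kappa> i) x\<bar>) \<le> D * \<bar>poly W x\<bar>"
      "\<And>x::real. \<bar>x\<bar> * (\<Sum>i<r. \<bar>poly (hcof r \<kappa> i) x\<bar>) \<le> D * \<bar>poly W x\<bar>"
    and R: "R = sqrt (2 * real n)" "R + 1 \<le> real n" "D * ((R + 1) / real n) < 1"
      "D * ((R + 1) / real n * ((R + 1) / R)) < 1"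
  shows "\<exists>t. alternates (poly (P n)) n t"
proof -
  obtain c where c: "c > 0" "g n = Polynomial.smult c (hermite n)" using g_hermite by blast
  have Rpos: "0 < R" using n R(1) by simp
  obtain t where t: "alternates (poly (hermite n)) n t"
    "\<And>i. i \<le> n \<Longrightarrow> \<bar>t i\<bar> \<le> R"
    "\<And>i. i \<le> n \<Longrightarrow> poly (pderiv (hermite n)) (t i) = 0 \<or>
          \<bar>t i\<bar> = R \<and> \<bar>poly (pderiv (hermite n)) (t i)\<bar> \<le> R * \<bar>poly (hermite n) (t i)\<bar>"
    using hermite_alternates[OF n] unfolding R(1) by blast
  have close: "\<bar>poly (P n) x - poly W x * poly (g n) x\<bar> < \<bar>poly W x * poly (g n) x\<bar>"
    if x: "x = t i" "i \<le> n" "poly (hermite n) x \<noteq> 0" for x i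
  proof -
    let ?S = "\<Sum>i<r. \<bar>poly (hcof r \<kappa> i) x\<bar>"
    let ?q = "(R + 1) / real n"
    have pos: "0 < \<bar>poly W x * poly (g n) x\<bar>" using W_real[of x] x(3) c by auto
    have le: "\<bar>poly (P n) x - poly W x * poly (g n) x\<bar> \<le> ?S * (?q * (\<bar>poly (g n) x\<bar> + \<bar>poly (pderiv (g n)) x\<bar>))"
      using P_minus_le[of x R n] t(2)[OF x(2)] R(2) x(1) by simp
    show ?thesis
    proof (cases "poly (pderiv (hermite n)) x = 0")
      case True
      then have "poly (pderiv (g n)) x = 0" by (simp add: c(2) pderiv_smult)
      then have "\<bar>poly (P n) x - poly W x * poly (g n) x\<bar> \<le> ?S * (?q * \<bar>poly (g n) x\<bar>)" using le by simp
      also have "\<dots> \<le> (D * \<bar>poly W x\<bar>) * (?q * \<bar>poly (g n) x\<bar>)"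
        using D(2)[of x] Rpos by (intro mult_right_mono) auto
      also have "\<dots> = (D * ?q) * \<bar>poly W x * poly (g n) x\<bar>" by (simp add: abs_mult)
      also have "\<dots> < 1 * \<bar>poly W x * poly (g n) x\<bar>" using R(3) pos by (intro mult_strict_right_mono) auto
      finally show ?thesis by simp
    next
      case False
      then have xR: "\<bar>x\<bar> = R" and d: "\<bar>poly (pderiv (hermite n)) x\<bar> \<le> R * \<bar>poly (hermite n) x\<bar>"
        using t(3)[OF x(2)] x(1) by auto
      have "\<bar>poly (pderiv (g n)) x\<bar> \<le> R * \<bar>poly (g n) x\<bar>"
        using mult_left_mono[OF d, of c] c(1) unfolding c(2) by (simp add: pderiv_smult abs_mult mult_ac)
      then have "?S * (?q * (\<bar>poly (g n) x\<bar> + \<bar>poly (pderiv (g n)) x\<bar>)) \<le> ?S * (?q * ((R + 1) * \<bar>poly (g n) x\<bar>))"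
        using Rpos by (intro mult_left_mono) (auto simp: algebra_simps intro!: sum_nonneg)
      also have "\<dots> = (\<bar>x\<bar> * ?S) * (?q * ((R + 1) / R) * \<bar>poly (g n) x\<bar>)"
      proof -
        have "R * ((R + 1) / R) = R + 1" using Rpos by simp
        then show ?thesis unfolding xR by (metis (no_types, lifting) mult.assoc mult.left_commute)
      qed
      also have "\<dots> \<le> (D * \<bar>poly W x\<bar>) * (?q * ((R + 1) / R) * \<bar>poly (g n) x\<bar>)"
        using D(3)[of x] Rpos by (intro mult_right_mono) auto
      also have "\<dots> = (D * (?q * ((R + 1) / R))) * \<bar>poly W x * poly (g n) x\<bar>" by (simp add: abs_mult)
      also have "\<dots> < 1 * \<bar>poly W x * poly (g n) x\<bar>" using R(4) pos by (intro mult_strict_right_mono) auto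
      finally show ?thesis using le by simp
    qed
  qed
  obtain s where s: "s \<noteq> 0" "\<And>x. 0 < s * poly W x" using poly_const_sign[of W] W_real by blast
  have sgn: "0 < s * poly (P n) (t i) * poly (hermite n) (t i)"
    if i: "i \<le> n" "poly (hermite n) (t i) \<noteq> 0" for i
  proof -
    let ?a = "poly W (t i) * poly (g n) (t i)"
    have "0 < y * z" if "\<bar>y - z\<bar> < \<bar>z\<bar>" for y z :: real
      using that by (cases "0 < z") (auto simp: abs_if zero_less_mult_iff split: if_splits)
    from this[OF close[OF refl i]] have "0 < poly (P n) (t i) * ?a" .
    also have "poly (P n) (t i) * ?a = c * poly W (t i) * (poly (P n) (t i) * poly (hermite n) (t i))"
      by (simp add: c(2) mult_ac)
    finally have 1: "0 < c * poly W (t i) * (poly (P n) (t i) * poly (hermite n) (t i))" .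
    have "0 < (s * poly W (t i)) * (c * poly W (t i) * (poly (P n) (t i) * poly (hermite n) (t i)))"
      using s(2)[of "t i"] 1 by (rule mult_pos_pos)
    also have "\<dots> = (c * (poly W (t i))\<^sup>2) * (s * poly (P n) (t i) * poly (hermite n) (t i))"
      by (simp add: power2_eq_square mult_ac)
    finally show ?thesis
      using c(1) by (simp only: zero_less_mult_iff) (auto simp: zero_less_mult_iff mult_less_0_iff not_less[symmetric])
  qed
  have "poly (P n) (t i) * poly (P n) (t (Suc i)) < 0" if i: "i < n" for i
  proof -
    let ?h = "\<lambda>i. poly (hermite n) (t i)" and ?p = "\<lambda>i. poly (P n) (t i)"
    have neg: "?h i * ?h (Suc i) < 0" using t(1) i by (auto simp: alternates_def)
    then have nz: "?h i \<noteq> 0" "?h (Suc i) \<noteq> 0" by auto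
    have "0 < (s * ?p i * ?h i) * (s * ?p (Suc i) * ?h (Suc i))"
      by (rule mult_pos_pos[OF sgn sgn]) (use i nz in auto)
    also have "\<dots> = s\<^sup>2 * (?h i * ?h (Suc i)) * (?p i * ?p (Suc i))" by (simp add: power2_eq_square)
    finally have "0 < s\<^sup>2 * (?h i * ?h (Suc i)) * (?p i * ?p (Suc i))" .
    moreover have "s\<^sup>2 * (?h i * ?h (Suc i)) < 0" by (rule mult_pos_neg) (use s(1) neg in auto)
    ultimately show ?thesis by (meson less_asym zero_less_mult_iff)
  qed
  then show ?thesis using t(1) unfolding alternates_def by blast
qed

lemma eventually_P_alternates: "\<forall>\<^sub>F n in sequentially. \<exists>t. alternates (poly (P n)) n t"
proof -
  obtain D where D: "0 \<le> D" "\<And>x::real. (\<Sum>i<r. \<bar>poly (hcof r \<kappa> i) x\<bar>) \<le> D * \<bar>poly W x\<bar>"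
      "\<And>x::real. \<bar>x\<bar> * (\<Sum>i<r. \<bar>poly (hcof r \<kappa> i) x\<bar>) \<le> D * \<bar>poly W x\<bar>"
    using hcof_bound by blast
  have "(\<lambda>n. (sqrt (2 * real n) + 1) / real n) \<longlonglongrightarrow> 0" by real_asymp
  from tendsto_mult_right_zero[OF this, of D]
  have e1: "\<forall>\<^sub>F n in sequentially. D * ((sqrt (2 * real n) + 1) / real n) < 1"
    by (rule order_tendstoD) simp
  have "(\<lambda>n. (sqrt (2 * real n) + 1) / real n * ((sqrt (2 * real n) + 1) / sqrt (2 * real n))) \<longlonglongrightarrow> 0" by real_asymp
  from tendsto_mult_right_zero[OF this, of D]
  have e2: "\<forall>\<^sub>F n in sequentially. D * ((sqrt (2 * real n) + 1) / real n * ((sqrt (2 * real n) + 1) / sqrt (2 * real n))) < 1"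
    by (rule order_tendstoD) simp
  have e3: "\<forall>\<^sub>F n in sequentially. sqrt (2 * real n) + 1 \<le> real n" by real_asymp
  show ?thesis
    using e1 e2 e3 eventually_gt_at_top[of 0]
  proof eventually_elim
    case (elim n)
    then show ?case using P_alternates[OF _ D refl] by blast
  qed
qed

end

section \<open>Zeros near the zeros of the denominator\<close>

lemma pderiv_prod_linear:
  fixes z :: "'a::field"
  assumes "finite S" "z \<notin> S"
  defines "p \<equiv> (\<Prod>a\<in>S. [:- a, 1:])"
  shows "poly (pderiv p) z = poly p z * (\<Sum>a\<in>S. 1 / (z - a))"
    and "poly (pderiv (pderiv p)) z = poly p z * ((\<Sum>a\<in>S. 1 / (z - a))\<^sup>2 - (\<Sum>a\<in>S. 1 / (z - a)\<^sup>2))"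
proof -
  have "poly (pderiv (\<Prod>a\<in>S. [:- a, 1:])) z = poly (\<Prod>a\<in>S. [:- a, 1:]) z * (\<Sum>a\<in>S. 1 / (z - a)) \<and>
      poly (pderiv (pderiv (\<Prod>a\<in>S. [:- a, 1:]))) z =
        poly (\<Prod>a\<in>S. [:- a, 1:]) z * ((\<Sum>a\<in>S. 1 / (z - a))\<^sup>2 - (\<Sum>a\<in>S. 1 / (z - a)\<^sup>2))"
    using assms(1,2)
  proof (induction S rule: finite_induct)
    case (insert b S)
    define q where "q = (\<Prod>a\<in>S. [:- a, 1:])"
    define u v where "u = (\<Sum>a\<in>S. 1 / (z - a))" and "v = (\<Sum>a\<in>S. 1 / (z - a)\<^sup>2)"
    define y where "y = z - b"
    have y: "y \<noteq> 0" using insert.prems by (auto simp: y_def)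
    have IH: "poly (pderiv q) z = poly q z * u" "poly (pderiv (pderiv q)) z = poly q z * (u\<^sup>2 - v)"
      using insert unfolding q_def u_def v_def by auto
    have d1: "pderiv ([:- b, 1:] * q) = q + [:- b, 1:] * pderiv q"
      by (simp only: pderiv_mult) (simp add: pderiv_pCons)
    have d2: "pderiv (pderiv ([:- b, 1:] * q)) = pderiv q + (pderiv q + [:- b, 1:] * pderiv (pderiv q))"
      unfolding d1 pderiv_add by (simp only: pderiv_mult) (simp add: pderiv_pCons)
    have "poly (pderiv ([:- b, 1:] * q)) z = y * poly q z * (1 / y + u)"
      unfolding d1 using y by (simp add: IH y_def[symmetric] algebra_simps) (simp add: y_def algebra_simps)
    moreover have "poly (pderiv (pderiv ([:- b, 1:] * q))) z = y * poly q z * ((1 / y + u)\<^sup>2 - (1 / y\<^sup>2 + v))"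
    proof -
      have "poly (pderiv (pderiv ([:- b, 1:] * q))) z = 2 * (poly q z * u) + y * (poly q z * (u\<^sup>2 - v))"
        unfolding d2 by (simp add: IH y_def algebra_simps)
      also have "\<dots> = y * poly q z * ((1 / y + u)\<^sup>2 - (1 / y\<^sup>2 + v))"
        using y by (simp add: power2_eq_square field_simps)
      finally show ?thesis .
    qed
    moreover have "poly ([:- b, 1:] * q) z = y * poly q z" by (simp add: y_def algebra_simps)
    moreover have "(\<Prod>a\<in>insert b S. [:- a, 1:]) = [:- b, 1:] * q" using insert.hyps by (simp add: q_def)
    moreover have "(\<Sum>a\<in>insert b S. 1 / (z - a)) = 1 / y + u" "(\<Sum>a\<in>insert b S. 1 / (z - a)\<^sup>2) = 1 / y\<^sup>2 + v"
      using insert.hyps by (simp_all add: u_def v_def y_def)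
    ultimately show ?case by (simp only:)
  qed simp
  then show "poly (pderiv p) z = poly p z * (\<Sum>a\<in>S. 1 / (z - a))"
    "poly (pderiv (pderiv p)) z = poly p z * ((\<Sum>a\<in>S. 1 / (z - a))\<^sup>2 - (\<Sum>a\<in>S. 1 / (z - a)\<^sup>2))"
    unfolding p_def by blast+
qed

lemma map_poly_of_real_prod_linear:
  assumes "finite S"
  shows "map_poly of_real (\<Prod>a\<in>S. [:- a, 1:]) = (\<Prod>a\<in>of_real ` S. [:- a, 1:] :: 'a::{real_algebra_1,idom} poly)"
  using assms
proof (induction S rule: finite_induct)
  case (insert b S)
  have "(of_real b :: 'a) \<notin> of_real ` S" using insert.hyps by auto
  then show ?case using insert by (simp add: map_poly_of_real_mult map_poly_pCons del: mult_pCons_left)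
qed simp

text \<open>The Riccati equation for the logarithmic derivative of a Hermite polynomial bounds it by
  a multiple of the square root of the degree, away from the real line.\<close>

lemma hermite_log_deriv_bound:
  fixes z :: complex
  assumes d: "0 < d" "d \<le> \<bar>Im z\<bar>" and "norm z \<le> R"
  shows "rpoly (hermite n) z \<noteq> 0"
    and "norm (rpoly (pderiv (hermite n)) z) \<le> (2 * R + sqrt (real n * (2 + 1 / d\<^sup>2))) * norm (rpoly (hermite n) z)"
proof -
  obtain S where S: "finite S" "card S = n" "hermite n = Polynomial.smult (2 ^ n) (\<Prod>a\<in>S. [:- a, 1:])"
    using hermite_real_rooted by blast
  let ?T = "complex_of_real ` S"
  define p where "p = (\<Prod>a\<in>?T. [:- a, 1:])"
  have im: "d \<le> norm (z - of_real a)" for a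
    using d(2) abs_Im_le_cmod[of "z - of_real a"] by simp
  have zT: "z \<notin> ?T" using d by auto
  have T: "finite ?T" "card ?T = n" using S by (auto simp: card_image inj_on_def)
  have H: "map_poly complex_of_real (hermite n) = Polynomial.smult (2 ^ n) p"
    unfolding S(3) map_poly_of_real_smult map_poly_of_real_prod_linear[OF S(1)] p_def by simp
  have pz: "poly p z \<noteq> 0" using zT T(1) by (auto simp: p_def poly_prod)
  then show nz: "rpoly (hermite n) z \<noteq> 0" unfolding rpoly_def H by simp
  define u v where "u = (\<Sum>a\<in>?T. 1 / (z - a))" and "v = (\<Sum>a\<in>?T. 1 / (z - a)\<^sup>2)"
  have p': "poly (pderiv p) z = poly p z * u" "poly (pderiv (pderiv p)) z = poly p z * (u\<^sup>2 - v)"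
    using pderiv_prod_linear[OF T(1) zT] unfolding p_def u_def v_def by auto
  have h': "rpoly (pderiv (hermite n)) z = rpoly (hermite n) z * u"
    "rpoly (pderiv (pderiv (hermite n))) z = rpoly (hermite n) z * (u\<^sup>2 - v)"
    unfolding rpoly_def map_poly_of_real_pderiv H by (simp_all add: pderiv_smult p')
  \<comment> \<open>Hermite's equation divided by \<open>hermite n\<close> is the Riccati equation
    for \<open>u\<close>, since \<open>-v\<close> is the derivative of \<open>u\<close>.\<close>
  have "rpoly (hermite n) z * (u\<^sup>2 - v) = rpoly (hermite n) z * (2 * z * u - 2 * of_nat n)"
    unfolding h'(2)[symmetric] hermite_ode using h'(1)
    by (simp add: diff_conv_add_uminus[of _ "Polynomial.smult _ _"] smult_minus_left[symmetric] algebra_simps del: smult_minus_left add_uminus_conv_diff)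
  then have "u\<^sup>2 - v = 2 * z * u - 2 * of_nat n" using nz by simp
  then have uu: "u\<^sup>2 = 2 * z * u + (v - 2 * of_nat n)" by (simp add: algebra_simps)
  have "norm v \<le> real n * (1 / d\<^sup>2)"
  proof -
    have "norm (1 / (z - a)\<^sup>2) \<le> 1 / d\<^sup>2" if "a \<in> ?T" for a
      using that im d(1) zT by (auto simp: norm_divide norm_power intro!: divide_left_mono power_mono mult_pos_pos)
    then show ?thesis unfolding v_def using sum_norm_le[of ?T "\<lambda>a. 1 / (z - a)\<^sup>2" "\<lambda>_. 1 / d\<^sup>2"] T(2) by simp
  qed
  then have "norm (v - 2 * of_nat n) \<le> real n * (1 / d\<^sup>2) + 2 * real n"
    using norm_triangle_ineq4[of v "2 * of_nat n"] by (simp add: norm_mult)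
  then have q: "norm (v - 2 * of_nat n) \<le> real n * (2 + 1 / d\<^sup>2)" by (simp add: algebra_simps)
  define Q where "Q = sqrt (real n * (2 + 1 / d\<^sup>2))"
  have Q: "0 \<le> Q" "Q\<^sup>2 = real n * (2 + 1 / d\<^sup>2)" by (auto simp: Q_def)
  have R: "0 \<le> R" using assms(3) norm_ge_zero[of z] by linarith
  have "(norm u)\<^sup>2 \<le> norm (2 * z * u) + norm (v - 2 * of_nat n)"
    using norm_triangle_ineq[of "2 * z * u" "v - 2 * of_nat n"] unfolding uu[symmetric] norm_power .
  also have "\<dots> \<le> 2 * R * norm u + Q\<^sup>2"
    unfolding Q(2) using assms(3) q by (intro add_mono) (auto simp: norm_mult intro!: mult_right_mono)
  finally have le: "(norm u)\<^sup>2 \<le> 2 * R * norm u + Q\<^sup>2" .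
  \<comment> \<open>If \<open>norm u\<close> exceeded \<open>2 * R + Q\<close>, both factors of
    \<open>(norm u - 2 * R) * norm u\<close> would exceed or equal \<open>Q\<close>, the first one
    strictly, against the quadratic inequality.\<close>
  have "norm u \<le> 2 * R + Q"
  proof (rule ccontr)
    assume "\<not> ?thesis"
    then have gt: "Q < norm u - 2 * R" "Q \<le> norm u" "0 < norm u" using R Q(1) by auto
    have "Q * Q \<le> Q * norm u" using gt Q(1) by (intro mult_left_mono) auto
    also have "\<dots> < (norm u - 2 * R) * norm u" using gt by (intro mult_strict_right_mono) auto
    finally show False using le by (simp add: power2_eq_square algebra_simps)
  qed
  then have "norm (rpoly (hermite n) z * u) \<le> (2 * R + Q) * norm (rpoly (hermite n) z)"
    unfolding norm_mult by (subst mult.commute) (intro mult_right_mono, auto)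
  then show "norm (rpoly (pderiv (hermite n)) z) \<le> (2 * R + sqrt (real n * (2 + 1 / d\<^sup>2))) * norm (rpoly (hermite n) z)"
    unfolding h'(1) Q_def .
qed

lemma holomorphic_on_rpoly [holomorphic_intros]: "(\<lambda>z. rpoly p z) holomorphic_on A"
  unfolding rpoly_def by (intro holomorphic_intros)

lemma continuous_on_rpoly [continuous_intros]: "continuous_on A (\<lambda>z::complex. rpoly p z)"
  unfolding rpoly_def by (intro continuous_intros)

context zero_free_wronskian
begin

text \<open>If \<open>P n\<close> had no zero in a small disc around \<open>z0\<close>, then
  \<open>g n / P n\<close> would be holomorphic there. On the circle \<open>P n / g n\<close> is
  close to \<open>W\<close> and so bounded below, while at the centre it is close to
  \<open>W z0 = 0\<close>. This contradicts the maximum principle for the reciprocal.\<close>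

lemma eventually_P_zero_near:
  assumes z0: "rpoly W (z0 :: complex) = 0" and e: "0 < e"
  shows "\<forall>\<^sub>F n in sequentially. \<exists>z. rpoly (P n) z = 0 \<and> dist z z0 < e"
proof -
  have im: "Im z0 \<noteq> 0"
  proof
    assume "Im z0 = 0"
    then have "z0 = of_real (Re z0)" by (simp add: complex_eq_iff)
    then have "poly W (Re z0) = 0" using z0 rpoly_of_real[of W "Re z0", where 'a = complex]
      by (metis of_real_eq_0_iff)
    then show False using W_real by blast
  qed
  have "W \<noteq> 0" using W_real[of 0] by auto
  then have "map_poly complex_of_real W \<noteq> 0" by (simp add: map_poly_eq_0_iff)
  then have fin: "finite {z :: complex. rpoly W z = 0}"
    unfolding rpoly_def by (rule poly_roots_finite)
  obtain e1 where e1: "0 < e1" "\<And>z. rpoly W z = 0 \<Longrightarrow> z \<noteq> z0 \<Longrightarrow> e1 \<le> dist z0 z"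
    using finite_set_avoid[OF fin, of z0] by auto
  define d where "d = \<bar>Im z0\<bar> / 2"
  have d: "0 < d" using im by (simp add: d_def)
  \<comment> \<open>The disc contains no other zero of \<open>W\<close>, so \<open>W\<close> does
    not vanish on its boundary, and it keeps the distance \<open>d\<close> from the real axis that
    \<open>hermite_log_deriv_bound\<close> requires.\<close>
  define \<rho> where "\<rho> = min (e / 2) (min (e1 / 2) d)"
  have \<rho>: "0 < \<rho>" "\<rho> < e" "\<rho> < e1" "\<rho> \<le> d" using e e1 d by (auto simp: \<rho>_def)
  define R where "R = norm z0 + \<rho>"
  let ?C = "cball z0 \<rho>"
  have Cim: "d \<le> \<bar>Im z\<bar>" if "z \<in> ?C" for z
    using abs_Im_le_cmod[of "z0 - z"] that \<rho>(4) unfolding d_def by (auto simp: dist_norm)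
  have CR: "norm z \<le> R" if "z \<in> ?C" for z
    using norm_triangle_sub[of z z0] that by (auto simp: R_def dist_norm norm_minus_commute)
  have "rpoly W z \<noteq> 0" if "z \<in> sphere z0 \<rho>" for z
    using e1(2)[of z] that \<rho> by auto
  then obtain \<mu> where \<mu>: "0 < \<mu>" "\<And>z. z \<in> sphere z0 \<rho> \<Longrightarrow> \<mu> \<le> norm (rpoly W z)"
  proof -
    assume a: "\<And>\<mu>. 0 < \<mu> \<Longrightarrow> (\<And>z. z \<in> sphere z0 \<rho> \<Longrightarrow> \<mu> \<le> norm (rpoly W z)) \<Longrightarrow> thesis"
      and nz: "\<And>z. z \<in> sphere z0 \<rho> \<Longrightarrow> rpoly W z \<noteq> 0"
    have "sphere z0 \<rho> \<noteq> {}" using \<rho>(1) by (metis less_imp_le sphere_eq_empty not_less)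
    moreover have "continuous_on (sphere z0 \<rho>) (\<lambda>z. norm (rpoly W z))" by (intro continuous_intros)
    ultimately obtain y where "y \<in> sphere z0 \<rho>" "\<And>z. z \<in> sphere z0 \<rho> \<Longrightarrow> norm (rpoly W y) \<le> norm (rpoly W z)"
      using continuous_attains_inf[OF compact_sphere] by blast
    then show thesis using a[of "norm (rpoly W y)"] nz by auto
  qed
  have "bounded ((\<lambda>z. \<Sum>i<r. norm (rpoly (hcof r \<kappa> i) z)) ` ?C)"
    by (intro compact_imp_bounded compact_continuous_image continuous_intros) auto
  then obtain M where "\<forall>z\<in>?C. norm (\<Sum>i<r. norm (rpoly (hcof r \<kappa> i) z)) \<le> M"
    by (auto simp: bounded_iff)
  then have M: "(\<Sum>i<r. norm (rpoly (hcof r \<kappa> i) z)) \<le> M" if "z \<in> ?C" for z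
    using that by fastforce
  define K where "K = 2 + 1 / d\<^sup>2"
  have K: "0 < K" by (auto simp: K_def intro: add_pos_nonneg)
  \<comment> \<open>The factor of order \<open>1 / n\<close> from the recurrence beats the
    logarithmic derivative of order \<open>sqrt n\<close>.\<close>
  define \<eta> where "\<eta> = (\<lambda>n. M * ((R + 1) / real n * (1 + 2 * R + sqrt (real n * K))))"
  have close: "norm (rpoly (P n) z / rpoly (g n) z - rpoly W z) \<le> \<eta> n" "rpoly (g n) z \<noteq> 0"
    if z: "z \<in> ?C" and n: "R + 1 \<le> real n" for z n
  proof -
    obtain c where c: "c > 0" "g n = Polynomial.smult c (hermite n)" using g_hermite by blast
    note hb = hermite_log_deriv_bound[OF d Cim[OF z] CR[OF z], of n]
    show gz: "rpoly (g n) z \<noteq> 0" using hb(1) c by simp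
    have R: "0 \<le> R" using \<rho> by (simp add: R_def)
    have "norm (rpoly (pderiv (g n)) z) \<le> (2 * R + sqrt (real n * K)) * norm (rpoly (g n) z)"
      using mult_left_mono[OF hb(2), of c] c(1) unfolding c(2) K_def by (simp add: pderiv_smult norm_mult mult_ac)
    then have dg: "norm (rpoly (g n) z) + norm (rpoly (pderiv (g n)) z) \<le> (1 + 2 * R + sqrt (real n * K)) * norm (rpoly (g n) z)"
      by (simp add: algebra_simps)
    have "norm (rpoly (P n) z - rpoly W z * rpoly (g n) z) \<le>
        (\<Sum>i<r. norm (rpoly (hcof r \<kappa> i) z)) * ((R + 1) / real n * (norm (rpoly (g n) z) + norm (rpoly (pderiv (g n)) z)))"
      by (rule P_minus_le[OF CR[OF z] n])
    also have "\<dots> \<le> M * ((R + 1) / real n * ((1 + 2 * R + sqrt (real n * K)) * norm (rpoly (g n) z)))"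
      using M[OF z] dg R n order_trans[OF sum_nonneg M[OF z]] by (intro mult_mono) auto
    also have "\<dots> = \<eta> n * norm (rpoly (g n) z)" by (simp add: \<eta>_def mult.assoc)
    finally have "norm (rpoly (P n) z - rpoly W z * rpoly (g n) z) / norm (rpoly (g n) z) \<le> \<eta> n"
      using gz by (simp add: divide_le_eq)
    also have "norm (rpoly (P n) z - rpoly W z * rpoly (g n) z) / norm (rpoly (g n) z) =
        norm (rpoly (P n) z / rpoly (g n) z - rpoly W z)"
      unfolding norm_divide[symmetric] using gz by (simp add: diff_divide_distrib)
    finally show "norm (rpoly (P n) z / rpoly (g n) z - rpoly W z) \<le> \<eta> n" .
  qed
  have "(\<lambda>n. (1 + 2 * R + sqrt (real n * K)) / real n) \<longlonglongrightarrow> 0" using K by real_asymp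
  from tendsto_mult_right_zero[OF this, of "M * (R + 1)"]
  have "\<eta> \<longlonglongrightarrow> 0" unfolding \<eta>_def by (simp add: mult_ac)
  then have "\<forall>\<^sub>F n in sequentially. \<eta> n < \<mu> / 2" using \<mu>(1) by (intro order_tendstoD) auto
  moreover have "\<forall>\<^sub>F n in sequentially. R + 1 \<le> real n" by real_asymp
  ultimately show ?thesis
  proof eventually_elim
    case (elim n)
    let ?G = "\<lambda>z::complex. rpoly (g n) z / rpoly (P n) z"
    show ?case
    proof (rule ccontr)
      assume neg: "\<not> ?case"
      have nz: "rpoly (P n) z \<noteq> 0" if "z \<in> ?C" for z
        using neg that \<rho>(2) by (auto simp: dist_commute)
      have inv: "norm (?G z) = 1 / norm (rpoly (P n) z / rpoly (g n) z)" for z :: complex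
        by (simp add: norm_divide)
      have "norm (?G z0) \<le> 2 / \<mu>"
      proof (rule maximum_modulus_frontier[where f = ?G and S = ?C])
        show "?G holomorphic_on interior ?C"
          using nz by (intro holomorphic_intros) (auto simp: interior_cball)
        show "continuous_on (closure ?C) ?G"
          using nz by (intro continuous_intros) auto
        fix z assume "z \<in> frontier ?C"
        then have zs: "z \<in> sphere z0 \<rho>" and zC: "z \<in> ?C" using \<rho>(1) by (auto simp: frontier_cball)
        have "norm (rpoly W z) - norm (rpoly (P n) z / rpoly (g n) z) \<le> \<eta> n"
          using close(1)[OF zC elim(2)] norm_triangle_ineq2[of "rpoly W z" "rpoly (P n) z / rpoly (g n) z"]
          by (simp add: norm_minus_commute)
        then have "\<mu> / 2 \<le> norm (rpoly (P n) z / rpoly (g n) z)" using \<mu>(2)[OF zs] elim(1) by linarith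
        then show "norm (?G z) \<le> 2 / \<mu>"
          unfolding inv using \<mu>(1) frac_le[of 1 1 "\<mu> / 2"] by simp
      qed (use \<rho>(1) in auto)
      moreover have z0C: "z0 \<in> ?C" using \<rho>(1) by simp
      have "norm (rpoly (P n) z0 / rpoly (g n) z0) < \<mu> / 2"
        using close(1)[OF z0C elim(2)] elim(1) z0 by simp
      moreover have "0 < norm (rpoly (P n) z0 / rpoly (g n) z0)"
        using nz[OF z0C] close(2)[OF z0C elim(2)] by simp
      ultimately show False
        unfolding inv using \<mu>(1) frac_less2[of 1 1 "norm (rpoly (P n) z0 / rpoly (g n) z0)" "\<mu> / 2"] by simp
    qed
  qed
qed

end

section \<open>Counting the zeros of the exceptional polynomial\<close>

lemma prod_linear_dvd:
  fixes p :: "'a::idom poly"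
  assumes "finite S" "\<And>a. a \<in> S \<Longrightarrow> poly p a = 0"
  shows "(\<Prod>a\<in>S. [:- a, 1:]) dvd p"
  using assms
proof (induction S arbitrary: p rule: finite_induct)
  case (insert b S)
  obtain q where q: "p = [:- b, 1:] * q"
    using insert.prems[of b] by (auto simp: poly_eq_0_iff_dvd elim!: dvdE)
  have "poly q a = 0" if "a \<in> S" for a
    using insert.prems[of a] insert.hyps that by (auto simp: q)
  from insert.IH[OF this] have "[:- b, 1:] * (\<Prod>a\<in>S. [:- a, 1:]) dvd p"
    unfolding q by (rule mult_dvd_mono[OF dvd_refl])
  then show ?case using insert.hyps by simp
qed simp

lemma poly_eq_prod_roots:
  fixes p :: "'a::idom poly"
  assumes "p \<noteq> 0" "finite S" "\<And>a. a \<in> S \<Longrightarrow> poly p a = 0" "degree p \<le> card S"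
  shows "\<exists>c. c \<noteq> 0 \<and> p = Polynomial.smult c (\<Prod>a\<in>S. [:- a, 1:])"
proof -
  have "(\<Prod>a\<in>S. [:- a, 1:]) dvd p" by (rule prod_linear_dvd[OF assms(2,3)])
  then obtain q where q: "p = (\<Prod>a\<in>S. [:- a, 1:]) * q" by (rule dvdE)
  have nz: "q \<noteq> 0" "(\<Prod>a\<in>S. [:- a, 1:] :: 'a poly) \<noteq> 0" using assms(1) q by auto
  have "degree (\<Prod>a\<in>S. [:- a, 1:] :: 'a poly) = card S"
    by (subst degree_prod_eq_sum_degree) auto
  then have "degree q = 0" using assms(4) nz unfolding q by (simp add: degree_mult_eq)
  then obtain c where c: "q = [:c:]" by (elim degree_eq_zeroE)
  then show ?thesis using nz(1) unfolding q by (intro exI[of _ c]) auto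
qed

lemma finite_pos_lower_bound:
  fixes F :: "real set"
  assumes "finite F" "\<forall>y\<in>F. 0 < y"
  shows "\<exists>e>0. \<forall>y\<in>F. e \<le> y"
proof (cases "F = {}")
  case False
  have "0 < Min F" by (rule bspec[OF assms(2) Min_in[OF assms(1) False]])
  moreover have "\<forall>y\<in>F. Min F \<le> y" using Min_le[OF assms(1)] by blast
  ultimately show ?thesis by blast
qed (auto intro: exI[of _ 1])

context zero_free_wronskian
begin

definition Z :: "complex set" where "Z = {z. rpoly W z = 0}"

lemma W_nonzero: "W \<noteq> 0" "map_poly complex_of_real W \<noteq> 0"
proof -
  show "W \<noteq> 0" using W_real[of 0] by auto
  then show "map_poly complex_of_real W \<noteq> 0" by (simp add: map_poly_eq_0_iff)
qed

lemma finite_Z: "finite Z"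
  unfolding Z_def rpoly_def by (rule poly_roots_finite[OF W_nonzero(2)])

lemma Z_nonreal: "\<zeta> \<in> Z \<Longrightarrow> Im \<zeta> \<noteq> 0"
proof
  assume "\<zeta> \<in> Z" "Im \<zeta> = 0"
  then have "rpoly W (of_real (Re \<zeta>)) = (0 :: complex)"
    by (simp add: Z_def complex_eq_iff flip: complex_is_Real_iff)
  then show False using W_real[of "Re \<zeta>"] by simp
qed

lemma W_decompose:
  assumes "rsquarefree (map_poly complex_of_real W)"
  shows "card Z = degree W" "map_poly complex_of_real W = Polynomial.smult (of_real (lead_coeff W)) (\<Prod>a\<in>Z. [:- a, 1:])"
proof -
  have "lead_coeff (map_poly complex_of_real W) = of_real (lead_coeff W)"
    by (simp add: degree_map_poly coeff_map_poly)
  then show d: "map_poly complex_of_real W = Polynomial.smult (of_real (lead_coeff W)) (\<Prod>a\<in>Z. [:- a, 1:])"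
    using complex_poly_decompose_rsquarefree[OF assms] unfolding Z_def rpoly_def by simp
  have "degree (map_poly complex_of_real W) = card Z"
    unfolding d using W_nonzero by (simp add: degree_prod_eq_sum_degree)
  then show "card Z = degree W" by (simp add: degree_map_poly)
qed

end

context zero_free_wronskian
begin

text \<open>The alternation gives \<open>n\<close> real zeros. Each of the \<open>degree W\<close>
  simple zeros of \<open>W\<close> has a zero of \<open>P n\<close> within
  \<open>\<epsilon>\<close>, and these are non-real and distinct because \<open>\<epsilon>\<close>
  is at most every \<open>\<bar>Im \<zeta>\<bar>\<close> and at most half the distance between two
  zeros of \<open>W\<close>. The degree bound excludes further ones.\<close>

lemma eventually_P_zeros:
  assumes sqf: "rsquarefree (map_poly complex_of_real W)" and "0 < e"
  shows "\<forall>\<^sub>F n in sequentially. \<exists>X f. P n \<noteq> 0 \<and> finite X \<and> card X = n \<and> inj_on f Z \<and>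
    (\<forall>\<zeta>\<in>Z. Im (f \<zeta>) \<noteq> 0 \<and> dist (f \<zeta>) \<zeta> < e) \<and> {z. rpoly (P n) z = 0} = of_real ` X \<union> f ` Z"
proof -
  have "\<forall>y\<in>(\<lambda>\<zeta>. \<bar>Im \<zeta>\<bar>) ` Z. 0 < y" using Z_nonreal by auto
  from finite_pos_lower_bound[OF finite_imageI[OF finite_Z] this]
  obtain e1 where e1: "0 < e1" "\<forall>y\<in>(\<lambda>\<zeta>. \<bar>Im \<zeta>\<bar>) ` Z. e1 \<le> y" by (elim exE conjE)
  let ?D = "(\<lambda>(\<zeta>, \<xi>). dist \<zeta> \<xi>) ` {(\<zeta>, \<xi>) \<in> Z \<times> Z. \<zeta> \<noteq> \<xi>}"
  have "finite ?D" using finite_Z by (intro finite_imageI) (auto intro: finite_subset[of _ "Z \<times> Z"])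
  moreover have "\<forall>y\<in>?D. 0 < y" by auto
  ultimately have "\<exists>e>0. \<forall>y\<in>?D. e \<le> y" by (rule finite_pos_lower_bound)
  then obtain e2 where e2': "0 < e2" "\<forall>y\<in>?D. e2 \<le> y" by (elim exE conjE)
  have e2: "e2 \<le> dist \<zeta> \<xi>" if "\<zeta> \<in> Z" "\<xi> \<in> Z" "\<zeta> \<noteq> \<xi>" for \<zeta> \<xi>
  proof -
    have "(\<zeta>, \<xi>) \<in> {(\<zeta>, \<xi>) \<in> Z \<times> Z. \<zeta> \<noteq> \<xi>}" using that by simp
    then have "dist \<zeta> \<xi> \<in> ?D" by (rule image_eqI[rotated]) simp
    with e2'(2) show ?thesis by (rule bspec)
  qed
  define \<epsilon> where "\<epsilon> = min e (min e1 (e2 / 2))"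
  have \<epsilon>: "0 < \<epsilon>" "\<epsilon> \<le> e" "\<epsilon> \<le> e1" "2 * \<epsilon> \<le> e2" using assms(2) e1(1) e2'(1) by (auto simp: \<epsilon>_def)
  have "\<forall>\<^sub>F n in sequentially. \<forall>\<zeta>\<in>Z. \<exists>z. rpoly (P n) z = 0 \<and> dist z \<zeta> < \<epsilon>"
    by (intro eventually_ball_finite finite_Z ballI eventually_P_zero_near \<epsilon>) (simp add: Z_def)
  then show ?thesis
    using eventually_P_alternates eventually_gt_at_top[of 0]
  proof eventually_elim
    case (elim n)
    obtain t where t: "alternates (poly (P n)) n t" using elim(2) by blast
    have "poly (P n) (t 0) \<noteq> 0" using t elim(3) by (auto simp: alternates_def)
    then have Pnz: "P n \<noteq> 0" by auto
    obtain X where X: "finite X" "card X = n" "\<And>x. x \<in> X \<Longrightarrow> poly (P n) x = 0"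
      using alternates_imp_roots[OF t] by blast
    obtain f where f: "\<And>\<zeta>. \<zeta> \<in> Z \<Longrightarrow> rpoly (P n) (f \<zeta>) = 0" "\<And>\<zeta>. \<zeta> \<in> Z \<Longrightarrow> dist (f \<zeta>) \<zeta> < \<epsilon>"
      using elim(1) by metis
    have im: "Im (f \<zeta>) \<noteq> 0" if "\<zeta> \<in> Z" for \<zeta>
    proof
      assume "Im (f \<zeta>) = 0"
      then have "\<bar>Im \<zeta>\<bar> \<le> dist (f \<zeta>) \<zeta>" using abs_Im_le_cmod[of "f \<zeta> - \<zeta>"] by (simp add: dist_norm)
      then show False using f(2)[OF that] bspec[OF e1(2) imageI[OF that]] \<epsilon>(3) by linarith
    qed
    have injf: "inj_on f Z"
    proof (rule inj_onI, rule ccontr)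
      fix \<zeta> \<xi> assume *: "\<zeta> \<in> Z" "\<xi> \<in> Z" "f \<zeta> = f \<xi>" "\<zeta> \<noteq> \<xi>"
      have "dist \<zeta> \<xi> \<le> dist (f \<zeta>) \<zeta> + dist (f \<zeta>) \<xi>" by (rule dist_triangle3)
      then show False using f(2)[OF *(1)] f(2)[OF *(2)] e2[OF *(1,2,4)] \<epsilon>(4) *(3) by simp
    qed
    let ?p = "map_poly complex_of_real (P n)"
    have pnz: "?p \<noteq> 0" using Pnz by (simp add: map_poly_eq_0_iff)
    have "card (complex_of_real ` X) = n" using X by (simp add: card_image inj_on_def)
    moreover have "card (f ` Z) = degree W" using injf W_decompose(1)[OF sqf] by (simp add: card_image)
    moreover have "complex_of_real ` X \<inter> f ` Z = {}"
    proof (rule equals0I)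
      fix z assume "z \<in> complex_of_real ` X \<inter> f ` Z"
      then obtain x \<zeta> where \<zeta>: "\<zeta> \<in> Z" "z = f \<zeta>" "z = of_real x" by blast
      then have "f \<zeta> = of_real x" by metis
      then have "Im (f \<zeta>) = 0" by (simp only: Im_complex_of_real)
      with im[OF \<zeta>(1)] show False by contradiction
    qed
    ultimately have card: "card (complex_of_real ` X \<union> f ` Z) = n + degree W"
      using X(1) finite_Z by (subst card_Un_disjoint) auto
    have roots: "{z. rpoly (P n) z = 0} = of_real ` X \<union> f ` Z"
    proof (rule sym, rule card_seteq)
      show "finite {z :: complex. rpoly (P n) z = 0}" unfolding rpoly_def by (rule poly_roots_finite[OF pnz])
      show "complex_of_real ` X \<union> f ` Z \<subseteq> {z. rpoly (P n) z = 0}" using X(3) f(1) by auto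
      have "card {z :: complex. rpoly (P n) z = 0} \<le> degree (P n)"
        using card_poly_roots_bound[OF pnz] by (simp add: rpoly_def degree_map_poly)
      also have "\<dots> \<le> degree W + n" unfolding P_def W_def by (rule degree_exc_le[OF inj])
      finally show "card {z :: complex. rpoly (P n) z = 0} \<le> card (complex_of_real ` X \<union> f ` Z)" unfolding card by simp
    qed
    have near: "\<forall>\<zeta>\<in>Z. Im (f \<zeta>) \<noteq> 0 \<and> dist (f \<zeta>) \<zeta> < e"
      using im less_le_trans[OF f(2) \<epsilon>(2)] by simp
    show ?case
      by (intro exI[of _ X] exI[of _ f] conjI Pnz X(1,2) injf near roots)
  qed
qed

end

section \<open>The logarithmic energy\<close>

lemma prod_pairs_ordered:
  fixes h :: "nat \<Rightarrow> nat \<Rightarrow> 'a::comm_monoid_mult"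
  shows "(\<Prod>i<n. \<Prod>j\<in>{..<n} - {i}. h i j) = (\<Prod>j<n. \<Prod>i<j. h i j * h j i)"
proof (induction n)
  case (Suc n)
  have 1: "{..<Suc n} - {n} = {..<n}" by auto
  have 2: "(\<Prod>j\<in>{..<Suc n} - {i}. h i j) = h i n * (\<Prod>j\<in>{..<n} - {i}. h i j)" if "i \<in> {..<n}" for i
  proof -
    have "{..<Suc n} - {i} = insert n ({..<n} - {i})" using that by auto
    then show ?thesis by simp
  qed
  have "(\<Prod>i<Suc n. \<Prod>j\<in>{..<Suc n} - {i}. h i j) =
      (\<Prod>i<n. \<Prod>j\<in>{..<Suc n} - {i}. h i j) * (\<Prod>j<n. h n j)"
    by (simp only: prod.lessThan_Suc 1)
  also have "(\<Prod>i<n. \<Prod>j\<in>{..<Suc n} - {i}. h i j) = (\<Prod>i<n. h i n * (\<Prod>j\<in>{..<n} - {i}. h i j))"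
    by (rule prod.cong[OF refl 2])
  also have "\<dots> = (\<Prod>i<n. h i n) * (\<Prod>j<n. \<Prod>i<j. h i j * h j i)"
    by (simp only: prod.distrib Suc.IH)
  also have "\<dots> * (\<Prod>j<n. h n j) = (\<Prod>j<Suc n. \<Prod>i<j. h i j * h j i)"
    by (simp only: prod.lessThan_Suc prod.distrib mult_ac)
  finally show ?case .
qed simp

lemma abs_diff_mult_swap: "\<bar>a - b\<bar> * \<bar>b - a\<bar> = (a - b)\<^sup>2" for a b :: real
  unfolding abs_minus_commute[of b a] power2_eq_square by (rule abs_mult_self_eq)

text \<open>Exhibits the energy as a function of the set of points, so all enumerations of one set
  have the same energy. This is why uniqueness is a statement about sets.\<close>

lemma energy_T_image:
  assumes "inj_on u {..<n}"
  shows "energy_T w n u = (\<Prod>a\<in>u ` {..<n}. w a) * (\<Prod>a\<in>u ` {..<n}. \<Prod>b\<in>u ` {..<n} - {a}. \<bar>a - b\<bar>)"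
proof -
  have "(\<Prod>a\<in>u ` {..<n}. \<Prod>b\<in>u ` {..<n} - {a}. \<bar>a - b\<bar>) = (\<Prod>i<n. \<Prod>b\<in>u ` {..<n} - {u i}. \<bar>u i - b\<bar>)"
    by (subst prod.reindex[OF assms]) simp
  also have "\<dots> = (\<Prod>i<n. \<Prod>j\<in>{..<n} - {i}. \<bar>u i - u j\<bar>)"
  proof (intro prod.cong refl)
    fix i assume "i \<in> {..<n}"
    then have "u ` ({..<n} - {i}) = u ` {..<n} - u ` {i}"
      by (intro inj_on_image_set_diff[OF assms]) auto
    then have "u ` {..<n} - {u i} = u ` ({..<n} - {i})" by (simp only: image_insert image_empty)
    moreover have "inj_on u ({..<n} - {i})" by (rule inj_on_subset[OF assms]) auto
    ultimately show "(\<Prod>b\<in>u ` {..<n} - {u i}. \<bar>u i - b\<bar>) = (\<Prod>j\<in>{..<n} - {i}. \<bar>u i - u j\<bar>)"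
      by (simp add: prod.reindex)
  qed
  also have "\<dots> = (\<Prod>j<n. \<Prod>i<j. \<bar>u i - u j\<bar> * \<bar>u j - u i\<bar>)" by (rule prod_pairs_ordered[of "\<lambda>i j. \<bar>u i - u j\<bar>" n])
  also have "\<dots> = (\<Prod>j<n. \<Prod>i<j. (u i - u j)\<^sup>2)"
    by (simp only: abs_diff_mult_swap)
  finally show ?thesis by (simp add: energy_T_def prod.reindex[OF assms])
qed

text \<open>Summation over ordered pairs absorbs the squares in \<open>energy_T\<close>.\<close>

lemma ln_energy_T:
  assumes "inj_on u {..<n}" "\<And>x. 0 < w x"
  shows "energy_T w n u > 0"
    and "ln (energy_T w n u) = (\<Sum>i<n. ln (w (u i))) + (\<Sum>i<n. \<Sum>j\<in>{..<n} - {i}. ln \<bar>u i - u j\<bar>)"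
proof -
  have pos: "0 < \<bar>u i - u j\<bar>" if "i < n" "j \<in> {..<n} - {i}" for i j
    using that assms(1) by (auto simp: inj_on_def)
  have eq: "energy_T w n u = (\<Prod>i<n. w (u i)) * (\<Prod>i<n. \<Prod>j\<in>{..<n} - {i}. \<bar>u i - u j\<bar>)"
    unfolding prod_pairs_ordered[of "\<lambda>i j. \<bar>u i - u j\<bar>" n] energy_T_def
    by (simp only: abs_diff_mult_swap)
  have p1: "0 < (\<Prod>i<n. w (u i))" using assms(2) by (intro prod_pos) auto
  have p2: "0 < (\<Prod>j\<in>{..<n} - {i}. \<bar>u i - u j\<bar>)" if "i < n" for i
    by (rule prod_pos) (rule pos[OF that])
  have p3: "0 < (\<Prod>i<n. \<Prod>j\<in>{..<n} - {i}. \<bar>u i - u j\<bar>)"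
    by (rule prod_pos) (simp only: lessThan_iff p2)
  show "energy_T w n u > 0" unfolding eq using p1 p3 by simp
  show "ln (energy_T w n u) = (\<Sum>i<n. ln (w (u i))) + (\<Sum>i<n. \<Sum>j\<in>{..<n} - {i}. ln \<bar>u i - u j\<bar>)"
  proof -
    have "ln (energy_T w n u) = ln (\<Prod>i<n. w (u i)) + ln (\<Prod>i<n. \<Prod>j\<in>{..<n} - {i}. \<bar>u i - u j\<bar>)"
      unfolding eq using p1 p3 by (rule ln_mult_pos)
    also have "ln (\<Prod>i<n. w (u i)) = (\<Sum>i<n. ln (w (u i)))"
      by (rule ln_prod[OF finite_lessThan less_imp_neq[OF assms(2), symmetric]])
    also have "ln (\<Prod>i<n. \<Prod>j\<in>{..<n} - {i}. \<bar>u i - u j\<bar>) = (\<Sum>i<n. ln (\<Prod>j\<in>{..<n} - {i}. \<bar>u i - u j\<bar>))"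
      by (rule ln_prod[OF finite_lessThan less_imp_neq[OF p2, symmetric]]) (simp only: lessThan_iff)
    also have "\<dots> = (\<Sum>i<n. \<Sum>j\<in>{..<n} - {i}. ln \<bar>u i - u j\<bar>)"
    proof (rule sum.cong[OF refl], rule ln_prod)
      fix i j assume "i \<in> {..<n}" "j \<in> {..<n} - {i}"
      then show "\<bar>u i - u j\<bar> \<noteq> 0" using pos[of i j] by simp
    qed simp
    finally show ?thesis .
  qed
qed

lemma energy_T_not_inj:
  assumes "\<not> inj_on u {..<n}"
  shows "energy_T w n u = 0"
proof -
  obtain i j where ij: "i < n" "j < n" "i < j" "u i = u j"
    using assms by (auto simp: inj_on_def) (metis linorder_neqE_nat)
  have "(\<Prod>i<j. (u i - u j)\<^sup>2) = 0" using ij by (auto simp: prod_zero_iff)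
  then have "(\<Prod>j<n. \<Prod>i<j. (u i - u j)\<^sup>2) = 0" using ij(2) by (auto simp: prod_zero_iff)
  then show ?thesis by (simp add: energy_T_def)
qed

text \<open>Points are matched by rank. In a common order the quotients
  \<open>(u i - u j) / (y i - y j)\<close> are positive, so that the tangent inequality of
  \<open>ln\<close> applies to them.\<close>

lemma exists_same_order:
  fixes u :: "nat \<Rightarrow> real" and X :: "real set"
  assumes "inj_on u {..<n}" "finite X" "card X = n"
  shows "\<exists>y. bij_betw y {..<n} X \<and> (\<forall>i<n. \<forall>j<n. u i < u j \<longrightarrow> y i < y j)"
proof -
  define k where "k = (\<lambda>i. card {l. l < n \<and> u l < u i})"
  define y where "y = (\<lambda>i. sorted_list_of_set X ! k i)"
  have len: "length (sorted_list_of_set X) = n" using assms by simp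
  have kn: "k i < n" if "i < n" for i
  proof -
    have "k i < card {..<n}" unfolding k_def using that by (intro psubset_card_mono) auto
    then show ?thesis by simp
  qed
  have kmono: "k i < k j" if "i < n" "u i < u j" for i j
    unfolding k_def using that by (intro psubset_card_mono) auto
  have ymono: "y i < y j" if "i < n" "j < n" "u i < u j" for i j
    unfolding y_def using kmono[OF that(1,3)] kn[OF that(2)] len strict_sorted_list_of_set[of X]
    by (simp add: sorted_wrt_nth_less)
  have "inj_on y {..<n}"
  proof (rule inj_onI)
    fix i j assume "i \<in> {..<n}" "j \<in> {..<n}" "y i = y j"
    then have "u i = u j" using ymono[of i j] ymono[of j i] by (metis lessThan_iff less_irrefl linorder_neqE)
    then show "i = j" using assms(1) \<open>i \<in> _\<close> \<open>j \<in> _\<close> by (auto simp: inj_on_def)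
  qed
  moreover have "y ` {..<n} \<subseteq> X"
    using kn len assms(2) nth_mem[of _ "sorted_list_of_set X"] by (auto simp: y_def)
  ultimately have "bij_betw y {..<n} X"
    unfolding bij_betw_def using assms(2,3) by (metis card_image card_lessThan card_subset_eq)
  then show ?thesis using ymono by blast
qed

text \<open>Both \<open>ln\<close> and the logarithm of the weight lie below their tangents. Summing the tangent
  inequalities at the critical configuration, listed in the order of a competitor, all linear terms
  cancel by the critical point equations.\<close>

lemma ln_energy_less:
  fixes y u :: "nat \<Rightarrow> real"
  assumes w: "\<And>x. 0 < w x" and tang: "\<And>x v. v \<noteq> x \<Longrightarrow> ln (w v) - ln (w x) < L x * (v - x)"
    and inj: "inj_on u {..<n}" and y: "bij_betw y {..<n} X" and X: "finite X"
    and ord: "\<And>i j. i < n \<Longrightarrow> j < n \<Longrightarrow> u i < u j \<Longrightarrow> y i < y j"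
    and crit: "\<And>x. x \<in> X \<Longrightarrow> L x + 2 * (\<Sum>b\<in>X - {x}. 1 / (x - b)) = 0"
    and neq: "\<exists>i<n. u i \<noteq> y i"
  shows "ln (energy_T w n u) < ln (energy_T w n y)"
proof -
  have injy: "inj_on y {..<n}" and Xy: "X = y ` {..<n}" using y by (auto simp: bij_betw_def)
  have crit': "L (y i) + 2 * (\<Sum>j\<in>{..<n} - {i}. 1 / (y i - y j)) = 0" if "i < n" for i
  proof -
    have "X - {y i} = y ` ({..<n} - {i})" using injy that unfolding Xy by (auto simp: inj_on_def)
    moreover have "inj_on y ({..<n} - {i})" by (rule inj_on_subset[OF injy]) auto
    ultimately have "(\<Sum>b\<in>X - {y i}. 1 / (y i - b)) = (\<Sum>j\<in>{..<n} - {i}. 1 / (y i - y j))"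
      by (simp add: sum.reindex)
    then show ?thesis using crit[of "y i"] that unfolding Xy by simp
  qed
  let ?d = "\<lambda>i. u i - y i"
  have W: "(\<Sum>i<n. ln (w (u i)) - ln (w (y i))) < (\<Sum>i<n. L (y i) * ?d i)"
  proof (rule sum_strict_mono_ex1)
    show "\<forall>i\<in>{..<n}. ln (w (u i)) - ln (w (y i)) \<le> L (y i) * ?d i"
    proof
      fix i
      show "ln (w (u i)) - ln (w (y i)) \<le> L (y i) * ?d i"
        using tang[of "u i" "y i"] by (cases "u i = y i") (auto intro: less_imp_le)
    qed
    show "\<exists>i\<in>{..<n}. ln (w (u i)) - ln (w (y i)) < L (y i) * ?d i"
      using neq tang by blast
  qed simp
  have pair: "ln \<bar>u i - u j\<bar> - ln \<bar>y i - y j\<bar> \<le> (?d i - ?d j) / (y i - y j)"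
    if ij: "i < n" "j \<in> {..<n} - {i}" for i j
  proof -
    have "u i \<noteq> u j" using ij inj by (auto simp: inj_on_def)
    then consider "u i < u j" "y i < y j" | "u j < u i" "y j < y i"
      using ord[of i j] ord[of j i] ij by (cases "u i < u j") auto
    then have "0 < (u i - u j) / (y i - y j) \<and> y i - y j \<noteq> 0"
    proof cases
      case 1
      then show ?thesis using divide_neg_neg[of "u i - u j" "y i - y j"] by linarith
    next
      case 2
      then show ?thesis using divide_pos_pos[of "u i - u j" "y i - y j"] by linarith
    qed
    then have q: "0 < (u i - u j) / (y i - y j)" "y i - y j \<noteq> 0" by auto
    have "ln \<bar>u i - u j\<bar> - ln \<bar>y i - y j\<bar> = ln ((u i - u j) / (y i - y j))"
    proof -
      have "\<bar>u i - u j\<bar> / \<bar>y i - y j\<bar> = (u i - u j) / (y i - y j)"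
        using q(1) by (simp flip: abs_divide)
      moreover have "ln (\<bar>u i - u j\<bar> / \<bar>y i - y j\<bar>) = ln \<bar>u i - u j\<bar> - ln \<bar>y i - y j\<bar>"
        using \<open>u i \<noteq> u j\<close> q(2) by (subst ln_div) auto
      ultimately show ?thesis by simp
    qed
    also have "\<dots> \<le> (u i - u j) / (y i - y j) - 1" by (rule ln_le_minus_one[OF q(1)])
    also have "\<dots> = (?d i - ?d j) / (y i - y j)" using q(2) by (simp add: field_simps)
    finally show ?thesis .
  qed
  have swap: "(\<Sum>i<n. \<Sum>j\<in>{..<n} - {i}. h i j) = (\<Sum>i<n. \<Sum>j\<in>{..<n} - {i}. h j i)" for h :: "nat \<Rightarrow> nat \<Rightarrow> real"
  proof -
    have "(\<Sum>i<n. \<Sum>j\<in>{..<n} - {i}. h i j) = (\<Sum>i<n. \<Sum>j<n. if j \<noteq> i then h i j else 0)"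
      by (intro sum.cong refl sum.mono_neutral_cong_left) auto
    also have "\<dots> = (\<Sum>j<n. \<Sum>i<n. if j \<noteq> i then h i j else 0)" by (rule sum.swap)
    also have "\<dots> = (\<Sum>i<n. \<Sum>j\<in>{..<n} - {i}. h j i)"
      by (intro sum.cong refl sum.mono_neutral_cong_right) auto
    finally show ?thesis .
  qed
  have "(\<Sum>i<n. \<Sum>j\<in>{..<n} - {i}. ln \<bar>u i - u j\<bar> - ln \<bar>y i - y j\<bar>) \<le>
      (\<Sum>i<n. \<Sum>j\<in>{..<n} - {i}. (?d i - ?d j) / (y i - y j))"
    by (intro sum_mono pair) auto
  \<comment> \<open>By antisymmetry of \<open>1 / (y i - y j)\<close> the two double sums differ
    only in sign. This produces the factor 2 of the critical point equations.\<close>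
  also have "\<dots> = (\<Sum>i<n. \<Sum>j\<in>{..<n} - {i}. ?d i / (y i - y j)) - (\<Sum>i<n. \<Sum>j\<in>{..<n} - {i}. ?d j / (y i - y j))"
    by (simp only: diff_divide_distrib sum_subtractf)
  also have "(\<Sum>i<n. \<Sum>j\<in>{..<n} - {i}. ?d j / (y i - y j)) = (\<Sum>i<n. \<Sum>j\<in>{..<n} - {i}. ?d i / (y j - y i))"
    by (rule swap)
  also have "\<dots> = (\<Sum>i<n. \<Sum>j\<in>{..<n} - {i}. - (?d i / (y i - y j)))"
    by (intro sum.cong refl) (metis minus_diff_eq minus_divide_right)
  also have "(\<Sum>i<n. \<Sum>j\<in>{..<n} - {i}. ?d i / (y i - y j)) - (\<Sum>i<n. \<Sum>j\<in>{..<n} - {i}. - (?d i / (y i - y j)))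
      = (\<Sum>i<n. ?d i * (2 * (\<Sum>j\<in>{..<n} - {i}. 1 / (y i - y j))))"
  proof -
    define S where "S = (\<lambda>i. \<Sum>j\<in>{..<n} - {i}. 1 / (y i - y j))"
    have r: "(\<Sum>j\<in>{..<n} - {i}. ?d i / (y i - y j)) = ?d i * S i" for i
      by (simp add: S_def sum_distrib_left)
    define A where "A = (\<Sum>i<n. \<Sum>j\<in>{..<n} - {i}. ?d i / (y i - y j))"
    have "(\<Sum>i<n. \<Sum>j\<in>{..<n} - {i}. - (?d i / (y i - y j))) = - A"
      by (simp only: A_def sum_negf)
    moreover have "(\<Sum>i<n. ?d i * (2 * (\<Sum>j\<in>{..<n} - {i}. 1 / (y i - y j)))) = (\<Sum>i<n. 2 * (?d i * S i))"
      by (simp only: S_def mult.left_commute)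
    moreover have "\<dots> = 2 * A"
      by (simp only: A_def r sum_distrib_left)
    ultimately show ?thesis unfolding A_def[symmetric] by simp
  qed
  also have "\<dots> = (\<Sum>i<n. - (L (y i) * ?d i))"
  proof (intro sum.cong refl)
    fix i assume "i \<in> {..<n}"
    then have "2 * (\<Sum>j\<in>{..<n} - {i}. 1 / (y i - y j)) = - L (y i)" using crit'[of i] by (simp add: eq_neg_iff_add_eq_0 add.commute)
    then show "?d i * (2 * (\<Sum>j\<in>{..<n} - {i}. 1 / (y i - y j))) = - (L (y i) * ?d i)"
      by (simp only:) simp
  qed
  finally show ?thesis
    using W unfolding ln_energy_T(2)[of u n w, OF inj w] ln_energy_T(2)[of y n w, OF injy w]
    by (simp add: sum_subtractf sum_negf)
qed

text \<open>Every competitor is compared directly with \<open>X\<close>, enumerated in the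
  competitor's order. Existence comes with uniqueness, since the critical configuration itself beats
  all configurations with another point set.\<close>

lemma energy_unique_maximum:
  assumes w: "\<And>x. 0 < w x" and tang: "\<And>x v. v \<noteq> x \<Longrightarrow> ln (w v) - ln (w x) < L x * (v - x)"
    and X: "finite X" "card X = n"
    and crit: "\<And>x. x \<in> X \<Longrightarrow> L x + 2 * (\<Sum>b\<in>X - {x}. 1 / (x - b)) = 0"
  shows "(\<exists>u. attains_max_at (log_energy w n) (real_space n) u) \<and>
    (\<forall>u. attains_max_at (log_energy w n) (real_space n) u \<longrightarrow> u ` {..<n} = X)"
proof -
  obtain x0' where x0': "bij_betw x0' {..<n} X"
    using ex_bij_betw_nat_finite[OF X(1)] X(2) by (auto simp: atLeast0LessThan)
  define x0 where "x0 = restrict x0' {..<n}"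
  have x0: "bij_betw x0 {..<n} X" "x0 \<in> real_space n"
    using x0' by (auto simp: x0_def real_space_def bij_betw_def inj_on_def)
  have inj0: "inj_on x0 {..<n}" "x0 ` {..<n} = X" using x0(1) by (auto simp: bij_betw_def)
  have e0: "log_energy w n x0 = ereal (ln (energy_T w n x0))"
    using ln_energy_T(1)[of x0 n w, OF inj0(1) w] by (simp add: log_energy_def)
  have less: "log_energy w n u < log_energy w n x0" if "u ` {..<n} \<noteq> X" for u
  proof (cases "inj_on u {..<n}")
    case False
    then show ?thesis unfolding e0 by (simp add: log_energy_def energy_T_not_inj)
  next
    case True
    obtain y where y: "bij_betw y {..<n} X" "\<And>i j. i < n \<Longrightarrow> j < n \<Longrightarrow> u i < u j \<Longrightarrow> y i < y j"
      using exists_same_order[OF True X] by blast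
    have inj: "inj_on y {..<n}" "y ` {..<n} = X" using y(1) by (auto simp: bij_betw_def)
    have "\<exists>i<n. u i \<noteq> y i"
    proof (rule ccontr)
      assume "\<not> ?thesis"
      then have "u ` {..<n} = y ` {..<n}" by (intro image_cong) auto
      then show False using inj(2) that by simp
    qed
    then have lt: "ln (energy_T w n u) < ln (energy_T w n y)"
      by (intro ln_energy_less[of w L u n y X] w tang True y X(1) crit)
    have eq: "energy_T w n y = energy_T w n x0"
      unfolding energy_T_image[OF inj(1)] energy_T_image[OF inj0(1)] inj(2) inj0(2) ..
    have "log_energy w n u = ereal (ln (energy_T w n u))"
      using ln_energy_T(1)[of u n w, OF True w] by (simp add: log_energy_def)
    then show ?thesis
      unfolding e0 using lt by (simp only: eq less_ereal.simps)
  qed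
  have same: "log_energy w n u = log_energy w n x0" if "u ` {..<n} = X" for u
  proof -
    have "card (u ` {..<n}) = card {..<n}" by (simp only: that X(2) card_lessThan)
    then have inju: "inj_on u {..<n}" by (rule eq_card_imp_inj_on[OF finite_lessThan])
    have "energy_T w n u = energy_T w n x0"
      unfolding energy_T_image[OF inju] energy_T_image[OF inj0(1)] that inj0(2) ..
    then show ?thesis by (simp add: log_energy_def)
  qed
  have "attains_max_at (log_energy w n) (real_space n) x0"
    unfolding attains_max_at_def
  proof (intro conjI ballI x0(2))
    fix v
    show "log_energy w n v \<le> log_energy w n x0"
      using less[of v] same[of v] by (cases "v ` {..<n} = X") simp_all
  qed
  moreover have "u ` {..<n} = X" if "attains_max_at (log_energy w n) (real_space n) u" for u
  proof (rule ccontr)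
    assume "u ` {..<n} \<noteq> X"
    then have "log_energy w n u < log_energy w n x0" by (rule less)
    moreover have "log_energy w n x0 \<le> log_energy w n u"
      using that x0(2) unfolding attains_max_at_def by blast
    ultimately show False by simp
  qed
  ultimately show ?thesis by blast
qed

section \<open>Concavity of the weight\<close>

definition log_deriv :: "real poly \<Rightarrow> real \<Rightarrow> real" where
  "log_deriv p x = poly (pderiv p) x / poly p x"

lemma has_derivative_log_deriv:
  assumes "poly p x \<noteq> 0"
  shows "(log_deriv p has_real_derivative
      (poly (pderiv (pderiv p)) x * poly p x - (poly (pderiv p) x)\<^sup>2) / (poly p x)\<^sup>2) (at x)"
  unfolding log_deriv_def using assms
  by (auto intro!: derivative_eq_intros simp: power2_eq_square)

lemma log_deriv_deriv_eq_sum: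
  assumes p: "map_poly complex_of_real p = Polynomial.smult c (\<Prod>a\<in>S. [:- a, 1:])"
    and S: "finite S" and nz: "poly p x \<noteq> 0"
  shows "complex_of_real ((poly (pderiv (pderiv p)) x * poly p x - (poly (pderiv p) x)\<^sup>2) / (poly p x)\<^sup>2)
     = - (\<Sum>a\<in>S. 1 / (of_real x - a)\<^sup>2)"
proof -
  define q where "q = (\<Prod>a\<in>S. [:- a, 1:])"
  let ?z = "complex_of_real x"
  have p0: "complex_of_real (poly p x) = c * poly q ?z"
    unfolding rpoly_of_real[symmetric] rpoly_def p q_def by simp
  then have cq: "c \<noteq> 0" "poly q ?z \<noteq> 0" using nz by auto
  then have xS: "?z \<notin> S" using S by (auto simp: q_def poly_prod)
  define u v where "u = (\<Sum>a\<in>S. 1 / (?z - a))" and "v = (\<Sum>a\<in>S. 1 / (?z - a)\<^sup>2)"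
  have p1: "complex_of_real (poly (pderiv p) x) = c * poly q ?z * u"
    unfolding rpoly_of_real[symmetric] rpoly_def map_poly_of_real_pderiv p
    using pderiv_prod_linear(1)[OF S xS] by (simp add: pderiv_smult q_def u_def)
  have p2: "complex_of_real (poly (pderiv (pderiv p)) x) = c * poly q ?z * (u\<^sup>2 - v)"
    unfolding rpoly_of_real[symmetric] rpoly_def map_poly_of_real_pderiv p
    using pderiv_prod_linear(2)[OF S xS] by (simp add: pderiv_smult q_def u_def v_def)
  have "complex_of_real ((poly (pderiv (pderiv p)) x * poly p x - (poly (pderiv p) x)\<^sup>2) / (poly p x)\<^sup>2) =
      (c * poly q ?z * (u\<^sup>2 - v) * (c * poly q ?z) - (c * poly q ?z * u)\<^sup>2) / (c * poly q ?z)\<^sup>2"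
    by (simp only: of_real_divide of_real_diff of_real_mult of_real_power p0 p1 p2)
  also have "\<dots> = ((c * poly q ?z)\<^sup>2 * (- v)) / (c * poly q ?z)\<^sup>2"
    by (simp add: power2_eq_square algebra_simps)
  also have "\<dots> = - v" using cq by simp
  finally show ?thesis by (simp add: v_def)
qed

lemma inverse_square_diff_bound:
  fixes y a b :: complex
  assumes "0 < d" "d \<le> norm (y - a)" "d \<le> norm (y - b)"
  shows "norm (1 / (y - a)\<^sup>2 - 1 / (y - b)\<^sup>2) \<le> 2 * norm (a - b) / d ^ 3"
proof -
  have nz: "y - a \<noteq> 0" "y - b \<noteq> 0" using assms by auto
  have "1 / (y - a)\<^sup>2 - 1 / (y - b)\<^sup>2 = (1 / (y - a) - 1 / (y - b)) * (1 / (y - a) + 1 / (y - b))"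
    by (simp add: power2_eq_square algebra_simps)
  also have "1 / (y - a) - 1 / (y - b) = (a - b) * (1 / (y - a)) * (1 / (y - b))"
    using nz by (simp add: field_simps)
  finally have "norm (1 / (y - a)\<^sup>2 - 1 / (y - b)\<^sup>2) =
      norm (a - b) * norm (1 / (y - a)) * norm (1 / (y - b)) * norm (1 / (y - a) + 1 / (y - b))"
    by (simp only: norm_mult)
  also have "\<dots> \<le> norm (a - b) * (1 / d) * (1 / d) * (1 / d + 1 / d)"
  proof -
    have i: "norm (1 / (y - a)) \<le> 1 / d" "norm (1 / (y - b)) \<le> 1 / d"
      unfolding norm_divide norm_one using assms by (auto intro!: divide_left_mono mult_pos_pos)
    have "norm (1 / (y - a) + 1 / (y - b)) \<le> 1 / d + 1 / d"
      by (rule order_trans[OF norm_triangle_ineq add_mono[OF i]])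
    with i show ?thesis using assms(1) by (intro mult_mono) auto
  qed
  also have "\<dots> = 2 * norm (a - b) / d ^ 3"
    using assms(1) by (simp add: power3_eq_cube field_simps)
  finally show ?thesis .
qed

lemma strict_tangent:
  fixes F L :: "real \<Rightarrow> real"
  assumes F: "\<And>x. (F has_real_derivative L x) (at x)" and L: "\<And>x y. x < y \<Longrightarrow> L y < L x" and "v \<noteq> x"
  shows "F v - F x < L x * (v - x)"
proof (cases "x < v")
  case True
  obtain z where z: "x < z" "F v - F x = (v - x) * L z"
    using MVT2[OF True, of F L] F by blast
  have "(v - x) * L z < (v - x) * L x" using True L[OF z(1)] by (intro mult_strict_left_mono) auto
  then show ?thesis using z(2) by (simp add: mult.commute)
next
  case False
  then have lt: "v < x" using assms(3) by simp
  obtain z where z: "z < x" "F x - F v = (x - v) * L z"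
    using MVT2[OF lt, of F L] F by blast
  have "(x - v) * L x < (x - v) * L z" using lt L[OF z(1)] by (intro mult_strict_left_mono) auto
  then have "(x - v) * L x < F x - F v" using z(2) by simp
  then show ?thesis by (simp add: algebra_simps)
qed

context zero_free_wronskian
begin

definition weight :: "real poly \<Rightarrow> real \<Rightarrow> real" where
  "weight Pm x = exp (- x\<^sup>2) / (poly W x)\<^sup>2 * (poly Pm x)\<^sup>2"

definition weight_log_deriv :: "real poly \<Rightarrow> real \<Rightarrow> real" where
  "weight_log_deriv Pm x = - 2 * x + 2 * log_deriv Pm x - 2 * log_deriv W x"

text \<open>The factor \<open>exp (- x^2)\<close> contributes -2 to the second derivative of the
  logarithm, and the polynomials enter squared. Hence the threshold 1 for the difference of their
  second logarithmic derivatives.\<close>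

lemma weight_tangent:
  assumes Pm: "\<And>x. poly Pm x \<noteq> 0"
    and small: "\<And>x. (poly (pderiv (pderiv Pm)) x * poly Pm x - (poly (pderiv Pm) x)\<^sup>2) / (poly Pm x)\<^sup>2
      - (poly (pderiv (pderiv W)) x * poly W x - (poly (pderiv W) x)\<^sup>2) / (poly W x)\<^sup>2 < 1"
    and "v \<noteq> x"
  shows "ln (weight Pm v) - ln (weight Pm x) < weight_log_deriv Pm x * (v - x)"
proof (rule strict_tangent[OF _ _ assms(3)])
  fix x
  have "weight Pm x > 0" using Pm[of x] W_real[of x] by (simp add: weight_def)
  then show "((\<lambda>x. ln (weight Pm x)) has_real_derivative weight_log_deriv Pm x) (at x)"
    using Pm[of x] W_real[of x] unfolding weight_def weight_log_deriv_def log_deriv_def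
    by (auto intro!: derivative_eq_intros simp: field_simps power2_eq_square)
next
  fix x y :: real assume "x < y"
  let ?D = "\<lambda>p x. (poly (pderiv (pderiv p)) x * poly p x - (poly (pderiv p) x)\<^sup>2) / (poly p x)\<^sup>2"
  show "weight_log_deriv Pm y < weight_log_deriv Pm x"
  proof (rule DERIV_neg_imp_decreasing[OF \<open>x < y\<close>])
    fix z
    have "(weight_log_deriv Pm has_real_derivative (- 2 * 1 + 2 * ?D Pm z - 2 * ?D W z)) (at z)"
      unfolding weight_log_deriv_def
      by (intro DERIV_add DERIV_diff DERIV_cmult DERIV_ident has_derivative_log_deriv Pm W_real)
    moreover have "- 2 * 1 + 2 * a - 2 * b < 0" if "a - b < 1" for a b :: real
      using that by simp
    from this[OF small] have "- 2 * 1 + 2 * ?D Pm z - 2 * ?D W z < 0" .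
    ultimately show "\<exists>d. (weight_log_deriv Pm has_real_derivative d) (at z) \<and> d < 0" by blast
  qed
qed

end

text \<open>At a simple zero \<open>x\<close>, the quotient \<open>P'' / P'\<close> is twice the
  logarithmic derivative of \<open>P\<close> with the factor at \<open>x\<close> removed, which
  splits into the part of \<open>Pm\<close> and the sum over the other zeros. The differential
  equation evaluates the same quotient as \<open>2 * (x + W' / W)\<close>.\<close>

lemma root_log_deriv_sum:
  fixes P Pm q W :: "real poly"
  assumes P: "P = Pm * q" and q: "q = Polynomial.smult c (\<Prod>a\<in>X. [:- a, 1:])" and X: "finite X" "x \<in> X" and c: "c \<noteq> 0"
    and nz: "poly Pm x \<noteq> 0" "poly W x \<noteq> 0"
    and ode: "poly W x * poly (pderiv (pderiv P)) x = 2 * (x * poly W x + poly (pderiv W) x) * poly (pderiv P) x"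
  shows "- 2 * x + 2 * log_deriv Pm x - 2 * log_deriv W x + 2 * (\<Sum>b\<in>X - {x}. 1 / (x - b)) = 0"
proof -
  define s where "s = Polynomial.smult c (\<Prod>a\<in>X - {x}. [:- a, 1:])"
  define \<sigma> where "\<sigma> = (\<Sum>b\<in>X - {x}. 1 / (x - b))"
  have qs: "q = [:- x, 1:] * s"
    unfolding q s_def using X by (subst prod.remove[of X x]) (auto simp del: mult_pCons_left)
  have s0: "poly s x \<noteq> 0" using X c by (auto simp: s_def poly_prod)
  have s1: "poly (pderiv s) x = poly s x * \<sigma>"
    using pderiv_prod_linear(1)[of "X - {x}" x] X by (simp add: s_def \<sigma>_def pderiv_smult)
  have d1: "pderiv q = s + [:- x, 1:] * pderiv s"
    unfolding qs by (simp only: pderiv_mult) (simp add: pderiv_pCons)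
  have d2: "pderiv (pderiv q) = pderiv s + (pderiv s + [:- x, 1:] * pderiv (pderiv s))"
    unfolding d1 pderiv_add by (simp only: pderiv_mult) (simp add: pderiv_pCons)
  have e: "poly q x = 0" "poly (pderiv q) x = poly s x" "poly (pderiv (pderiv q)) x = 2 * (poly s x * \<sigma>)"
    unfolding d2 unfolding d1 unfolding qs using s1 by simp_all
  have P1: "poly (pderiv P) x = poly Pm x * poly s x"
    unfolding P by (simp add: pderiv_mult e)
  have P2: "poly (pderiv (pderiv P)) x = 2 * (poly (pderiv Pm) x * poly s x) + poly Pm x * (2 * (poly s x * \<sigma>))"
    unfolding P by (simp add: pderiv_mult pderiv_add e)
  define p p' w w' t where "p = poly Pm x" and "p' = poly (pderiv Pm) x" and "w = poly W x"
    and "w' = poly (pderiv W) x" and "t = poly s x"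
  have "w * (2 * (p' * t) + p * (2 * (t * \<sigma>))) = 2 * (x * w + w') * (p * t)"
    using ode unfolding P1 P2 p_def p'_def w_def w'_def t_def .
  then have "t * (w * p' + w * p * \<sigma>) = t * ((x * w + w') * p)" by (simp add: algebra_simps)
  then have "w * p' + w * p * \<sigma> = (x * w + w') * p" using s0 by (simp add: t_def)
  moreover have "p \<noteq> 0" "w \<noteq> 0" using nz by (auto simp: p_def w_def)
  ultimately have "p' / p + \<sigma> = x + w' / w" by (simp add: field_simps)
  then show ?thesis unfolding log_deriv_def \<sigma>_def p_def p'_def w_def w'_def by simp
qed

context zero_free_wronskian
begin

text \<open>The points \<open>f \<zeta>\<close> must be zeros of \<open>Pm\<close> and the points of
  \<open>X\<close> zeros of \<open>qn\<close>. Their numbers already reach the degree bound for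
  \<open>P n\<close>, so both factors have exactly these zeros, all simple, for whichever real
  constants the factorization carries.\<close>

lemma energy_maximum_of_zeros:
  assumes sqf: "rsquarefree (map_poly complex_of_real W)"
    and d: "0 < d" "\<And>\<zeta>. \<zeta> \<in> Z \<Longrightarrow> 2 * d \<le> \<bar>Im \<zeta>\<bar>"
    and e: "e \<le> d" "real (card Z) * (2 * e / d ^ 3) < 1"
    and n: "P n \<noteq> 0" "finite X" "card X = n" "inj_on f Z" "\<And>\<zeta>. \<zeta> \<in> Z \<Longrightarrow> Im (f \<zeta>) \<noteq> 0"
      "\<And>\<zeta>. \<zeta> \<in> Z \<Longrightarrow> dist (f \<zeta>) \<zeta> < e" "{z. rpoly (P n) z = 0} = of_real ` X \<union> f ` Z"
    and fac: "nonreal_real_factorization (P n) Pm qn"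
  shows "(\<exists>u. attains_max_at (log_energy (weight Pm) n) (real_space n) u) \<and>
    (\<forall>u. attains_max_at (log_energy (weight Pm) n) (real_space n) u \<longrightarrow> u ` {..<n} = {x. poly qn x = 0})"
proof -
  have Pf: "P n = Pm * qn" and Pm_nr: "\<And>z :: complex. rpoly Pm z = 0 \<Longrightarrow> z \<notin> \<real>" and qn_r: "\<And>z :: complex. rpoly qn z = 0 \<Longrightarrow> z \<in> \<real>"
    using fac unfolding nonreal_real_factorization_def rpoly_def by auto
  have nz: "Pm \<noteq> 0" "qn \<noteq> 0" using n(1) Pf by auto
  have nzc: "map_poly complex_of_real Pm \<noteq> 0" using nz by (simp add: map_poly_eq_0_iff)
  have fZ_nr: "f \<zeta> \<notin> \<real>" if "\<zeta> \<in> Z" for \<zeta> using n(5)[OF that] by (auto simp: complex_is_Real_iff)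
  have rootP: "rpoly (P n) z = 0 \<longleftrightarrow> rpoly Pm z = 0 \<or> rpoly qn z = 0" for z :: complex
    unfolding Pf by simp
  have inP: "rpoly (P n) z = 0 \<longleftrightarrow> z \<in> of_real ` X \<union> f ` Z" for z :: complex
    using n(7) by blast
  have Pm_root: "rpoly Pm (f \<zeta>) = 0" if "\<zeta> \<in> Z" for \<zeta>
    using inP[of "f \<zeta>"] rootP[of "f \<zeta>"] qn_r[of "f \<zeta>"] fZ_nr[OF that] that by blast
  have qn_root: "poly qn x = 0" if "x \<in> X" for x
  proof -
    have "rpoly (P n) (complex_of_real x) = 0" using inP[of "of_real x"] that by blast
    then have "rpoly qn (complex_of_real x) = 0"
      using rootP[of "of_real x"] Pm_nr[of "of_real x"] by auto
    then show ?thesis by simp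
  qed
  have "degree Pm + degree qn = degree (P n)" unfolding Pf using nz by (simp add: degree_mult_eq)
  also have "\<dots> \<le> degree W + n" unfolding P_def W_def by (rule degree_exc_le[OF inj])
  finally have deg: "degree Pm + degree qn \<le> card Z + n" using W_decompose(1)[OF sqf] by simp
  have cardfZ: "card (f ` Z) = card Z" using n(4) by (rule card_image)
  have "card (f ` Z) \<le> card {z :: complex. poly (map_poly complex_of_real Pm) z = 0}"
    using Pm_root by (intro card_mono poly_roots_finite[OF nzc]) (auto simp: rpoly_def)
  also have "\<dots> \<le> degree Pm" using card_poly_roots_bound[OF nzc] by (simp add: degree_map_poly)
  finally have dPm: "card Z \<le> degree Pm" using cardfZ by simp
  have "card X \<le> card {x. poly qn x = 0}"
    using qn_root by (intro card_mono poly_roots_finite[OF nz(2)]) auto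
  also have "\<dots> \<le> degree qn" by (rule card_poly_roots_bound[OF nz(2)])
  finally have dqn: "n \<le> degree qn" using n(3) by simp
  have le: "degree Pm \<le> card (f ` Z)" "degree qn \<le> card X" using deg dPm dqn cardfZ n(3) by auto
  obtain c where c: "c \<noteq> 0" "qn = Polynomial.smult c (\<Prod>a\<in>X. [:- a, 1:])"
    using poly_eq_prod_roots[OF nz(2) n(2) qn_root le(2)] by blast
  have "degree (map_poly complex_of_real Pm) \<le> card (f ` Z)" using le(1) by (simp add: degree_map_poly)
  from poly_eq_prod_roots[OF nzc finite_imageI[OF finite_Z] _ this]
  obtain c' where c': "map_poly complex_of_real Pm = Polynomial.smult c' (\<Prod>a\<in>f ` Z. [:- a, 1:])"
    using Pm_root unfolding rpoly_def by blast
  have Xq: "{x. poly qn x = 0} = X"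
    unfolding c(2) using c(1) n(2) by (auto simp: poly_prod)
  have Pm_real: "poly Pm x \<noteq> 0" for x
    using Pm_nr[of "of_real x"] by auto
  let ?D = "\<lambda>p x. (poly (pderiv (pderiv p)) x * poly p x - (poly (pderiv p) x)\<^sup>2) / (poly p x)\<^sup>2"
  \<comment> \<open>Both terms are minus a sum of inverse squared distances to simple zeros. All
    these zeros keep the distance \<open>d\<close> from the real axis, so moving one of them by less
    than \<open>e\<close> changes its summand by at most \<open>2 * e / d ^ 3\<close>.\<close>
  have small: "?D Pm x - ?D W x < 1" for x
  proof -
    let ?y = "complex_of_real x"
    have A: "complex_of_real (?D Pm x) = - (\<Sum>\<zeta>\<in>Z. 1 / (?y - f \<zeta>)\<^sup>2)"
      using log_deriv_deriv_eq_sum[OF c' finite_imageI[OF finite_Z] Pm_real] by (simp add: sum.reindex[OF n(4)])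
    have B: "complex_of_real (?D W x) = - (\<Sum>\<zeta>\<in>Z. 1 / (?y - \<zeta>)\<^sup>2)"
      by (rule log_deriv_deriv_eq_sum[OF W_decompose(2)[OF sqf] finite_Z W_real])
    have "complex_of_real (?D Pm x - ?D W x) = (\<Sum>\<zeta>\<in>Z. 1 / (?y - \<zeta>)\<^sup>2 - 1 / (?y - f \<zeta>)\<^sup>2)"
      unfolding of_real_diff A B sum_subtractf by simp
    also have "norm \<dots> \<le> (\<Sum>\<zeta>\<in>Z. 2 * e / d ^ 3)"
    proof (rule sum_norm_le)
      fix \<zeta> assume \<zeta>: "\<zeta> \<in> Z"
      have 1: "2 * d \<le> norm (?y - \<zeta>)"
        using d(2)[OF \<zeta>] abs_Im_le_cmod[of "?y - \<zeta>"] by simp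
      have 2: "d \<le> norm (?y - f \<zeta>)"
        using 1 n(6)[OF \<zeta>] e(1) norm_triangle_ineq[of "?y - f \<zeta>" "f \<zeta> - \<zeta>"] by (simp add: dist_norm)
      have "norm (1 / (?y - \<zeta>)\<^sup>2 - 1 / (?y - f \<zeta>)\<^sup>2) \<le> 2 * norm (\<zeta> - f \<zeta>) / d ^ 3"
        using 1 2 d(1) by (intro inverse_square_diff_bound) auto
      also have "\<dots> \<le> 2 * e / d ^ 3"
        using n(6)[OF \<zeta>] d(1) by (intro divide_right_mono) (auto simp: dist_norm norm_minus_commute)
      finally show "norm (1 / (?y - \<zeta>)\<^sup>2 - 1 / (?y - f \<zeta>)\<^sup>2) \<le> 2 * e / d ^ 3" .
    qed
    also have "\<dots> < 1" using e(2) by simp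
    finally have "\<bar>?D Pm x - ?D W x\<bar> < 1" by (simp only: norm_of_real)
    then show ?thesis by (rule le_less_trans[OF abs_ge_self])
  qed
  have crit: "weight_log_deriv Pm x + 2 * (\<Sum>b\<in>X - {x}. 1 / (x - b)) = 0" if "x \<in> X" for x
    unfolding weight_log_deriv_def
  proof (rule root_log_deriv_sum[OF Pf c(2) n(2) that c(1) Pm_real W_real])
    have "poly (P n) x = 0" using qn_root[OF that] by (simp add: Pf)
    moreover have "hdet r (\<kappa>(r := n + r)) id = W" unfolding W_def by (rule hdet_cong) auto
    ultimately show "poly W x * poly (pderiv (pderiv (P n))) x = 2 * (x * poly W x + poly (pderiv W) x) * poly (pderiv (P n)) x"
      using exc_root_ode[of r "\<kappa>(r := n + r)" x] W_real[of x] unfolding P_def by simp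
  qed
  have "0 < weight Pm x" for x using Pm_real[of x] W_real[of x] by (simp add: weight_def)
  from energy_unique_maximum[of "weight Pm" "weight_log_deriv Pm" X n, OF this weight_tangent[OF Pm_real small] n(2,3) crit]
  show ?thesis unfolding Xq by blast
qed

lemma eventually_energy_maximum:
  assumes sqf: "rsquarefree (map_poly complex_of_real W)"
  shows "\<forall>\<^sub>F n in sequentially. \<forall>Pm qn. nonreal_real_factorization (P n) Pm qn \<longrightarrow>
    (\<exists>u. attains_max_at (log_energy (weight Pm) n) (real_space n) u) \<and>
    (\<forall>u. attains_max_at (log_energy (weight Pm) n) (real_space n) u \<longrightarrow> u ` {..<n} = {x. poly qn x = 0})"
proof -
  have "\<forall>y\<in>(\<lambda>\<zeta>. \<bar>Im \<zeta>\<bar> / 2) ` Z. 0 < y" using Z_nonreal by auto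
  from finite_pos_lower_bound[OF finite_imageI[OF finite_Z] this]
  obtain d where d: "0 < d" "\<forall>y\<in>(\<lambda>\<zeta>. \<bar>Im \<zeta>\<bar> / 2) ` Z. d \<le> y" by (elim exE conjE)
  have d2: "2 * d \<le> \<bar>Im \<zeta>\<bar>" if "\<zeta> \<in> Z" for \<zeta> using bspec[OF d(2) imageI[OF that]] by simp
  define k where "k = real (card Z)"
  \<comment> \<open>Makes the total change at most \<open>k / (k + 1)\<close>; adding 1 to
    \<open>k\<close> gives strictness and covers \<open>k = 0\<close>.\<close>
  define e where "e = min d (d ^ 3 / (2 * (k + 1)))"
  have k: "0 \<le> k" by (simp add: k_def)
  have e: "0 < e" "e \<le> d" using d(1) k by (auto simp: e_def)
  have "k * (2 * e / d ^ 3) \<le> k * (2 * (d ^ 3 / (2 * (k + 1))) / d ^ 3)"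
    using d(1) k by (intro mult_left_mono divide_right_mono) (auto simp: e_def)
  also have "2 * (d ^ 3 / (2 * (k + 1))) / d ^ 3 = 1 / (k + 1)"
    using d(1) k by (auto simp: divide_simps)
  also have "k * (1 / (k + 1)) < 1" using k by simp
  finally have e1: "real (card Z) * (2 * e / d ^ 3) < 1" by (simp only: k_def)
  show ?thesis
    using eventually_P_zeros[OF sqf e(1)]
  proof eventually_elim
    case (elim n)
    then obtain X f where n: "P n \<noteq> 0" "finite X" "card X = n" "inj_on f Z"
      "\<And>\<zeta>. \<zeta> \<in> Z \<Longrightarrow> Im (f \<zeta>) \<noteq> 0" "\<And>\<zeta>. \<zeta> \<in> Z \<Longrightarrow> dist (f \<zeta>) \<zeta> < e"
      "{z. rpoly (P n) z = 0} = of_real ` X \<union> f ` Z" by metis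
    show ?case
      by (intro allI impI energy_maximum_of_zeros[OF sqf d(1) d2 e(2) e1 n])
  qed
qed

end

section \<open>The exponents belonging to an even partition\<close>

lemma length_hermite_seq [simp]: "length (hermite_seq la) = length la"
  by (simp add: hermite_seq_def)

lemma gen_hermite_eq_hdet: "gen_hermite la = hdet (length la) (\<lambda>k. rev la ! k + k) id"
  unfolding gen_hermite_def wronskian_def hdet_def fdet_def
  by (intro arg_cong[of _ _ Determinant.det] eq_matI) (auto simp: hermite_seq_def)

lemma exc_hermite_eq_hdet:
  "exc_hermite la n = hdet (Suc (length la)) ((\<lambda>k. rev la ! k + k)(length la := n + length la)) id"
  unfolding exc_hermite_def wronskian_def hdet_def fdet_def
  by (intro arg_cong[of _ _ Determinant.det] eq_matI) (auto simp: hermite_seq_def nth_append less_Suc_eq)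

lemma partition_list_strict_mono:
  assumes "partition_list la" "i < j" "j < length la"
  shows "rev la ! i + i < rev la ! j + j"
proof -
  have "sorted_wrt (\<le>) (rev la)" using assms(1) by (simp add: partition_list_def sorted_wrt_rev)
  then have "rev la ! i \<le> rev la ! j" using assms(2,3) by (simp add: sorted_wrt_nth_less)
  then show ?thesis using assms(2) by linarith
qed

lemma partition_list_inj:
  assumes "partition_list la"
  shows "inj_on (\<lambda>k. rev la ! k + k) {..<length la}"
proof (rule linorder_inj_onI)
  fix x y assume "x < y" "x \<in> {..<length la}" "y \<in> {..<length la}"
  then show "rev la ! x + x \<noteq> rev la ! y + y" using partition_list_strict_mono[OF assms, of x y] by simp
qed auto

lemma even_partition_pairs:
  assumes "even_partition la" "2 * k < length la"
  shows "rev la ! (2 * k) = rev la ! Suc (2 * k)"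
proof -
  obtain p where p: "length la = 2 * p" using assms(1) by (auto simp: even_partition_def)
  \<comment> \<open>Pair \<open>k\<close> of the reversed list, counted from 0, is pair
    \<open>p - k\<close> of \<open>la\<close>, counted from 1, with its two entries
    exchanged.\<close>
  define l where "l = p - k"
  have l: "l \<in> {1..length la div 2}" "Suc k + l = Suc p" using assms(2) p by (auto simp: l_def)
  then have "la ! (2 * l - 1 - 1) = la ! (2 * l - 1)" using assms(1) by (auto simp: even_partition_def)
  moreover have "rev la ! (2 * k) = la ! (2 * l - 1)"
    using l p assms(2) by (subst rev_nth) (auto intro!: arg_cong[of _ _ "\<lambda>i. la ! i"])
  moreover have "rev la ! Suc (2 * k) = la ! (2 * l - 1 - 1)"
    using l p assms(2) by (subst rev_nth) (auto intro!: arg_cong[of _ _ "\<lambda>i. la ! i"])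
  ultimately show ?thesis by simp
qed

text \<open>Two equal parts give consecutive exponents, and no gap fits between these. So the
  exponents above a gap come in complete pairs, which is the condition of
  \<open>krein_adler\<close>.\<close>

lemma even_partition_gaps:
  assumes "even_partition la"
  defines "K \<equiv> (\<lambda>k. rev la ! k + k) ` {..<length la}"
  assumes "j \<notin> K"
  shows "even (card {k \<in> K. j < k})"
proof -
  let ?\<kappa> = "\<lambda>k. rev la ! k + k"
  have pl: "partition_list la" using assms(1) by (simp add: even_partition_def)
  obtain p where p: "length la = 2 * p" using assms(1) by (auto simp: even_partition_def)
  note inj = partition_list_inj[OF pl]
  define B where "B = {k. k < p \<and> j < ?\<kappa> (2 * k)}"
  have pair: "?\<kappa> (Suc (2 * k)) = Suc (?\<kappa> (2 * k))" if "k < p" for k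
    using even_partition_pairs[OF assms(1), of k] that p by simp
  have iff: "j < ?\<kappa> (Suc (2 * k)) \<longleftrightarrow> j < ?\<kappa> (2 * k)" if "k < p" for k
  proof -
    have "?\<kappa> (2 * k) \<in> K" using that p by (auto simp: K_def)
    then have "j \<noteq> ?\<kappa> (2 * k)" using assms(3) by auto
    then show ?thesis unfolding pair[OF that] by linarith
  qed
  have "{i. i < length la \<and> j < ?\<kappa> i} = (\<lambda>k. 2 * k) ` B \<union> (\<lambda>k. Suc (2 * k)) ` B"
  proof (intro equalityI subsetI)
    fix i assume i: "i \<in> {i. i < length la \<and> j < ?\<kappa> i}"
    define k where "k = i div 2"
    have k: "k < p" using i p by (auto simp: k_def)
    have "i = 2 * k \<or> i = Suc (2 * k)" by (auto simp: k_def)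
    then show "i \<in> (\<lambda>k. 2 * k) ` B \<union> (\<lambda>k. Suc (2 * k)) ` B"
    proof
      assume "i = 2 * k"
      with i k have "k \<in> B" by (simp add: B_def)
      with \<open>i = 2 * k\<close> show ?thesis by blast
    next
      assume ik: "i = Suc (2 * k)"
      have "j < ?\<kappa> i" using i by simp
      then have "j < ?\<kappa> (2 * k)" unfolding ik iff[OF k] .
      with k have "k \<in> B" by (simp add: B_def)
      with ik show ?thesis by blast
    qed
  next
    fix i assume "i \<in> (\<lambda>k. 2 * k) ` B \<union> (\<lambda>k. Suc (2 * k)) ` B"
    then obtain k where k: "k \<in> B" "i = 2 * k \<or> i = Suc (2 * k)" by blast
    have kp: "k < p" "j < ?\<kappa> (2 * k)" using k(1) by (auto simp: B_def)
    have "j < ?\<kappa> i" using k(2) kp(2) iff[OF kp(1)] by (elim disjE) (simp_all only:)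
    moreover have "i < length la" using k(2) kp(1) p by auto
    ultimately show "i \<in> {i. i < length la \<and> j < ?\<kappa> i}" by blast
  qed
  moreover have "card ((\<lambda>k. 2 * k) ` B \<union> (\<lambda>k. Suc (2 * k)) ` B) = card B + card B"
  proof -
    have fB: "finite B" by (simp add: B_def)
    have "(\<lambda>k. 2 * k) ` B \<inter> (\<lambda>k. Suc (2 * k)) ` B = {}"
      by (auto simp: image_iff) presburger
    moreover have "card ((\<lambda>k. 2 * k) ` B) = card B" "card ((\<lambda>k. Suc (2 * k)) ` B) = card B"
      by (auto intro!: card_image simp: inj_on_def)
    ultimately show ?thesis using fB by (subst card_Un_disjoint) auto
  qed
  moreover have "{k \<in> K. j < k} = ?\<kappa> ` {i. i < length la \<and> j < ?\<kappa> i}" by (auto simp: K_def)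
  moreover have "inj_on ?\<kappa> {i. i < length la \<and> j < ?\<kappa> i}" by (rule inj_on_subset[OF inj]) auto
  ultimately show ?thesis by (simp add: card_image)
qed

theorem mainTheorem4:
  fixes la :: "nat list"
  assumes "even_partition la"
    and "rsquarefree (map_poly complex_of_real (gen_hermite la))"
  shows "\<forall>\<^sub>F n in sequentially. \<forall>Pm qn :: real poly.
    nonreal_real_factorization (exc_hermite la n) Pm qn \<longrightarrow>
      (\<exists>u. attains_max_at (log_energy (\<lambda>x. exc_weight la x * (poly Pm x)\<^sup>2) n) (real_space n) u) \<and>
      (\<forall>u. attains_max_at (log_energy (\<lambda>x. exc_weight la x * (poly Pm x)\<^sup>2) n) (real_space n) u \<longrightarrow>
         u ` {..<n} = {x. poly qn x = 0})"
proof -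
  let ?\<kappa> = "\<lambda>k. rev la ! k + k"
  have inj: "inj_on ?\<kappa> {..<length la}"
    using assms(1) by (intro partition_list_inj) (simp add: even_partition_def)
  interpret zero_free_wronskian "length la" ?\<kappa>
    by unfold_locales (fact inj, rule krein_adler[OF inj even_partition_gaps[OF assms(1)]])
  have W: "W = gen_hermite la" unfolding W_def gen_hermite_eq_hdet ..
  have P: "P n = exc_hermite la n" for n unfolding P_def exc_hermite_eq_hdet ..
  have weight: "weight Pm = (\<lambda>x. exc_weight la x * (poly Pm x)\<^sup>2)" for Pm
    by (rule ext) (simp add: weight_def exc_weight_def W)
  show ?thesis
    using eventually_energy_maximum unfolding W P weight using assms(2) by blast
qed

end
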